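(* Let $k$ be a field, $\mathcal C$ a Hom-finite Krull--Schmidt $k$-category, $\Gamma$ a finite group whose order is not divisible by the characteristic of $k$, acting on $\mathcal C$, and let $H$ be a normal subgroup of $\Gamma$. The action of $\Gamma$ on $\mathcal C$ induces an action of $H$ on $\mathcal C$. Then: 1. The action of $\Gamma$ on $\mathcal C$ extends to an action of $\Gamma$ on $\mathcal CH$ (compatible with the forgetful functor $\mathcal CH\to\mathcal C$). 2. For every $h\in H$, there is an isomorphism of functors from $\mathbf h\otimes-:\mathcal CH\to\mathcal CH$ to $\mathrm{id}_{\mathcal CH}$. 3. The action of $\Gamma$ on $\mathcal CH$ induces an action of $\Gamma/H$ on $\mathcal CH$ (the class of $g$ acting by a functor isomorphic to $\mathbf g\otimes-$). 4. There is an equivalence of categories between $(\mathcal CH)(\Gamma/H)$ and $\mathcal C\Gamma$.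
   Context: $k$-category means $k$-linear additive category; Krull--Schmidt means idempotents split and indecomposable objects have local endomorphism rings. An action of a finite group $G$ on a category $\mathcal D$ is a structure of module category over the monoidal category $\mathrm{mod}\,k(G)$, where $k(G)$ is the Hopf algebra of $k$-valued functions on $G$; its simple modules are denoted $\mathbf g$ ($g\in G$), with $\mathbf g\otimes\mathbf h=\mathbf{gh}$. So one has $k$-linear auto-equivalences $\mathbf g\otimes-$ of $\mathcal D$ and coherent natural structural isomorphisms $\alpha:\mathbf{gh}\otimes X\to\mathbf g\otimes(\mathbf h\otimes X)$ and $\mathbf 1\otimes X\to X$. The $G$-equivariant category $\mathcal DG$ has as objects the pairs $(X,\psi)$, $X\in\mathcal D$, $\psi=(\psi_g:\mathbf g\otimes X\to X)_{g\in G}$ a family of isomorphisms such that $\psi_{gh}=\psi_g\circ(\mathrm{id}_{\mathbf g}\otimes\psi_h)\circ\alpha$ for all $g,h\in G$ and $\psi_e:\mathbf 1\otimes X\to X$ is the structural isomorphism. Morphisms $(X,\psi)\to(Y,\chi)$ are the morphisms $f:X\to Y$ of $\mathcal D$ with $f\circ\psi_g=\chi_g\circ(\mathrm{id}_{\mathbf g}\otimes f)$ for all $g$. *)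

theory Defs
  imports Complex_Main "HOL-Algebra.Coset" "HOL-Algebra.Ring"
begin

section \<open>Linear categories\<close>

text \<open>
  All morphism spaces live in one ambient \<open>k\<close>-vector space, the type \<open>'m\<close>
  with scalar multiplication \<open>Scale\<close>; each \<open>Hom C X Y\<close> is a linear subspace of it.
  This is no restriction: the morphism spaces of a linear category embed into their direct sum.
  Different morphism spaces are not required to be disjoint, so a morphism need not determine
  its source and target.  Accordingly identities are indexed by objects, and functors act on
  morphisms together with their source and target.
\<close>

record ('k, 'o, 'm) lin_cat =
  Obj :: "'o set"
  Hom :: "'o \<Rightarrow> 'o \<Rightarrow> 'm set"
  Id :: "'o \<Rightarrow> 'm"
  Comp :: "'m \<Rightarrow> 'm \<Rightarrow> 'm" (infixl \<open>\<odot>\<index>\<close> 70)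
  Scale :: "'k \<Rightarrow> 'm \<Rightarrow> 'm"

locale linear_category =
  vector_space "Scale C" for C :: "('k::field, 'o, 'm::ab_group_add) lin_cat" (structure) +
  assumes Hom_subspace: "\<lbrakk>X \<in> Obj C; Y \<in> Obj C\<rbrakk> \<Longrightarrow> subspace (Hom C X Y)"
    and Id_in_Hom: "X \<in> Obj C \<Longrightarrow> Id C X \<in> Hom C X X"
    and Comp_in_Hom: "\<lbrakk>X \<in> Obj C; Y \<in> Obj C; Z \<in> Obj C; f \<in> Hom C X Y; g \<in> Hom C Y Z\<rbrakk>
      \<Longrightarrow> g \<odot> f \<in> Hom C X Z"
    and Comp_assoc: "\<lbrakk>X \<in> Obj C; Y \<in> Obj C; Z \<in> Obj C; W \<in> Obj C;
        f \<in> Hom C X Y; g \<in> Hom C Y Z; h \<in> Hom C Z W\<rbrakk> \<Longrightarrow> (h \<odot> g) \<odot> f = h \<odot> (g \<odot> f)"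
    and Comp_Id_right: "\<lbrakk>X \<in> Obj C; Y \<in> Obj C; f \<in> Hom C X Y\<rbrakk> \<Longrightarrow> f \<odot> Id C X = f"
    and Comp_Id_left: "\<lbrakk>X \<in> Obj C; Y \<in> Obj C; f \<in> Hom C X Y\<rbrakk> \<Longrightarrow> Id C Y \<odot> f = f"
    and Comp_add_right: "\<lbrakk>X \<in> Obj C; Y \<in> Obj C; Z \<in> Obj C;
        f \<in> Hom C X Y; f' \<in> Hom C X Y; g \<in> Hom C Y Z\<rbrakk> \<Longrightarrow> g \<odot> (f + f') = g \<odot> f + g \<odot> f'"
    and Comp_add_left: "\<lbrakk>X \<in> Obj C; Y \<in> Obj C; Z \<in> Obj C;
        f \<in> Hom C X Y; g \<in> Hom C Y Z; g' \<in> Hom C Y Z\<rbrakk> \<Longrightarrow> (g + g') \<odot> f = g \<odot> f + g' \<odot> f"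
    and Comp_scale_right: "\<lbrakk>X \<in> Obj C; Y \<in> Obj C; Z \<in> Obj C; f \<in> Hom C X Y; g \<in> Hom C Y Z\<rbrakk>
      \<Longrightarrow> g \<odot> Scale C a f = Scale C a (g \<odot> f)"
    and Comp_scale_left: "\<lbrakk>X \<in> Obj C; Y \<in> Obj C; Z \<in> Obj C; f \<in> Hom C X Y; g \<in> Hom C Y Z\<rbrakk>
      \<Longrightarrow> Scale C a g \<odot> f = Scale C a (g \<odot> f)"

definition Isos :: "('k, 'o, 'm) lin_cat \<Rightarrow> 'o \<Rightarrow> 'o \<Rightarrow> 'm set" where
  "Isos C X Y = {f \<in> Hom C X Y. \<exists>g \<in> Hom C Y X. g \<odot>\<^bsub>C\<^esub> f = Id C X \<and> f \<odot>\<^bsub>C\<^esub> g = Id C Y}"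

definition zero_object :: "('k, 'o, 'm::ab_group_add) lin_cat \<Rightarrow> 'o \<Rightarrow> bool" where
  "zero_object C Z \<longleftrightarrow> Z \<in> Obj C \<and> (\<forall>X \<in> Obj C. Hom C X Z = {0} \<and> Hom C Z X = {0})"

definition biproduct :: "('k, 'o, 'm::ab_group_add) lin_cat \<Rightarrow> 'o \<Rightarrow> 'o \<Rightarrow> 'o \<Rightarrow> bool" where
  "biproduct C X Y S \<longleftrightarrow> X \<in> Obj C \<and> Y \<in> Obj C \<and> S \<in> Obj C \<and>
     (\<exists>i \<in> Hom C X S. \<exists>j \<in> Hom C Y S. \<exists>p \<in> Hom C S X. \<exists>q \<in> Hom C S Y.
        p \<odot>\<^bsub>C\<^esub> i = Id C X \<and> q \<odot>\<^bsub>C\<^esub> j = Id C Y \<and> p \<odot>\<^bsub>C\<^esub> j = 0 \<and> q \<odot>\<^bsub>C\<^esub> i = 0 \<and>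
        i \<odot>\<^bsub>C\<^esub> p + j \<odot>\<^bsub>C\<^esub> q = Id C S)"

text \<open>A \<open>k\<close>-category: linear and additive.\<close>

locale k_category = linear_category +
  assumes has_zero_object: "\<exists>Z. zero_object C Z"
    and has_biproducts: "\<lbrakk>X \<in> Obj C; Y \<in> Obj C\<rbrakk> \<Longrightarrow> \<exists>S. biproduct C X Y S"

definition Hom_finite :: "('k::field, 'o, 'm::ab_group_add) lin_cat \<Rightarrow> bool" where
  "Hom_finite C \<longleftrightarrow>
     (\<forall>X \<in> Obj C. \<forall>Y \<in> Obj C. \<exists>B. finite B \<and> Hom C X Y = module.span (Scale C) B)"

definition End_ring :: "('k, 'o, 'm::ab_group_add) lin_cat \<Rightarrow> 'o \<Rightarrow> 'm ring" where
  "End_ring C X = \<lparr>carrier = Hom C X X, monoid.mult = Comp C, one = Id C X, zero = 0, add = (+)\<rparr>"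

definition local_ring :: "('a, 'b) ring_scheme \<Rightarrow> bool" where
  "local_ring R \<longleftrightarrow> ring R \<and> \<one>\<^bsub>R\<^esub> \<noteq> \<zero>\<^bsub>R\<^esub> \<and>
     (\<forall>a \<in> carrier R. \<forall>b \<in> carrier R. a \<notin> Units R \<longrightarrow> b \<notin> Units R \<longrightarrow> a \<oplus>\<^bsub>R\<^esub> b \<notin> Units R)"

definition indecomposable :: "('k, 'o, 'm::ab_group_add) lin_cat \<Rightarrow> 'o \<Rightarrow> bool" where
  "indecomposable C X \<longleftrightarrow> X \<in> Obj C \<and> \<not> zero_object C X \<and>
     (\<forall>Y Z. biproduct C Y Z X \<longrightarrow> zero_object C Y \<or> zero_object C Z)"

definition idempotents_split :: "('k, 'o, 'm) lin_cat \<Rightarrow> bool" where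
  "idempotents_split C \<longleftrightarrow> (\<forall>X \<in> Obj C. \<forall>e \<in> Hom C X X. e \<odot>\<^bsub>C\<^esub> e = e \<longrightarrow>
     (\<exists>Y \<in> Obj C. \<exists>p \<in> Hom C X Y. \<exists>i \<in> Hom C Y X. p \<odot>\<^bsub>C\<^esub> i = Id C Y \<and> i \<odot>\<^bsub>C\<^esub> p = e))"

definition Krull_Schmidt :: "('k, 'o, 'm::ab_group_add) lin_cat \<Rightarrow> bool" where
  "Krull_Schmidt C \<longleftrightarrow>
     idempotents_split C \<and> (\<forall>X. indecomposable C X \<longrightarrow> local_ring (End_ring C X))"

section \<open>Functors and natural isomorphisms\<close>

record ('o, 'm, 'p, 'n) funct =
  on_obj :: "'o \<Rightarrow> 'p"
  on_mor :: "'o \<Rightarrow> 'o \<Rightarrow> 'm \<Rightarrow> 'n"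

locale linear_functor =
  source: linear_category C + target: linear_category D
  for C :: "('k::field, 'o, 'm::ab_group_add) lin_cat"
    and D :: "('k, 'p, 'n::ab_group_add) lin_cat"
    and F :: "('o, 'm, 'p, 'n) funct" +
  assumes on_obj_closed: "X \<in> Obj C \<Longrightarrow> on_obj F X \<in> Obj D"
    and on_mor_closed: "\<lbrakk>X \<in> Obj C; Y \<in> Obj C; f \<in> Hom C X Y\<rbrakk>
      \<Longrightarrow> on_mor F X Y f \<in> Hom D (on_obj F X) (on_obj F Y)"
    and on_mor_Id: "X \<in> Obj C \<Longrightarrow> on_mor F X X (Id C X) = Id D (on_obj F X)"
    and on_mor_Comp: "\<lbrakk>X \<in> Obj C; Y \<in> Obj C; Z \<in> Obj C; f \<in> Hom C X Y; g \<in> Hom C Y Z\<rbrakk>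
      \<Longrightarrow> on_mor F X Z (g \<odot>\<^bsub>C\<^esub> f) = on_mor F Y Z g \<odot>\<^bsub>D\<^esub> on_mor F X Y f"
    and on_mor_add: "\<lbrakk>X \<in> Obj C; Y \<in> Obj C; f \<in> Hom C X Y; g \<in> Hom C X Y\<rbrakk>
      \<Longrightarrow> on_mor F X Y (f + g) = on_mor F X Y f + on_mor F X Y g"
    and on_mor_scale: "\<lbrakk>X \<in> Obj C; Y \<in> Obj C; f \<in> Hom C X Y\<rbrakk>
      \<Longrightarrow> on_mor F X Y (Scale C a f) = Scale D a (on_mor F X Y f)"

definition id_funct :: "('o, 'm, 'o, 'm) funct" where
  "id_funct = \<lparr>on_obj = (\<lambda>X. X), on_mor = (\<lambda>X Y f. f)\<rparr>"

definition comp_funct ::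
  "('p, 'n, 'q, 'l) funct \<Rightarrow> ('o, 'm, 'p, 'n) funct \<Rightarrow> ('o, 'm, 'q, 'l) funct" where
  "comp_funct G F = \<lparr>on_obj = (\<lambda>X. on_obj G (on_obj F X)),
     on_mor = (\<lambda>X Y f. on_mor G (on_obj F X) (on_obj F Y) (on_mor F X Y f))\<rparr>"

definition natural_iso :: "('k, 'o, 'm) lin_cat \<Rightarrow> ('k, 'p, 'n) lin_cat \<Rightarrow>
    ('o, 'm, 'p, 'n) funct \<Rightarrow> ('o, 'm, 'p, 'n) funct \<Rightarrow> ('o \<Rightarrow> 'n) \<Rightarrow> bool" where
  "natural_iso C D F G \<eta> \<longleftrightarrow>
     (\<forall>X \<in> Obj C. \<eta> X \<in> Isos D (on_obj F X) (on_obj G X)) \<and>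
     (\<forall>X \<in> Obj C. \<forall>Y \<in> Obj C. \<forall>f \<in> Hom C X Y.
        \<eta> Y \<odot>\<^bsub>D\<^esub> on_mor F X Y f = on_mor G X Y f \<odot>\<^bsub>D\<^esub> \<eta> X)"

definition isomorphic_functors :: "('k, 'o, 'm) lin_cat \<Rightarrow> ('k, 'p, 'n) lin_cat \<Rightarrow>
    ('o, 'm, 'p, 'n) funct \<Rightarrow> ('o, 'm, 'p, 'n) funct \<Rightarrow> bool" where
  "isomorphic_functors C D F G \<longleftrightarrow> (\<exists>\<eta>. natural_iso C D F G \<eta>)"

definition equivalent_categories ::
  "('k::field, 'o, 'm::ab_group_add) lin_cat \<Rightarrow> ('k, 'p, 'n::ab_group_add) lin_cat \<Rightarrow> bool" where
  "equivalent_categories C D \<longleftrightarrow> (\<exists>F G. linear_functor C D F \<and> linear_functor D C G \<and>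
     isomorphic_functors C C (comp_funct G F) id_funct \<and>
     isomorphic_functors D D (comp_funct F G) id_funct)"

section \<open>Group actions\<close>

text \<open>
  \<open>act A g\<close> is the functor \<open>g \<otimes> -\<close>, \<open>assoc A g h X\<close> is the structural isomorphism
  \<open>\<alpha> : gh \<otimes> X \<rightarrow> g \<otimes> (h \<otimes> X)\<close> and \<open>unitor A X\<close> is \<open>1 \<otimes> X \<rightarrow> X\<close>.
\<close>

record ('g, 'o, 'm) cat_action =
  act :: "'g \<Rightarrow> ('o, 'm, 'o, 'm) funct"
  assoc :: "'g \<Rightarrow> 'g \<Rightarrow> 'o \<Rightarrow> 'm"
  unitor :: "'o \<Rightarrow> 'm"

text \<open>
  A module category over \<open>mod k(G)\<close>, described on the simple modules: every object of
  \<open>mod k(G)\<close> is a direct sum of simple modules, there are only scalar morphisms between these,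
  and the associativity and unit isomorphisms of \<open>mod k(G)\<close> are identities on them.
  The axioms are the pentagon and the triangle; the second unit axiom follows from
  the other two and is included for convenience.  That each \<open>act A g\<close> is an
  auto-equivalence is a consequence, with quasi-inverse \<open>act A (inv g)\<close>.
\<close>

locale category_action = group G + k_category D
  for G :: "('g, 'b) monoid_scheme"
    and D :: "('k::field, 'o, 'm::ab_group_add) lin_cat"
    and A :: "('g, 'o, 'm) cat_action" +
  assumes act_linear_functor: "g \<in> carrier G \<Longrightarrow> linear_functor D D (act A g)"
    and assoc_natural_iso: "\<lbrakk>g \<in> carrier G; h \<in> carrier G\<rbrakk>
      \<Longrightarrow> natural_iso D D (act A (g \<otimes>\<^bsub>G\<^esub> h)) (comp_funct (act A g) (act A h)) (assoc A g h)"
    and unitor_natural_iso: "natural_iso D D (act A \<one>\<^bsub>G\<^esub>) id_funct (unitor A)"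
    and pentagon: "\<lbrakk>g \<in> carrier G; h \<in> carrier G; l \<in> carrier G; X \<in> Obj D\<rbrakk>
      \<Longrightarrow> assoc A g h (on_obj (act A l) X) \<odot>\<^bsub>D\<^esub> assoc A (g \<otimes>\<^bsub>G\<^esub> h) l X =
          on_mor (act A g) (on_obj (act A (h \<otimes>\<^bsub>G\<^esub> l)) X)
              (on_obj (act A h) (on_obj (act A l) X)) (assoc A h l X)
            \<odot>\<^bsub>D\<^esub> assoc A g (h \<otimes>\<^bsub>G\<^esub> l) X"
    and triangle: "\<lbrakk>g \<in> carrier G; X \<in> Obj D\<rbrakk>
      \<Longrightarrow> on_mor (act A g) (on_obj (act A \<one>\<^bsub>G\<^esub>) X) X (unitor A X) \<odot>\<^bsub>D\<^esub> assoc A g \<one>\<^bsub>G\<^esub> X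
          = Id D (on_obj (act A g) X)"
    and left_triangle: "\<lbrakk>g \<in> carrier G; X \<in> Obj D\<rbrakk>
      \<Longrightarrow> unitor A (on_obj (act A g) X) \<odot>\<^bsub>D\<^esub> assoc A \<one>\<^bsub>G\<^esub> g X = Id D (on_obj (act A g) X)"

section \<open>Equivariant categories\<close>

text \<open>
  Families \<open>\<psi>\<close> indexed by the group are extensional functions on its carrier, so that an object
  is determined by \<open>X\<close> and the morphisms \<open>\<psi>\<^sub>g\<close>, \<open>g \<in> G\<close>.
\<close>

definition equivariant_structures :: "('g, 'b) monoid_scheme \<Rightarrow> ('k, 'o, 'm) lin_cat \<Rightarrow>
    ('g, 'o, 'm) cat_action \<Rightarrow> 'o \<Rightarrow> ('g \<Rightarrow> 'm) set" where
  "equivariant_structures G D A X =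
     {\<psi> \<in> (\<Pi>\<^sub>E g \<in> carrier G. Isos D (on_obj (act A g) X) X).
        (\<forall>g \<in> carrier G. \<forall>h \<in> carrier G. \<psi> (g \<otimes>\<^bsub>G\<^esub> h) =
           \<psi> g \<odot>\<^bsub>D\<^esub> on_mor (act A g) (on_obj (act A h) X) X (\<psi> h) \<odot>\<^bsub>D\<^esub> assoc A g h X) \<and>
        \<psi> \<one>\<^bsub>G\<^esub> = unitor A X}"

definition equivariant_category :: "('g, 'b) monoid_scheme \<Rightarrow> ('k, 'o, 'm) lin_cat \<Rightarrow>
    ('g, 'o, 'm) cat_action \<Rightarrow> ('k, 'o \<times> ('g \<Rightarrow> 'm), 'm) lin_cat" where
  "equivariant_category G D A = \<lparr>
     Obj = {(X, \<psi>). X \<in> Obj D \<and> \<psi> \<in> equivariant_structures G D A X},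
     Hom = (\<lambda>(X, \<psi>) (Y, \<chi>).
       {f \<in> Hom D X Y. \<forall>g \<in> carrier G. f \<odot>\<^bsub>D\<^esub> \<psi> g = \<chi> g \<odot>\<^bsub>D\<^esub> on_mor (act A g) X Y f}),
     Id = (\<lambda>(X, \<psi>). Id D X),
     Comp = Comp D,
     Scale = Scale D\<rparr>"

text \<open>
  Compatibility of an action \<open>B\<close> on an equivariant category with an action \<open>A\<close> on the underlying
  category: the forgetful functor \<open>(X, \<psi>) \<mapsto> X\<close>, \<open>f \<mapsto> f\<close> commutes strictly with the action
  functors and with the structural isomorphisms.
\<close>

definition forgetful :: "('o \<times> 'x, 'm, 'o, 'm) funct" where
  "forgetful = \<lparr>on_obj = fst, on_mor = (\<lambda>X Y f. f)\<rparr>"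

definition forgetful_compatible :: "('g, 'b) monoid_scheme \<Rightarrow> ('k, 'o \<times> 'x, 'm) lin_cat \<Rightarrow>
    ('g, 'o \<times> 'x, 'm) cat_action \<Rightarrow> ('g, 'o, 'm) cat_action \<Rightarrow> bool" where
  "forgetful_compatible G E B A \<longleftrightarrow>
     (\<forall>g \<in> carrier G. \<forall>X \<in> Obj E.
        on_obj (comp_funct forgetful (act B g)) X = on_obj (comp_funct (act A g) forgetful) X) \<and>
     (\<forall>g \<in> carrier G. \<forall>X \<in> Obj E. \<forall>Y \<in> Obj E. \<forall>f \<in> Hom E X Y.
        on_mor (comp_funct forgetful (act B g)) X Y f =
        on_mor (comp_funct (act A g) forgetful) X Y f) \<and>
     (\<forall>g \<in> carrier G. \<forall>h \<in> carrier G. \<forall>X \<in> Obj E. assoc B g h X = assoc A g h (fst X)) \<and>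
     (\<forall>X \<in> Obj E. unitor B X = unitor A (fst X))"

end

theory Submission
  imports Defs
begin

text \<open>
  An action of \<open>G\<close> on \<open>D\<close> amounts to a \<open>G\<close>-graded category on the objects of \<open>D\<close>: an arrow of degree
  \<open>g\<close> from \<open>X\<close> to \<open>Y\<close> is a morphism \<open>g \<otimes> X \<rightarrow> Y\<close>, and \<open>f'\<close> of degree \<open>h\<close> composes with \<open>f\<close> of degree
  \<open>g\<close> to \<open>f' \<circ> (h \<otimes> f) \<circ> \<alpha>\<close>.  The pentagon is associativity and the triangles are the unit laws.  The
  identity of \<open>g \<otimes> X\<close>, seen as an arrow \<open>u\<^sub>g : X \<rightarrow> g \<otimes> X\<close> of degree \<open>g\<close>, is invertible, and
  \<open>g \<otimes> f = u\<^sub>g f u\<^sub>g\<^sup>-\<^sup>1\<close>, \<open>\<alpha> = u\<^sub>g u\<^sub>h u\<^sub>g\<^sub>h\<^sup>-\<^sup>1\<close>; an equivariant structure on \<open>X\<close> is a degree preserving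
  homomorphism \<open>p\<close> from the group to the automorphisms of \<open>X\<close>.  All diagrams become cancellations.

  For normal \<open>H\<close>, the object \<open>g \<otimes> X\<close> carries the structure \<open>h \<mapsto> u\<^sub>g p(g\<^sup>-\<^sup>1hg) u\<^sub>g\<^sup>-\<^sup>1\<close>, and for \<open>a\<close>, \<open>b\<close> in one
  coset \<open>u\<^sub>b p(b\<^sup>-\<^sup>1a) u\<^sub>a\<^sup>-\<^sup>1\<close> is a coherent isomorphism \<open>a \<otimes> X \<rightarrow> b \<otimes> X\<close>.  With coset representatives \<open>r\<close>
  it turns the action of \<open>G\<close> into one of \<open>G/H\<close>.  A structure \<open>x\<close> for the latter extends \<open>p\<close> to
  \<open>g \<mapsto> x([g]) p(r([g])\<^sup>-\<^sup>1g)\<close>, which gives an isomorphism of categories and not just an equivalence.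
\<close>

section \<open>Linear categories and functors\<close>

context linear_category
begin

lemma Isos_Hom: "f \<in> Isos C X Y \<Longrightarrow> f \<in> Hom C X Y"
  by (simp add: Isos_def)

lemma Isos_Comp:
  assumes "X \<in> Obj C" "Y \<in> Obj C" "Z \<in> Obj C" "f \<in> Isos C X Y" "g \<in> Isos C Y Z"
  shows "g \<odot> f \<in> Isos C X Z"
proof -
  obtain f' where f: "f \<in> Hom C X Y" "f' \<in> Hom C Y X" "f' \<odot> f = Id C X" "f \<odot> f' = Id C Y"
    using assms(4) by (auto simp: Isos_def)
  obtain g' where g: "g \<in> Hom C Y Z" "g' \<in> Hom C Z Y" "g' \<odot> g = Id C Y" "g \<odot> g' = Id C Z"
    using assms(5) by (auto simp: Isos_def)
  note o = assms(1-3) note gf = Comp_in_Hom[OF o f(1) g(1)]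
  have 1: "f' \<odot> g' \<in> Hom C Z X" using o g(2) f(2) by (blast intro: Comp_in_Hom)
  have "f' \<odot> g' \<odot> (g \<odot> f) = f' \<odot> (g' \<odot> (g \<odot> f))"
    by (rule Comp_assoc[OF o(1) o(3) o(2) o(1) gf g(2) f(2)])
  also have "g' \<odot> (g \<odot> f) = g' \<odot> g \<odot> f" by (rule Comp_assoc[OF o o(2) f(1) g(1,2), symmetric])
  also have "\<dots> = f" unfolding g by (rule Comp_Id_left[OF o(1,2) f(1)])
  finally have 2: "f' \<odot> g' \<odot> (g \<odot> f) = Id C X" unfolding f .
  have "g \<odot> f \<odot> (f' \<odot> g') = g \<odot> (f \<odot> (f' \<odot> g'))"
    by (rule Comp_assoc[OF o(3) o(1) o(2) o(3) 1 f(1) g(1)])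
  also have "f \<odot> (f' \<odot> g') = f \<odot> f' \<odot> g'" by (rule Comp_assoc[OF o(3) o(2) o(1) o(2) g(2) f(2,1), symmetric])
  also have "\<dots> = g'" unfolding f by (rule Comp_Id_left[OF o(3,2) g(2)])
  finally have "g \<odot> f \<odot> (f' \<odot> g') = Id C Z" unfolding g .
  with 1 2 gf show ?thesis unfolding Isos_def by blast
qed

lemma zero_Hom: "X \<in> Obj C \<Longrightarrow> Y \<in> Obj C \<Longrightarrow> 0 \<in> Hom C X Y"
  using Hom_subspace subspace_0 by blast

lemma add_Hom: "X \<in> Obj C \<Longrightarrow> Y \<in> Obj C \<Longrightarrow> f \<in> Hom C X Y \<Longrightarrow> g \<in> Hom C X Y \<Longrightarrow> f + g \<in> Hom C X Y"
  using Hom_subspace subspace_add by blast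

lemma scale_Hom: "X \<in> Obj C \<Longrightarrow> Y \<in> Obj C \<Longrightarrow> f \<in> Hom C X Y \<Longrightarrow> Scale C a f \<in> Hom C X Y"
  using Hom_subspace subspace_scale by blast

lemma Comp_zero_right:
  assumes "X \<in> Obj C" "Y \<in> Obj C" "Z \<in> Obj C" "g \<in> Hom C Y Z"
  shows "g \<odot> 0 = 0"
  using Comp_scale_right[of X Y Z 0 g 0] assms zero_Hom by auto

lemma Comp_zero_left:
  assumes "X \<in> Obj C" "Y \<in> Obj C" "Z \<in> Obj C" "f \<in> Hom C X Y"
  shows "0 \<odot> f = 0"
  using Comp_scale_left[of X Y Z f 0 0] assms zero_Hom by auto

text \<open>Two squares, \<open>c \<odot> d = d' \<odot> c'\<close> and
  \<open>c' \<odot> e = x \<odot> y\<close>, are applied one after the other inside a composite of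
  five. In the associativity of graded composition they become naturality of \<alpha> and the
  pentagon. All eight objects are named because a morphism does not determine its source and
  target.\<close>

lemma Comp_rearrange:
  assumes "X\<^sub>0 \<in> Obj C" "X\<^sub>1 \<in> Obj C" "X\<^sub>2 \<in> Obj C" "X\<^sub>3 \<in> Obj C" "X\<^sub>4 \<in> Obj C" "X\<^sub>5 \<in> Obj C" "X\<^sub>6 \<in> Obj C" "X\<^sub>7 \<in> Obj C"
    and "a \<in> Hom C X\<^sub>1 X\<^sub>0" "b \<in> Hom C X\<^sub>2 X\<^sub>1" "c \<in> Hom C X\<^sub>3 X\<^sub>2" "d \<in> Hom C X\<^sub>4 X\<^sub>3" "e \<in> Hom C X\<^sub>5 X\<^sub>4"
      "d' \<in> Hom C X\<^sub>6 X\<^sub>2" "c' \<in> Hom C X\<^sub>4 X\<^sub>6" "x \<in> Hom C X\<^sub>7 X\<^sub>6" "y \<in> Hom C X\<^sub>5 X\<^sub>7"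
    and "c \<odot> d = d' \<odot> c'" "c' \<odot> e = x \<odot> y"
  shows "a \<odot> b \<odot> c \<odot> d \<odot> e = a \<odot> (b \<odot> d' \<odot> x) \<odot> y"
proof -
  note [simp] = assms(1-17)
  have [simp]: "a \<odot> b \<in> Hom C X\<^sub>2 X\<^sub>0" "d' \<odot> x \<in> Hom C X\<^sub>7 X\<^sub>2" "d \<odot> e \<in> Hom C X\<^sub>5 X\<^sub>3"
    using Comp_in_Hom[of X\<^sub>2 X\<^sub>1 X\<^sub>0 b a] Comp_in_Hom[of X\<^sub>7 X\<^sub>6 X\<^sub>2 x d'] Comp_in_Hom[of X\<^sub>5 X\<^sub>4 X\<^sub>3 e d] by simp_all
  have [simp]: "b \<odot> (d' \<odot> x) \<in> Hom C X\<^sub>7 X\<^sub>1" "a \<odot> b \<odot> c \<in> Hom C X\<^sub>3 X\<^sub>0"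
    using Comp_in_Hom[of X\<^sub>7 X\<^sub>2 X\<^sub>1 "d' \<odot> x" b] Comp_in_Hom[of X\<^sub>3 X\<^sub>2 X\<^sub>0 c "a \<odot> b"] by simp_all
  have "a \<odot> b \<odot> c \<odot> d \<odot> e = a \<odot> b \<odot> c \<odot> (d \<odot> e)"
    by (rule Comp_assoc[where X = X\<^sub>5 and Y = X\<^sub>4 and Z = X\<^sub>3 and W = X\<^sub>0]) auto
  also have "\<dots> = a \<odot> b \<odot> (c \<odot> (d \<odot> e))"
    by (rule Comp_assoc[where X = X\<^sub>5 and Y = X\<^sub>3 and Z = X\<^sub>2 and W = X\<^sub>0]) auto
  also have "c \<odot> (d \<odot> e) = c \<odot> d \<odot> e"
    by (rule Comp_assoc[symmetric, where X = X\<^sub>5 and Y = X\<^sub>4 and Z = X\<^sub>3 and W = X\<^sub>2]) auto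
  also have "\<dots> = d' \<odot> (c' \<odot> e)" unfolding assms(18)
    by (subst Comp_assoc[where X = X\<^sub>5 and Y = X\<^sub>4 and Z = X\<^sub>6 and W = X\<^sub>2]) auto
  also have "\<dots> = d' \<odot> x \<odot> y" unfolding assms(19)
    by (rule Comp_assoc[symmetric, where X = X\<^sub>5 and Y = X\<^sub>7 and Z = X\<^sub>6 and W = X\<^sub>2]) auto
  also have "a \<odot> b \<odot> (d' \<odot> x \<odot> y) = a \<odot> b \<odot> (d' \<odot> x) \<odot> y"
    by (rule Comp_assoc[symmetric, where X = X\<^sub>5 and Y = X\<^sub>7 and Z = X\<^sub>2 and W = X\<^sub>0]) auto
  also have "a \<odot> b \<odot> (d' \<odot> x) = a \<odot> (b \<odot> (d' \<odot> x))"
    by (rule Comp_assoc[where X = X\<^sub>7 and Y = X\<^sub>2 and Z = X\<^sub>1 and W = X\<^sub>0]) auto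
  also have "b \<odot> (d' \<odot> x) = b \<odot> d' \<odot> x"
    by (rule Comp_assoc[symmetric, where X = X\<^sub>7 and Y = X\<^sub>6 and Z = X\<^sub>2 and W = X\<^sub>1]) auto
  finally show ?thesis .
qed

end

lemma (in linear_functor) on_mor_zero:
  assumes "X \<in> Obj C" "Y \<in> Obj C"
  shows "on_mor F X Y 0 = 0"
proof -
  have "on_mor F X Y (Scale C 0 0) = Scale D 0 (on_mor F X Y 0)"
    using assms by (intro on_mor_scale source.zero_Hom)
  then show ?thesis
    unfolding source.scale_zero_left target.scale_zero_left .
qed

text \<open>Vertical composition, meant for a comparison of two group elements followed by a
  structural isomorphism.\<close>

lemma natural_iso_comp:
  assumes "linear_functor C D F" "linear_functor C D G" "linear_functor C D K"
    and "natural_iso C D F G \<eta>" "natural_iso C D G K \<epsilon>"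
  shows "natural_iso C D F K (\<lambda>X. \<epsilon> X \<odot>\<^bsub>D\<^esub> \<eta> X)"
proof -
  interpret F: linear_functor C D F by fact
  interpret G: linear_functor C D G by fact
  interpret K: linear_functor C D K by fact
  have \<eta>: "\<eta> X \<in> Isos D (on_obj F X) (on_obj G X)" and \<epsilon>: "\<epsilon> X \<in> Isos D (on_obj G X) (on_obj K X)"
    if "X \<in> Obj C" for X
    using assms(4,5) that by (auto simp: natural_iso_def)
  show ?thesis
    unfolding natural_iso_def
  proof (intro conjI ballI)
    show "\<epsilon> X \<odot>\<^bsub>D\<^esub> \<eta> X \<in> Isos D (on_obj F X) (on_obj K X)" if "X \<in> Obj C" for X
      using that F.on_obj_closed G.on_obj_closed K.on_obj_closed \<eta> \<epsilon> by (blast intro: F.target.Isos_Comp)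
    fix X Y f assume X: "X \<in> Obj C" and Y: "Y \<in> Obj C" and f: "f \<in> Hom C X Y"
    note h = \<eta>[THEN F.target.Isos_Hom] \<epsilon>[THEN F.target.Isos_Hom]
      F.on_obj_closed G.on_obj_closed K.on_obj_closed
    note m = F.on_mor_closed[OF X Y f] G.on_mor_closed[OF X Y f] K.on_mor_closed[OF X Y f]
    have "\<epsilon> Y \<odot>\<^bsub>D\<^esub> \<eta> Y \<odot>\<^bsub>D\<^esub> on_mor F X Y f = \<epsilon> Y \<odot>\<^bsub>D\<^esub> (\<eta> Y \<odot>\<^bsub>D\<^esub> on_mor F X Y f)"
      by (rule F.target.Comp_assoc[OF h(3)[OF X] h(3)[OF Y] h(4)[OF Y] h(5)[OF Y] m(1) h(1)[OF Y] h(2)[OF Y]])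
    also have "\<eta> Y \<odot>\<^bsub>D\<^esub> on_mor F X Y f = on_mor G X Y f \<odot>\<^bsub>D\<^esub> \<eta> X"
      using assms(4) X Y f by (simp add: natural_iso_def)
    also have "\<epsilon> Y \<odot>\<^bsub>D\<^esub> (on_mor G X Y f \<odot>\<^bsub>D\<^esub> \<eta> X) = \<epsilon> Y \<odot>\<^bsub>D\<^esub> on_mor G X Y f \<odot>\<^bsub>D\<^esub> \<eta> X"
      by (rule F.target.Comp_assoc[OF h(3)[OF X] h(4)[OF X] h(4)[OF Y] h(5)[OF Y] h(1)[OF X] m(2) h(2)[OF Y], symmetric])
    also have "\<epsilon> Y \<odot>\<^bsub>D\<^esub> on_mor G X Y f = on_mor K X Y f \<odot>\<^bsub>D\<^esub> \<epsilon> X"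
      using assms(5) X Y f by (simp add: natural_iso_def)
    also have "on_mor K X Y f \<odot>\<^bsub>D\<^esub> \<epsilon> X \<odot>\<^bsub>D\<^esub> \<eta> X = on_mor K X Y f \<odot>\<^bsub>D\<^esub> (\<epsilon> X \<odot>\<^bsub>D\<^esub> \<eta> X)"
      by (rule F.target.Comp_assoc[OF h(3)[OF X] h(4)[OF X] h(5)[OF X] h(5)[OF Y] h(1)[OF X] h(2)[OF X] m(3)])
    finally show "\<epsilon> Y \<odot>\<^bsub>D\<^esub> \<eta> Y \<odot>\<^bsub>D\<^esub> on_mor F X Y f = on_mor K X Y f \<odot>\<^bsub>D\<^esub> (\<epsilon> X \<odot>\<^bsub>D\<^esub> \<eta> X)" .
  qed
qed

text \<open>\<open>F\<close> and \<open>G\<close> are inverse bijections on objects and fix every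
  morphism, so both composites are identity functors and the identities serve as natural
  isomorphisms. Sum, scalars and composition are the same operations on both sides, hence
  functoriality reduces to matching Hom sets and identities.\<close>

lemma equivalent_categoriesI:
  fixes C :: "('k::field, 'o, 'm::ab_group_add) lin_cat" and D :: "('k, 'p, 'm) lin_cat"
  assumes "linear_category C" "linear_category D" "Comp C = Comp D" "Scale C = Scale D"
    and F: "\<And>X. X \<in> Obj C \<Longrightarrow> F X \<in> Obj D \<and> G (F X) = X \<and> Id D (F X) = Id C X"
    and G: "\<And>Y. Y \<in> Obj D \<Longrightarrow> G Y \<in> Obj C \<and> F (G Y) = Y"
    and Hom: "\<And>X Y. X \<in> Obj C \<Longrightarrow> Y \<in> Obj C \<Longrightarrow> Hom D (F X) (F Y) = Hom C X Y"
  shows "equivalent_categories C D"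
proof -
  let ?F = "\<lparr>on_obj = F, on_mor = (\<lambda>X Y f. f)\<rparr> :: ('o, 'm, 'p, 'm) funct"
  let ?G = "\<lparr>on_obj = G, on_mor = (\<lambda>X Y f. f)\<rparr> :: ('p, 'm, 'o, 'm) funct"
  interpret C: linear_category C by fact
  interpret D: linear_category D by fact
  have G': "Id C (G Y) = Id D Y" if "Y \<in> Obj D" for Y using F[of "G Y"] G[OF that] by simp
  have Hom': "Hom C (G X) (G Y) = Hom D X Y" if "X \<in> Obj D" "Y \<in> Obj D" for X Y
    using Hom[of "G X" "G Y"] G that by simp
  have "linear_functor C D ?F"
    by unfold_locales (simp_all add: F Hom assms)
  moreover have "linear_functor D C ?G"
    by unfold_locales (simp_all add: G G' Hom' assms)
  moreover have "natural_iso C C (comp_funct ?G ?F) id_funct (Id C)"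
    using F by (auto simp: natural_iso_def comp_funct_def id_funct_def Isos_def C.Id_in_Hom
        C.Comp_Id_left[OF _ _ C.Id_in_Hom] C.Comp_Id_left C.Comp_Id_right)
  moreover have "natural_iso D D (comp_funct ?F ?G) id_funct (Id D)"
    using G by (auto simp: natural_iso_def comp_funct_def id_funct_def Isos_def D.Id_in_Hom
        D.Comp_Id_left[OF _ _ D.Id_in_Hom] D.Comp_Id_left D.Comp_Id_right)
  ultimately show ?thesis unfolding equivalent_categories_def isomorphic_functors_def by blast
qed

section \<open>Components of an equivariant category\<close>

lemma Obj_equivariant: "P \<in> Obj (equivariant_category G D A) \<longleftrightarrow>
    fst P \<in> Obj D \<and> snd P \<in> equivariant_structures G D A (fst P)"
  by (cases P) (simp add: equivariant_category_def)

lemma Hom_equivariant: "f \<in> Hom (equivariant_category G D A) P Q \<longleftrightarrow>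
    f \<in> Hom D (fst P) (fst Q) \<and> (\<forall>g \<in> carrier G.
      f \<odot>\<^bsub>D\<^esub> snd P g = snd Q g \<odot>\<^bsub>D\<^esub> on_mor (act A g) (fst P) (fst Q) f)"
  by (cases P, cases Q) (simp add: equivariant_category_def)

lemma Id_equivariant: "Id (equivariant_category G D A) P = Id D (fst P)"
  by (cases P) (simp add: equivariant_category_def)

lemma Comp_equivariant: "Comp (equivariant_category G D A) = Comp D"
  by (simp add: equivariant_category_def)

lemma Scale_equivariant: "Scale (equivariant_category G D A) = Scale D"
  by (simp add: equivariant_category_def)

section \<open>The graded category of an action\<close>

context category_action
begin

section \<open>The action axioms, object by object\<close>

lemma act_obj: "g \<in> carrier G \<Longrightarrow> X \<in> Obj D \<Longrightarrow> on_obj (act A g) X \<in> Obj D"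
  by (rule linear_functor.on_obj_closed[OF act_linear_functor])

lemma act_mor: "g \<in> carrier G \<Longrightarrow> X \<in> Obj D \<Longrightarrow> Y \<in> Obj D \<Longrightarrow> f \<in> Hom D X Y \<Longrightarrow>
    on_mor (act A g) X Y f \<in> Hom D (on_obj (act A g) X) (on_obj (act A g) Y)"
  by (rule linear_functor.on_mor_closed[OF act_linear_functor])

lemma act_Id: "g \<in> carrier G \<Longrightarrow> X \<in> Obj D \<Longrightarrow>
    on_mor (act A g) X X (Id D X) = Id D (on_obj (act A g) X)"
  by (rule linear_functor.on_mor_Id[OF act_linear_functor])

lemma act_Comp: "g \<in> carrier G \<Longrightarrow> X \<in> Obj D \<Longrightarrow> Y \<in> Obj D \<Longrightarrow> Z \<in> Obj D \<Longrightarrow>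
    f \<in> Hom D X Y \<Longrightarrow> k \<in> Hom D Y Z \<Longrightarrow>
    on_mor (act A g) X Z (k \<odot>\<^bsub>D\<^esub> f) = on_mor (act A g) Y Z k \<odot>\<^bsub>D\<^esub> on_mor (act A g) X Y f"
  by (rule linear_functor.on_mor_Comp[OF act_linear_functor])

lemma assoc_Isos: "g \<in> carrier G \<Longrightarrow> h \<in> carrier G \<Longrightarrow> X \<in> Obj D \<Longrightarrow>
    assoc A g h X \<in> Isos D (on_obj (act A (g \<otimes>\<^bsub>G\<^esub> h)) X) (on_obj (act A g) (on_obj (act A h) X))"
  using assoc_natural_iso[of g h] by (auto simp: natural_iso_def comp_funct_def)

lemmas assoc_Hom = assoc_Isos[THEN Isos_Hom]

lemma assoc_natural: "g \<in> carrier G \<Longrightarrow> h \<in> carrier G \<Longrightarrow> X \<in> Obj D \<Longrightarrow> Y \<in> Obj D \<Longrightarrow> f \<in> Hom D X Y \<Longrightarrow>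
    assoc A g h Y \<odot>\<^bsub>D\<^esub> on_mor (act A (g \<otimes>\<^bsub>G\<^esub> h)) X Y f =
    on_mor (act A g) (on_obj (act A h) X) (on_obj (act A h) Y) (on_mor (act A h) X Y f) \<odot>\<^bsub>D\<^esub> assoc A g h X"
  using assoc_natural_iso[of g h] by (auto simp: natural_iso_def comp_funct_def)

lemma unitor_Isos: "X \<in> Obj D \<Longrightarrow> unitor A X \<in> Isos D (on_obj (act A \<one>\<^bsub>G\<^esub>) X) X"
  using unitor_natural_iso by (auto simp: natural_iso_def id_funct_def)

lemmas unitor_Hom = unitor_Isos[THEN Isos_Hom]

lemma unitor_natural: "X \<in> Obj D \<Longrightarrow> Y \<in> Obj D \<Longrightarrow> f \<in> Hom D X Y \<Longrightarrow>
    unitor A Y \<odot>\<^bsub>D\<^esub> on_mor (act A \<one>\<^bsub>G\<^esub>) X Y f = f \<odot>\<^bsub>D\<^esub> unitor A X"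
  using unitor_natural_iso by (auto simp: natural_iso_def id_funct_def)

text \<open>An arrow records its source, degree and target, since a morphism of \<open>D\<close>
  need not determine them. The set is empty unless the degree and both objects are legitimate, so
  membership carries all typing information.\<close>

definition GHom :: "'g \<Rightarrow> 'o \<Rightarrow> 'o \<Rightarrow> ('o \<times> 'g \<times> 'm \<times> 'o) option set" where
  "GHom g X Y = {Some (X, g, f, Y) |f.
     g \<in> carrier G \<and> X \<in> Obj D \<and> Y \<in> Obj D \<and> f \<in> Hom D (on_obj (act A g) X) Y}"

text \<open>
  Ill-typed composites are \<open>None\<close>, so that associativity holds without side conditions and can be
  used for rewriting.
\<close>

definition gcomp :: "('o \<times> 'g \<times> 'm \<times> 'o) option \<Rightarrow> ('o \<times> 'g \<times> 'm \<times> 'o) option \<Rightarrow>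
    ('o \<times> 'g \<times> 'm \<times> 'o) option" (infixr \<open>\<cdot>\<close> 70) where
  "a \<cdot> b = (case a of None \<Rightarrow> None | Some (Y', h, f', Z) \<Rightarrow>
     (case b of None \<Rightarrow> None | Some (X, g, f, Y) \<Rightarrow>
       if a \<in> GHom h Y Z \<and> b \<in> GHom g X Y
       then Some (X, h \<otimes>\<^bsub>G\<^esub> g, f' \<odot>\<^bsub>D\<^esub> on_mor (act A h) (on_obj (act A g) X) Y f \<odot>\<^bsub>D\<^esub> assoc A h g X, Z)
       else None))"

lemma Some_GHom_iff: "Some (X, g, f, Y) \<in> GHom h X' Y' \<longleftrightarrow> X' = X \<and> g = h \<and> Y' = Y \<and>
    g \<in> carrier G \<and> X \<in> Obj D \<and> Y \<in> Obj D \<and> f \<in> Hom D (on_obj (act A g) X) Y"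
  by (auto simp: GHom_def)

lemma GHomE:
  assumes "a \<in> GHom g X Y"
  obtains f where "a = Some (X, g, f, Y)" "g \<in> carrier G" "X \<in> Obj D" "Y \<in> Obj D"
    "f \<in> Hom D (on_obj (act A g) X) Y"
  using assms by (auto simp: GHom_def)

lemma gcomp_Some:
  assumes "g \<in> carrier G" "h \<in> carrier G" "X \<in> Obj D" "Y \<in> Obj D" "Z \<in> Obj D"
    "f \<in> Hom D (on_obj (act A g) X) Y" "f' \<in> Hom D (on_obj (act A h) Y) Z"
  shows "Some (Y, h, f', Z) \<cdot> Some (X, g, f, Y) =
    Some (X, h \<otimes>\<^bsub>G\<^esub> g, f' \<odot>\<^bsub>D\<^esub> on_mor (act A h) (on_obj (act A g) X) Y f \<odot>\<^bsub>D\<^esub> assoc A h g X, Z)"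
  using assms by (simp add: gcomp_def Some_GHom_iff)

lemma gcomp_closed:
  assumes "a \<in> GHom h Y Z" "b \<in> GHom g X Y"
  shows "a \<cdot> b \<in> GHom (h \<otimes>\<^bsub>G\<^esub> g) X Z"
proof -
  obtain f where f: "b = Some (X, g, f, Y)" "g \<in> carrier G" "X \<in> Obj D" "Y \<in> Obj D"
      "f \<in> Hom D (on_obj (act A g) X) Y" using assms(2) by (rule GHomE)
  obtain f' where f': "a = Some (Y, h, f', Z)" "h \<in> carrier G" "Z \<in> Obj D"
      "f' \<in> Hom D (on_obj (act A h) Y) Z" using assms(1) by (rule GHomE)
  note o = act_obj act_obj[OF _ act_obj] f f'
  have 1: "f' \<odot>\<^bsub>D\<^esub> on_mor (act A h) (on_obj (act A g) X) Y f \<in> Hom D (on_obj (act A h) (on_obj (act A g) X)) Z"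
    by (rule Comp_in_Hom[where Y = "on_obj (act A h) Y"]) (auto intro: o act_mor)
  have "f' \<odot>\<^bsub>D\<^esub> on_mor (act A h) (on_obj (act A g) X) Y f \<odot>\<^bsub>D\<^esub> assoc A h g X
      \<in> Hom D (on_obj (act A (h \<otimes>\<^bsub>G\<^esub> g)) X) Z"
    by (rule Comp_in_Hom[OF _ _ _ _ 1]) (auto intro: o act_mor assoc_Hom)
  then show ?thesis using f f' by (simp add: gcomp_Some Some_GHom_iff)
qed

lemma gcomp_NoneI: "(\<And>h g X Y Z. a \<in> GHom h Y Z \<Longrightarrow> b \<in> GHom g X Y \<Longrightarrow> False) \<Longrightarrow> a \<cdot> b = None"
  by (auto simp: gcomp_def split: option.splits)

lemma GHom_unique: "a \<in> GHom g X Y \<Longrightarrow> a \<in> GHom g' X' Y' \<Longrightarrow> g' = g \<and> X' = X \<and> Y' = Y"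
  by (auto simp: GHom_def)

text \<open>Functoriality of \<open>l \<otimes> -\<close> expands the right-hand side. The two
  composites of five morphisms then differ by naturality of \<alpha> in \<open>f\<close>, followed
  by the pentagon.\<close>

lemma gcomp_assoc_typed:
  assumes "a \<in> GHom l Z W" "b \<in> GHom h Y Z" "c \<in> GHom g X Y"
  shows "(a \<cdot> b) \<cdot> c = a \<cdot> b \<cdot> c"
proof -
  obtain f where f: "c = Some (X, g, f, Y)" "g \<in> carrier G" "X \<in> Obj D" "Y \<in> Obj D"
      "f \<in> Hom D (on_obj (act A g) X) Y" using assms(3) by (rule GHomE)
  obtain f' where f': "b = Some (Y, h, f', Z)" "h \<in> carrier G" "Z \<in> Obj D"
      "f' \<in> Hom D (on_obj (act A h) Y) Z" using assms(2) by (rule GHomE)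
  obtain f'' where f'': "a = Some (Z, l, f'', W)" "l \<in> carrier G" "W \<in> Obj D"
      "f'' \<in> Hom D (on_obj (act A l) Z) W" using assms(1) by (rule GHomE)
  let ?o = "\<lambda>g. on_obj (act A g)" and ?m = "\<lambda>g. on_mor (act A g)"
  note [simp] = f f' f''
  have [simp]: "?o k V \<in> Obj D" if "k \<in> carrier G" "V \<in> Obj D" for k V
    using that by (rule act_obj)
  have [simp]: "?m h (?o g X) Y f \<in> Hom D (?o h (?o g X)) (?o h Y)"
    "?m l (?o h Y) Z f' \<in> Hom D (?o l (?o h Y)) (?o l Z)" by (simp_all add: act_mor)
  have hf: "?m l (?o h (?o g X)) (?o h Y) (?m h (?o g X) Y f) \<in> Hom D (?o l (?o h (?o g X))) (?o l (?o h Y))"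
    "?m l (?o (h \<otimes>\<^bsub>G\<^esub> g) X) (?o h (?o g X)) (assoc A h g X) \<in> Hom D (?o l (?o (h \<otimes>\<^bsub>G\<^esub> g) X)) (?o l (?o h (?o g X)))"
    "?m (l \<otimes>\<^bsub>G\<^esub> h) (?o g X) Y f \<in> Hom D (?o (l \<otimes>\<^bsub>G\<^esub> h) (?o g X)) (?o (l \<otimes>\<^bsub>G\<^esub> h) Y)"
    by (simp_all add: act_mor assoc_Hom)
  \<comment> \<open>Degrees multiply strictly: both bracketings of the product are one group element
    and index the same functor, so this \<alpha> can be retyped.\<close>
  have ah: "assoc A (l \<otimes>\<^bsub>G\<^esub> h) g X \<in> Hom D (?o (l \<otimes>\<^bsub>G\<^esub> (h \<otimes>\<^bsub>G\<^esub> g)) X) (?o (l \<otimes>\<^bsub>G\<^esub> h) (?o g X))"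
    using assoc_Hom[of "l \<otimes>\<^bsub>G\<^esub> h" g X] by (simp add: m_assoc)
  have 1: "f' \<odot>\<^bsub>D\<^esub> ?m h (?o g X) Y f \<in> Hom D (?o h (?o g X)) Z"
    by (rule Comp_in_Hom[where Y = "?o h Y"]) auto
  have 2: "?m l (?o (h \<otimes>\<^bsub>G\<^esub> g) X) Z (f' \<odot>\<^bsub>D\<^esub> ?m h (?o g X) Y f \<odot>\<^bsub>D\<^esub> assoc A h g X) =
    ?m l (?o h Y) Z f' \<odot>\<^bsub>D\<^esub> ?m l (?o h (?o g X)) (?o h Y) (?m h (?o g X) Y f) \<odot>\<^bsub>D\<^esub>
      ?m l (?o (h \<otimes>\<^bsub>G\<^esub> g) X) (?o h (?o g X)) (assoc A h g X)"
    using 1 by (simp add: assoc_Hom act_Comp[where Y = "?o h (?o g X)"] act_Comp[where Y = "?o h Y"])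
  have 3: "f'' \<odot>\<^bsub>D\<^esub> ?m l (?o h Y) Z f' \<odot>\<^bsub>D\<^esub> assoc A l h Y \<odot>\<^bsub>D\<^esub> ?m (l \<otimes>\<^bsub>G\<^esub> h) (?o g X) Y f \<odot>\<^bsub>D\<^esub> assoc A (l \<otimes>\<^bsub>G\<^esub> h) g X
     = f'' \<odot>\<^bsub>D\<^esub> (?m l (?o h Y) Z f' \<odot>\<^bsub>D\<^esub> ?m l (?o h (?o g X)) (?o h Y) (?m h (?o g X) Y f) \<odot>\<^bsub>D\<^esub>
      ?m l (?o (h \<otimes>\<^bsub>G\<^esub> g) X) (?o h (?o g X)) (assoc A h g X)) \<odot>\<^bsub>D\<^esub> assoc A l (h \<otimes>\<^bsub>G\<^esub> g) X"
    by (rule Comp_rearrange[where X\<^sub>0 = W and X\<^sub>1 = "?o l Z" and X\<^sub>2 = "?o l (?o h Y)" and X\<^sub>3 = "?o (l \<otimes>\<^bsub>G\<^esub> h) Y" and X\<^sub>4 = "?o (l \<otimes>\<^bsub>G\<^esub> h) (?o g X)"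
          and X\<^sub>5 = "?o (l \<otimes>\<^bsub>G\<^esub> (h \<otimes>\<^bsub>G\<^esub> g)) X" and X\<^sub>6 = "?o l (?o h (?o g X))"
          and X\<^sub>7 = "?o l (?o (h \<otimes>\<^bsub>G\<^esub> g) X)" and c' = "assoc A l h (?o g X)"])
      (auto simp: hf assoc_Hom ah assoc_natural pentagon)
  have 4: "a \<cdot> b = Some (Y, l \<otimes>\<^bsub>G\<^esub> h, f'' \<odot>\<^bsub>D\<^esub> ?m l (?o h Y) Z f' \<odot>\<^bsub>D\<^esub> assoc A l h Y, W)"
    "b \<cdot> c = Some (X, h \<otimes>\<^bsub>G\<^esub> g, f' \<odot>\<^bsub>D\<^esub> ?m h (?o g X) Y f \<odot>\<^bsub>D\<^esub> assoc A h g X, Z)"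
    by (simp_all add: gcomp_Some)
  note 5 = gcomp_closed[OF assms(1,2), unfolded 4 Some_GHom_iff]
    gcomp_closed[OF assms(2,3), unfolded 4 Some_GHom_iff]
  have "(a \<cdot> b) \<cdot> c = Some (X, (l \<otimes>\<^bsub>G\<^esub> h) \<otimes>\<^bsub>G\<^esub> g, f'' \<odot>\<^bsub>D\<^esub> ?m l (?o h Y) Z f' \<odot>\<^bsub>D\<^esub> assoc A l h Y \<odot>\<^bsub>D\<^esub>
      ?m (l \<otimes>\<^bsub>G\<^esub> h) (?o g X) Y f \<odot>\<^bsub>D\<^esub> assoc A (l \<otimes>\<^bsub>G\<^esub> h) g X, W)"
    unfolding 4 f(1) using 5 by (intro gcomp_Some) auto
  moreover have "a \<cdot> b \<cdot> c = Some (X, l \<otimes>\<^bsub>G\<^esub> (h \<otimes>\<^bsub>G\<^esub> g), f'' \<odot>\<^bsub>D\<^esub>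
      ?m l (?o (h \<otimes>\<^bsub>G\<^esub> g) X) Z (f' \<odot>\<^bsub>D\<^esub> ?m h (?o g X) Y f \<odot>\<^bsub>D\<^esub> assoc A h g X) \<odot>\<^bsub>D\<^esub> assoc A l (h \<otimes>\<^bsub>G\<^esub> g) X, W)"
    unfolding 4 f''(1) using 5 by (intro gcomp_Some) auto
  ultimately show ?thesis using 2 3 by (simp add: m_assoc)
qed

lemma gcomp_cases:
  obtains "a \<cdot> b = None" | h g X Y Z where "a \<in> GHom h Y Z" "b \<in> GHom g X Y"
  using gcomp_NoneI by metis

text \<open>If the three arrows do not fit together, both sides are \<open>None\<close>: an inner
  composite that is defined has the outer source and target of its factors, so the mismatch with the
  third arrow remains.\<close>

lemma gcomp_assoc: "(a \<cdot> b) \<cdot> c = a \<cdot> b \<cdot> c"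
proof (cases "\<exists>l h g X Y Z W. a \<in> GHom l Z W \<and> b \<in> GHom h Y Z \<and> c \<in> GHom g X Y")
  case True
  then show ?thesis using gcomp_assoc_typed by blast
next
  case False
  have "(a \<cdot> b) \<cdot> c = None"
  proof (cases rule: gcomp_cases[of "a \<cdot> b" c])
    case (2 k g X Y W)
    then have "a \<cdot> b \<noteq> None" by (auto simp: GHom_def)
    then obtain h l Y' Z W' where *: "a \<in> GHom l Z W'" "b \<in> GHom h Y' Z"
      using gcomp_cases[of a b] by metis
    with 2 GHom_unique[OF gcomp_closed[OF *]] have "Y' = Y" by metis
    with * 2 False show ?thesis by blast
  qed
  moreover have "a \<cdot> b \<cdot> c = None"
  proof (cases rule: gcomp_cases[of a "b \<cdot> c"])
    case (2 l k X Z W)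
    then have "b \<cdot> c \<noteq> None" by (auto simp: GHom_def)
    then obtain h g X' Y Z' where *: "b \<in> GHom h Y Z'" "c \<in> GHom g X' Y"
      using gcomp_cases[of b c] by metis
    with 2 GHom_unique[OF gcomp_closed[OF *]] have "Z' = Z" by metis
    with * 2 False show ?thesis by blast
  qed
  ultimately show ?thesis by simp
qed

section \<open>Units, arrows of degree one and the arrows \<open>u\<^sub>g\<close>\<close>

definition gid :: "'o \<Rightarrow> ('o \<times> 'g \<times> 'm \<times> 'o) option" where
  "gid X = Some (X, \<one>\<^bsub>G\<^esub>, unitor A X, X)"

text \<open>This compares \<open>D\<close> with the degree one part of the graded category. Arrows
  of degree one start at \<open>1 \<otimes> X\<close>, hence the factor \<open>unitor A X\<close>.
  By \<open>GHom_one\<close> and \<open>emb_inject\<close> it is bijective on morphisms.\<close>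

definition emb :: "'o \<Rightarrow> 'o \<Rightarrow> 'm \<Rightarrow> ('o \<times> 'g \<times> 'm \<times> 'o) option" where
  "emb X Y f = Some (X, \<one>\<^bsub>G\<^esub>, f \<odot>\<^bsub>D\<^esub> unitor A X, Y)"

text \<open>The arrow \<open>u\<^sub>g\<close>. It is universal among arrows of degree
  \<open>g\<close> out of \<open>X\<close>: by \<open>emb_push\<close> each of them is an ordinary
  morphism composed with it.\<close>

definition push :: "'g \<Rightarrow> 'o \<Rightarrow> ('o \<times> 'g \<times> 'm \<times> 'o) option" where
  "push g X = Some (X, g, Id D (on_obj (act A g) X), on_obj (act A g) X)"

text \<open>The inverse of \<open>push g X\<close>; it exists by \<open>push_inverse\<close> below.\<close>

definition pull :: "'g \<Rightarrow> 'o \<Rightarrow> ('o \<times> 'g \<times> 'm \<times> 'o) option" where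
  "pull g X = (SOME e. e \<in> GHom (inv\<^bsub>G\<^esub> g) (on_obj (act A g) X) X \<and>
     e \<cdot> push g X = gid X \<and> push g X \<cdot> e = gid (on_obj (act A g) X))"

definition mor :: "('o \<times> 'g \<times> 'm \<times> 'o) option \<Rightarrow> 'm" where
  "mor e = fst (snd (snd (the e)))"

lemma gid_GHom: "X \<in> Obj D \<Longrightarrow> gid X \<in> GHom \<one>\<^bsub>G\<^esub> X X"
  by (simp add: gid_def Some_GHom_iff unitor_Hom)

lemma emb_GHom: "X \<in> Obj D \<Longrightarrow> Y \<in> Obj D \<Longrightarrow> f \<in> Hom D X Y \<Longrightarrow> emb X Y f \<in> GHom \<one>\<^bsub>G\<^esub> X Y"
  using Comp_in_Hom[of "on_obj (act A \<one>\<^bsub>G\<^esub>) X" X Y "unitor A X" f]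
  by (simp add: emb_def Some_GHom_iff unitor_Hom act_obj)

lemma push_GHom: "g \<in> carrier G \<Longrightarrow> X \<in> Obj D \<Longrightarrow> push g X \<in> GHom g X (on_obj (act A g) X)"
  by (simp add: push_def Some_GHom_iff act_obj Id_in_Hom)

lemma emb_Id: "X \<in> Obj D \<Longrightarrow> emb X X (Id D X) = gid X"
  using Comp_Id_left[of "on_obj (act A \<one>\<^bsub>G\<^esub>) X" X "unitor A X"]
  by (simp add: emb_def gid_def act_obj unitor_Hom)

text \<open>Naturality of the unitor moves it past \<open>e\<close>, and the left triangle cancels
  it against \<alpha>. What remains is plain composition in \<open>D\<close>.\<close>

lemma emb_gcomp_Some:
  assumes "X \<in> Obj D" "Y \<in> Obj D" "Z \<in> Obj D" "g \<in> carrier G" "f \<in> Hom D Y Z"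
    "e \<in> Hom D (on_obj (act A g) X) Y"
  shows "emb Y Z f \<cdot> Some (X, g, e, Y) = Some (X, g, f \<odot>\<^bsub>D\<^esub> e, Z)"
proof -
  let ?o = "\<lambda>g. on_obj (act A g)" and ?m = "\<lambda>g. on_mor (act A g)"
  note [simp] = assms act_obj unitor_Hom assoc_Hom act_mor
  have a: "assoc A \<one>\<^bsub>G\<^esub> g X \<in> Hom D (?o g X) (?o \<one>\<^bsub>G\<^esub> (?o g X))"
    using assoc_Hom[of "\<one>\<^bsub>G\<^esub>" g X] by simp
  have fu: "f \<odot>\<^bsub>D\<^esub> unitor A Y \<in> Hom D (?o \<one>\<^bsub>G\<^esub> Y) Z"
    by (rule Comp_in_Hom[where Y = Y]) simp_all
  have eu: "e \<odot>\<^bsub>D\<^esub> unitor A (?o g X) \<in> Hom D (?o \<one>\<^bsub>G\<^esub> (?o g X)) Y"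
    by (rule Comp_in_Hom[where Y = "?o g X"]) simp_all
  have "f \<odot>\<^bsub>D\<^esub> unitor A Y \<odot>\<^bsub>D\<^esub> ?m \<one>\<^bsub>G\<^esub> (?o g X) Y e = f \<odot>\<^bsub>D\<^esub> (unitor A Y \<odot>\<^bsub>D\<^esub> ?m \<one>\<^bsub>G\<^esub> (?o g X) Y e)"
    by (rule Comp_assoc[where X = "?o \<one>\<^bsub>G\<^esub> (?o g X)" and Y = "?o \<one>\<^bsub>G\<^esub> Y" and Z = Y and W = Z]) simp_all
  also have "\<dots> = f \<odot>\<^bsub>D\<^esub> (e \<odot>\<^bsub>D\<^esub> unitor A (?o g X))"
    using unitor_natural[of "?o g X" Y e] by simp
  finally have "f \<odot>\<^bsub>D\<^esub> unitor A Y \<odot>\<^bsub>D\<^esub> ?m \<one>\<^bsub>G\<^esub> (?o g X) Y e \<odot>\<^bsub>D\<^esub> assoc A \<one>\<^bsub>G\<^esub> g X =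
    f \<odot>\<^bsub>D\<^esub> (e \<odot>\<^bsub>D\<^esub> unitor A (?o g X)) \<odot>\<^bsub>D\<^esub> assoc A \<one>\<^bsub>G\<^esub> g X" by simp
  also have "\<dots> = f \<odot>\<^bsub>D\<^esub> (e \<odot>\<^bsub>D\<^esub> unitor A (?o g X) \<odot>\<^bsub>D\<^esub> assoc A \<one>\<^bsub>G\<^esub> g X)"
    by (rule Comp_assoc[where X = "?o g X" and Y = "?o \<one>\<^bsub>G\<^esub> (?o g X)" and Z = Y and W = Z]) (simp_all add: a eu)
  also have "e \<odot>\<^bsub>D\<^esub> unitor A (?o g X) \<odot>\<^bsub>D\<^esub> assoc A \<one>\<^bsub>G\<^esub> g X = e \<odot>\<^bsub>D\<^esub> (unitor A (?o g X) \<odot>\<^bsub>D\<^esub> assoc A \<one>\<^bsub>G\<^esub> g X)"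
    by (rule Comp_assoc[where X = "?o g X" and Y = "?o \<one>\<^bsub>G\<^esub> (?o g X)" and Z = "?o g X" and W = Y]) (simp_all add: a)
  also have "\<dots> = e"
    using left_triangle[of g X] Comp_Id_right[of "?o g X" Y e] by simp
  finally show ?thesis
    unfolding emb_def by (subst gcomp_Some) (simp_all add: fu)
qed

lemma gid_gcomp:
  assumes "e \<in> GHom g X Y"
  shows "gid Y \<cdot> e = e"
proof -
  obtain f where f: "e = Some (X, g, f, Y)" "g \<in> carrier G" "X \<in> Obj D" "Y \<in> Obj D"
      "f \<in> Hom D (on_obj (act A g) X) Y" using assms by (rule GHomE)
  then show ?thesis
    using emb_gcomp_Some[of X Y Y g "Id D Y" f] Comp_Id_left[of "on_obj (act A g) X" Y f]
    by (simp add: emb_Id Id_in_Hom act_obj)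
qed

text \<open>Functoriality splits \<open>g \<otimes> (f \<circ> unitor)\<close>, and the right
  triangle cancels the image of the unitor against \<alpha>. Only \<open>g \<otimes> f\<close> is
  left between \<open>e\<close> and the source.\<close>

lemma Some_gcomp_emb:
  assumes "X \<in> Obj D" "Y \<in> Obj D" "Z \<in> Obj D" "g \<in> carrier G" "f \<in> Hom D X Y"
    "e \<in> Hom D (on_obj (act A g) Y) Z"
  shows "Some (Y, g, e, Z) \<cdot> emb X Y f = Some (X, g, e \<odot>\<^bsub>D\<^esub> on_mor (act A g) X Y f, Z)"
proof -
  let ?o = "\<lambda>g. on_obj (act A g)" and ?m = "\<lambda>g. on_mor (act A g)"
  note [simp] = assms act_obj unitor_Hom assoc_Hom act_mor
  have a: "assoc A g \<one>\<^bsub>G\<^esub> X \<in> Hom D (?o g X) (?o g (?o \<one>\<^bsub>G\<^esub> X))"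
    using assoc_Hom[of g "\<one>\<^bsub>G\<^esub>" X] by simp
  have fu: "f \<odot>\<^bsub>D\<^esub> unitor A X \<in> Hom D (?o \<one>\<^bsub>G\<^esub> X) Y"
    by (rule Comp_in_Hom[where Y = X]) simp_all
  have ef: "e \<odot>\<^bsub>D\<^esub> ?m g X Y f \<in> Hom D (?o g X) Z"
    by (rule Comp_in_Hom[where Y = "?o g Y"]) simp_all
  have "e \<odot>\<^bsub>D\<^esub> ?m g (?o \<one>\<^bsub>G\<^esub> X) Y (f \<odot>\<^bsub>D\<^esub> unitor A X) =
    e \<odot>\<^bsub>D\<^esub> (?m g X Y f \<odot>\<^bsub>D\<^esub> ?m g (?o \<one>\<^bsub>G\<^esub> X) X (unitor A X))"
    by (simp add: act_Comp[where Y = X])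
  also have "\<dots> = e \<odot>\<^bsub>D\<^esub> ?m g X Y f \<odot>\<^bsub>D\<^esub> ?m g (?o \<one>\<^bsub>G\<^esub> X) X (unitor A X)"
    by (rule Comp_assoc[symmetric, where X = "?o g (?o \<one>\<^bsub>G\<^esub> X)" and Y = "?o g X" and Z = "?o g Y" and W = Z])
       simp_all
  finally have "e \<odot>\<^bsub>D\<^esub> ?m g (?o \<one>\<^bsub>G\<^esub> X) Y (f \<odot>\<^bsub>D\<^esub> unitor A X) \<odot>\<^bsub>D\<^esub> assoc A g \<one>\<^bsub>G\<^esub> X =
    e \<odot>\<^bsub>D\<^esub> ?m g X Y f \<odot>\<^bsub>D\<^esub> ?m g (?o \<one>\<^bsub>G\<^esub> X) X (unitor A X) \<odot>\<^bsub>D\<^esub> assoc A g \<one>\<^bsub>G\<^esub> X" by simp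
  also have "\<dots> = e \<odot>\<^bsub>D\<^esub> ?m g X Y f \<odot>\<^bsub>D\<^esub> (?m g (?o \<one>\<^bsub>G\<^esub> X) X (unitor A X) \<odot>\<^bsub>D\<^esub> assoc A g \<one>\<^bsub>G\<^esub> X)"
    by (rule Comp_assoc[where X = "?o g X" and Y = "?o g (?o \<one>\<^bsub>G\<^esub> X)" and Z = "?o g X" and W = Z])
       (simp_all add: ef a)
  also have "\<dots> = e \<odot>\<^bsub>D\<^esub> ?m g X Y f"
    using triangle[of g X] Comp_Id_right[of "?o g X" Z "e \<odot>\<^bsub>D\<^esub> ?m g X Y f"] ef by simp
  finally show ?thesis
    unfolding emb_def by (subst gcomp_Some) (simp_all add: fu)
qed

lemma gcomp_gid:
  assumes "e \<in> GHom g X Y"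
  shows "e \<cdot> gid X = e"
proof -
  obtain f where f: "e = Some (X, g, f, Y)" "g \<in> carrier G" "X \<in> Obj D" "Y \<in> Obj D"
      "f \<in> Hom D (on_obj (act A g) X) Y" using assms by (rule GHomE)
  then show ?thesis
    using Some_gcomp_emb[of X X Y g "Id D X" f] Comp_Id_right[of "on_obj (act A g) X" Y f]
    by (simp add: emb_Id Id_in_Hom act_obj act_Id)
qed

lemma emb_Comp:
  assumes "X \<in> Obj D" "Y \<in> Obj D" "Z \<in> Obj D" "f \<in> Hom D X Y" "g \<in> Hom D Y Z"
  shows "emb X Z (g \<odot>\<^bsub>D\<^esub> f) = emb Y Z g \<cdot> emb X Y f"
proof -
  have "f \<odot>\<^bsub>D\<^esub> unitor A X \<in> Hom D (on_obj (act A \<one>\<^bsub>G\<^esub>) X) Y"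
    by (rule Comp_in_Hom[where Y = X]) (simp_all add: assms act_obj unitor_Hom)
  then show ?thesis
    using assms Comp_assoc[of "on_obj (act A \<one>\<^bsub>G\<^esub>) X" X Y Z "unitor A X" f g]
    unfolding emb_def[of X] by (simp add: emb_gcomp_Some act_obj unitor_Hom)
qed

lemma emb_push:
  assumes "X \<in> Obj D" "Y \<in> Obj D" "g \<in> carrier G" "f \<in> Hom D (on_obj (act A g) X) Y"
  shows "emb (on_obj (act A g) X) Y f \<cdot> push g X = Some (X, g, f, Y)"
  using assms Comp_Id_right[of "on_obj (act A g) X" Y f]
  by (simp add: push_def emb_gcomp_Some act_obj Id_in_Hom)

text \<open>Both sides have the underlying morphism \<open>g \<otimes> f\<close>. Once
  \<open>push\<close> is invertible, this says that the action functor is conjugation by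
  \<open>push\<close>.\<close>

lemma push_emb:
  assumes "X \<in> Obj D" "Y \<in> Obj D" "g \<in> carrier G" "f \<in> Hom D X Y"
  shows "push g Y \<cdot> emb X Y f =
    emb (on_obj (act A g) X) (on_obj (act A g) Y) (on_mor (act A g) X Y f) \<cdot> push g X"
  using assms Comp_Id_left[of "on_obj (act A g) X" "on_obj (act A g) Y" "on_mor (act A g) X Y f"]
  by (simp add: emb_push Some_gcomp_emb push_def[of _ Y] act_obj act_mor Id_in_Hom)

text \<open>Both sides have the underlying morphism \<alpha>, because \<open>g \<otimes> -\<close>
  preserves the identity that defines \<open>push h X\<close>. Thus \<alpha> compares
  \<open>u\<^sub>g u\<^sub>h\<close> with the universal arrow of the product degree.\<close>

lemma push_push:
  assumes "X \<in> Obj D" "g \<in> carrier G" "h \<in> carrier G"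
  shows "push g (on_obj (act A h) X) \<cdot> push h X =
    emb (on_obj (act A (g \<otimes>\<^bsub>G\<^esub> h)) X) (on_obj (act A g) (on_obj (act A h) X)) (assoc A g h X) \<cdot> push (g \<otimes>\<^bsub>G\<^esub> h) X"
  using assms Comp_Id_left[of "on_obj (act A (g \<otimes>\<^bsub>G\<^esub> h)) X" "on_obj (act A g) (on_obj (act A h) X)" "assoc A g h X"]
    Comp_Id_left[of "on_obj (act A g) (on_obj (act A h) X)" "on_obj (act A g) (on_obj (act A h) X)"
      "Id D (on_obj (act A g) (on_obj (act A h) X))"]
  by (simp add: emb_push push_def[of g] push_def[of h] gcomp_Some act_obj act_Id assoc_Hom Id_in_Hom)

lemma unitor_push: "X \<in> Obj D \<Longrightarrow> emb (on_obj (act A \<one>\<^bsub>G\<^esub>) X) X (unitor A X) \<cdot> push \<one>\<^bsub>G\<^esub> X = gid X"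
  by (simp add: emb_push unitor_Hom gid_def)

lemma emb_Isos:
  assumes "X \<in> Obj D" "Y \<in> Obj D" "f \<in> Isos D X Y"
  obtains f' where "f' \<in> Hom D Y X" "emb Y X f' \<cdot> emb X Y f = gid X" "emb X Y f \<cdot> emb Y X f' = gid Y"
  using assms by (auto simp: Isos_def emb_Comp[symmetric] emb_Id)

text \<open>The unitor is invertible, so every arrow of degree one factors through it. With
  \<open>emb_inject\<close> this lets equations between morphisms of \<open>D\<close> be proved by
  computing with graded arrows.\<close>

lemma GHom_one:
  assumes "e \<in> GHom \<one>\<^bsub>G\<^esub> X Y"
  obtains f where "f \<in> Hom D X Y" "e = emb X Y f"
proof -
  obtain f where f: "e = Some (X, \<one>\<^bsub>G\<^esub>, f, Y)" "X \<in> Obj D" "Y \<in> Obj D"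
      "f \<in> Hom D (on_obj (act A \<one>\<^bsub>G\<^esub>) X) Y" using assms by (auto elim: GHomE)
  obtain j where j: "j \<in> Hom D X (on_obj (act A \<one>\<^bsub>G\<^esub>) X)"
      "j \<odot>\<^bsub>D\<^esub> unitor A X = Id D (on_obj (act A \<one>\<^bsub>G\<^esub>) X)"
    using unitor_Isos[OF f(2)] by (auto simp: Isos_def)
  show ?thesis
  proof
    show "f \<odot>\<^bsub>D\<^esub> j \<in> Hom D X Y"
      using Comp_in_Hom[of X "on_obj (act A \<one>\<^bsub>G\<^esub>) X" Y j f] f j act_obj by simp
    show "e = emb X Y (f \<odot>\<^bsub>D\<^esub> j)"
      using Comp_assoc[of "on_obj (act A \<one>\<^bsub>G\<^esub>) X" X "on_obj (act A \<one>\<^bsub>G\<^esub>) X" Y "unitor A X" j f]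
        Comp_Id_right[of "on_obj (act A \<one>\<^bsub>G\<^esub>) X" Y f] f j
      by (simp add: emb_def act_obj unitor_Hom)
  qed
qed

lemma emb_inject:
  assumes "X \<in> Obj D" "Y \<in> Obj D" "f \<in> Hom D X Y" "f' \<in> Hom D X Y" "emb X Y f = emb X Y f'"
  shows "f = f'"
proof -
  obtain j where j: "j \<in> Hom D X (on_obj (act A \<one>\<^bsub>G\<^esub>) X)" "unitor A X \<odot>\<^bsub>D\<^esub> j = Id D X"
    using unitor_Isos[OF assms(1)] by (auto simp: Isos_def)
  have *: "k = k \<odot>\<^bsub>D\<^esub> unitor A X \<odot>\<^bsub>D\<^esub> j" if "k \<in> Hom D X Y" for k
    using Comp_assoc[of X "on_obj (act A \<one>\<^bsub>G\<^esub>) X" X Y j "unitor A X" k] j assms that Comp_Id_right[of X Y k]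
    by (simp add: act_obj unitor_Hom)
  have "f \<odot>\<^bsub>D\<^esub> unitor A X = f' \<odot>\<^bsub>D\<^esub> unitor A X" using assms(5) by (simp add: emb_def)
  then show ?thesis using *[OF assms(3)] *[OF assms(4)] by simp
qed

text \<open>The inverse may be given as any arrow of degree one, for instance a word in which
  degrees cancel; \<open>GHom_one\<close> turns it into a morphism.\<close>

lemma IsosI_emb:
  assumes "X \<in> Obj D" "Y \<in> Obj D" "f \<in> Hom D X Y" "e \<in> GHom \<one>\<^bsub>G\<^esub> Y X"
    "e \<cdot> emb X Y f = gid X" "emb X Y f \<cdot> e = gid Y"
  shows "f \<in> Isos D X Y"
proof -
  obtain f' where f': "f' \<in> Hom D Y X" "e = emb Y X f'" using assms(4) by (rule GHom_one)
  have "f' \<odot>\<^bsub>D\<^esub> f = Id D X"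
    using assms f' by (intro emb_inject[of X X]) (auto simp: emb_Comp[where Y = Y] emb_Id Id_in_Hom intro: Comp_in_Hom)
  moreover have "f \<odot>\<^bsub>D\<^esub> f' = Id D Y"
    using assms f' by (intro emb_inject[of Y Y]) (auto simp: emb_Comp[where Y = X] emb_Id Id_in_Hom intro: Comp_in_Hom)
  ultimately show ?thesis using assms f' by (auto simp: Isos_def)
qed

text \<open>
  Left inverses of all the \<open>push g X\<close> suffice for two-sided ones: the left inverse found here is itself
  of the form isomorphism times \<open>push\<close>, hence has a left inverse.
\<close>

lemma push_left_inverse:
  assumes g: "g \<in> carrier G" and X: "X \<in> Obj D"
  obtains u a where "u \<in> GHom \<one>\<^bsub>G\<^esub> (on_obj (act A (inv\<^bsub>G\<^esub> g)) (on_obj (act A g) X)) X"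
    "a \<in> GHom \<one>\<^bsub>G\<^esub> X (on_obj (act A (inv\<^bsub>G\<^esub> g)) (on_obj (act A g) X))"
    "a \<cdot> u = gid (on_obj (act A (inv\<^bsub>G\<^esub> g)) (on_obj (act A g) X))"
    "u \<cdot> push (inv\<^bsub>G\<^esub> g) (on_obj (act A g) X) \<cdot> push g X = gid X"
proof -
  let ?k = "inv\<^bsub>G\<^esub> g" let ?o = "\<lambda>g. on_obj (act A g)"
  note [simp] = assms act_obj inv_closed unitor_Hom emb_Id l_one
  obtain b where b: "b \<in> Hom D (?o ?k (?o g X)) (?o \<one>\<^bsub>G\<^esub> X)"
      "emb (?o ?k (?o g X)) (?o \<one>\<^bsub>G\<^esub> X) b \<cdot> emb (?o \<one>\<^bsub>G\<^esub> X) (?o ?k (?o g X)) (assoc A ?k g X) = gid (?o \<one>\<^bsub>G\<^esub> X)"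
      "emb (?o \<one>\<^bsub>G\<^esub> X) (?o ?k (?o g X)) (assoc A ?k g X) \<cdot> emb (?o ?k (?o g X)) (?o \<one>\<^bsub>G\<^esub> X) b = gid (?o ?k (?o g X))"
    using assoc_Isos[of ?k g X] by (auto elim: emb_Isos[rotated 2])
  obtain c where c: "c \<in> Hom D X (?o \<one>\<^bsub>G\<^esub> X)"
      "emb X (?o \<one>\<^bsub>G\<^esub> X) c \<cdot> emb (?o \<one>\<^bsub>G\<^esub> X) X (unitor A X) = gid (?o \<one>\<^bsub>G\<^esub> X)"
    using unitor_Isos[of X] by (auto elim: emb_Isos[rotated 2])
  have al: "assoc A ?k g X \<in> Hom D (?o \<one>\<^bsub>G\<^esub> X) (?o ?k (?o g X))"
    using assoc_Hom[of ?k g X] by simp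
  \<comment> \<open>Here \<open>b\<close> and \<open>c\<close> come from inverting \<alpha> and the
    unitor. So \<open>?u\<close> is the canonical map from
    \<open>inv g \<otimes> (g \<otimes> X)\<close> to \<open>X\<close>, and \<open>?a\<close> runs
    the other way.\<close>
  let ?u = "emb (?o \<one>\<^bsub>G\<^esub> X) X (unitor A X) \<cdot> emb (?o ?k (?o g X)) (?o \<one>\<^bsub>G\<^esub> X) b"
  let ?a = "emb (?o \<one>\<^bsub>G\<^esub> X) (?o ?k (?o g X)) (assoc A ?k g X) \<cdot> emb X (?o \<one>\<^bsub>G\<^esub> X) c"
  show ?thesis
  proof
    show "?u \<in> GHom \<one>\<^bsub>G\<^esub> (?o ?k (?o g X)) X"
      using gcomp_closed[OF emb_GHom emb_GHom, of "?o \<one>\<^bsub>G\<^esub> X" X "unitor A X" "?o ?k (?o g X)" b] b by simp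
    show "?a \<in> GHom \<one>\<^bsub>G\<^esub> X (?o ?k (?o g X))"
      using gcomp_closed[OF emb_GHom emb_GHom, of "?o \<one>\<^bsub>G\<^esub> X" "?o ?k (?o g X)" "assoc A ?k g X" X c] c al by simp
    have "?a \<cdot> ?u = emb (?o \<one>\<^bsub>G\<^esub> X) (?o ?k (?o g X)) (assoc A ?k g X) \<cdot>
        (emb X (?o \<one>\<^bsub>G\<^esub> X) c \<cdot> emb (?o \<one>\<^bsub>G\<^esub> X) X (unitor A X)) \<cdot> emb (?o ?k (?o g X)) (?o \<one>\<^bsub>G\<^esub> X) b"
      by (simp add: gcomp_assoc)
    also have "\<dots> = gid (?o ?k (?o g X))"
      using b c gid_gcomp[OF emb_GHom, of "?o ?k (?o g X)" "?o \<one>\<^bsub>G\<^esub> X" b] by simp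
    finally show "?a \<cdot> ?u = gid (?o ?k (?o g X))" .
    have "?u \<cdot> push ?k (?o g X) \<cdot> push g X = emb (?o \<one>\<^bsub>G\<^esub> X) X (unitor A X) \<cdot>
       (emb (?o ?k (?o g X)) (?o \<one>\<^bsub>G\<^esub> X) b \<cdot> emb (?o \<one>\<^bsub>G\<^esub> X) (?o ?k (?o g X)) (assoc A ?k g X)) \<cdot> push \<one>\<^bsub>G\<^esub> X"
      using push_push[of X ?k g] by (simp add: gcomp_assoc)
    also have "\<dots> = gid X"
      using b gid_gcomp[OF push_GHom, of "\<one>\<^bsub>G\<^esub>" X] unitor_push[of X] by simp
    finally show "?u \<cdot> push ?k (?o g X) \<cdot> push g X = gid X" .
  qed
qed

lemma push_inverse:
  assumes g: "g \<in> carrier G" and X: "X \<in> Obj D"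
  shows "\<exists>e. e \<in> GHom (inv\<^bsub>G\<^esub> g) (on_obj (act A g) X) X \<and>
     e \<cdot> push g X = gid X \<and> push g X \<cdot> e = gid (on_obj (act A g) X)"
proof -
  let ?k = "inv\<^bsub>G\<^esub> g" let ?o = "\<lambda>g. on_obj (act A g)"
  note [simp] = assms act_obj inv_closed
  obtain u a where u: "u \<in> GHom \<one>\<^bsub>G\<^esub> (?o ?k (?o g X)) X" "a \<in> GHom \<one>\<^bsub>G\<^esub> X (?o ?k (?o g X))"
    "a \<cdot> u = gid (?o ?k (?o g X))" "u \<cdot> push ?k (?o g X) \<cdot> push g X = gid X"
    using assms by (rule push_left_inverse)
  obtain u' a' where u': "u' \<in> GHom \<one>\<^bsub>G\<^esub> (?o g (?o ?k (?o g X))) (?o g X)"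
    "u' \<cdot> push g (?o ?k (?o g X)) \<cdot> push ?k (?o g X) = gid (?o g X)"
    using push_left_inverse[of ?k "?o g X"] by auto
  \<comment> \<open>\<open>?e\<close> is a left inverse of \<open>push g X\<close>.
    \<open>?e'\<close> is built as a left inverse of \<open>?e\<close>, from a left inverse of the
    \<open>push\<close> that occurs in \<open>?e\<close>.\<close>
  let ?e = "u \<cdot> push ?k (?o g X)" and ?e' = "u' \<cdot> push g (?o ?k (?o g X)) \<cdot> a"
  have e: "?e \<in> GHom ?k (?o g X) X" using gcomp_closed[OF u(1) push_GHom] by simp
  have e': "?e' \<in> GHom g X (?o g X)"
    using gcomp_closed[OF u'(1) gcomp_closed[OF push_GHom u(2)]] by simp
  have "?e' \<cdot> ?e = u' \<cdot> push g (?o ?k (?o g X)) \<cdot> (a \<cdot> u) \<cdot> push ?k (?o g X)"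
    by (simp add: gcomp_assoc)
  also have "\<dots> = gid (?o g X)"
    using u(3) u'(2) gid_gcomp[OF push_GHom, of ?k "?o g X"] by simp
  finally have *: "?e' \<cdot> ?e = gid (?o g X)" .
  \<comment> \<open>An element with a left inverse which itself has a left inverse equals the
    latter. So \<open>?e'\<close> is \<open>push g X\<close>, and
    \<open>?e' \<cdot> ?e = gid\<close> becomes the missing right inverse law.\<close>
  have "push g X = ?e' \<cdot> ?e \<cdot> push g X"
    using * gid_gcomp[OF push_GHom, of g X] by (simp add: gcomp_assoc[symmetric])
  also have "\<dots> = ?e'" using u(4) gcomp_gid[OF e'] by (simp add: gcomp_assoc)
  finally show ?thesis using e u(4) * by (auto simp: gcomp_assoc)
qed

section \<open>Morphisms as words in \<open>push\<close> and \<open>pull\<close>\<close>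

lemma
  assumes "g \<in> carrier G" "X \<in> Obj D"
  shows pull_GHom: "pull g X \<in> GHom (inv\<^bsub>G\<^esub> g) (on_obj (act A g) X) X"
    and pull_push: "pull g X \<cdot> push g X = gid X"
    and push_pull: "push g X \<cdot> pull g X = gid (on_obj (act A g) X)"
  using someI_ex[OF push_inverse[OF assms]] unfolding pull_def[symmetric] by auto

lemma mor_Some [simp]: "mor (Some (X, g, f, Y)) = f"
  by (simp add: mor_def)

lemma mor_Hom: "a \<in> GHom g X Y \<Longrightarrow> mor a \<in> Hom D (on_obj (act A g) X) Y"
  by (auto elim: GHomE)

lemma Some_mor: "a \<in> GHom g X Y \<Longrightarrow> Some (X, g, mor a, Y) = a"
  by (auto elim: GHomE)

text \<open>By universality \<open>a\<close> is its underlying morphism after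
  \<open>push g X\<close>; multiplying by \<open>pull g X\<close> isolates that morphism.\<close>

lemma emb_mor:
  assumes "a \<in> GHom g X Y"
  shows "emb (on_obj (act A g) X) Y (mor a) = a \<cdot> pull g X"
proof -
  obtain f where f: "a = Some (X, g, f, Y)" "g \<in> carrier G" "X \<in> Obj D" "Y \<in> Obj D"
      "f \<in> Hom D (on_obj (act A g) X) Y" using assms by (rule GHomE)
  then have "a \<cdot> pull g X = (emb (on_obj (act A g) X) Y f \<cdot> push g X) \<cdot> pull g X"
    by (simp add: emb_push)
  also have "\<dots> = emb (on_obj (act A g) X) Y f"
    using f gcomp_gid[OF emb_GHom, of "on_obj (act A g) X" Y f] by (simp add: gcomp_assoc push_pull act_obj)
  finally show ?thesis using f by simp
qed

text \<open>This is \<open>push_emb\<close> multiplied by \<open>pull\<close> on the right. Together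
  with \<open>emb_assoc\<close> and \<open>emb_unitor\<close> it translates all data of the action
  into words, so that a diagram commutes as soon as its words reduce to the same one.\<close>

lemma emb_act:
  assumes "g \<in> carrier G" "X \<in> Obj D" "Y \<in> Obj D" "f \<in> Hom D X Y"
  shows "emb (on_obj (act A g) X) (on_obj (act A g) Y) (on_mor (act A g) X Y f) =
    push g Y \<cdot> emb X Y f \<cdot> pull g X"
  using assms gcomp_gid[OF emb_GHom, of "on_obj (act A g) X" "on_obj (act A g) Y" "on_mor (act A g) X Y f"]
  by (simp add: gcomp_assoc[symmetric] push_emb) (simp add: gcomp_assoc push_pull act_obj act_mor)

lemma emb_assoc:
  assumes "g \<in> carrier G" "h \<in> carrier G" "X \<in> Obj D"
  shows "emb (on_obj (act A (g \<otimes>\<^bsub>G\<^esub> h)) X) (on_obj (act A g) (on_obj (act A h) X)) (assoc A g h X) =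
    push g (on_obj (act A h) X) \<cdot> push h X \<cdot> pull (g \<otimes>\<^bsub>G\<^esub> h) X"
  using assms gcomp_gid[OF emb_GHom, of "on_obj (act A (g \<otimes>\<^bsub>G\<^esub> h)) X"
      "on_obj (act A g) (on_obj (act A h) X)" "assoc A g h X"]
  by (simp add: gcomp_assoc[symmetric] push_push) (simp add: gcomp_assoc push_pull act_obj assoc_Hom)

lemma emb_unitor:
  assumes "X \<in> Obj D"
  shows "emb (on_obj (act A \<one>\<^bsub>G\<^esub>) X) X (unitor A X) = pull \<one>\<^bsub>G\<^esub> X"
  using emb_mor[OF gid_GHom[OF assms]] gid_gcomp[OF pull_GHom[OF _ assms]]
  by (simp add: gid_def)

section \<open>Equivariant categories\<close>

definition family_arr :: "'o \<Rightarrow> ('g \<Rightarrow> 'm) \<Rightarrow> 'g \<Rightarrow> ('o \<times> 'g \<times> 'm \<times> 'o) option" where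
  "family_arr X \<psi> g = Some (X, g, \<psi> g, X)"

text \<open>The cocycle condition is multiplicativity of graded arrows and the unit condition is
  preservation of units, so a structure is a degree preserving homomorphism. Invertibility of \<psi>
  at \<open>g\<close> is recovered from its value at \<open>inv g\<close>. The statement is for a
  subgroup, so that \<open>H\<close> and the whole group are both treated in the graded category of
  \<open>G\<close>.\<close>

lemma equivariant_structures_iff:
  assumes K: "subgroup K G" and X: "X \<in> Obj D"
  shows "\<psi> \<in> equivariant_structures (G\<lparr>carrier := K\<rparr>) D A X \<longleftrightarrow>
    \<psi> \<in> extensional K \<and> (\<forall>g \<in> K. family_arr X \<psi> g \<in> GHom g X X) \<and>
    (\<forall>g \<in> K. \<forall>h \<in> K. family_arr X \<psi> (g \<otimes>\<^bsub>G\<^esub> h) = family_arr X \<psi> g \<cdot> family_arr X \<psi> h) \<and> family_arr X \<psi> \<one>\<^bsub>G\<^esub> = gid X"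
    (is "_ \<longleftrightarrow> ?ext \<and> ?typ \<and> ?mult \<and> ?unit")
proof -
  note [simp] = subgroup.mem_carrier[OF K] subgroup.m_closed[OF K] subgroup.one_closed[OF K]
    subgroup.m_inv_closed[OF K] X act_obj
  have ty: "family_arr X \<psi> g \<in> GHom g X X \<longleftrightarrow> \<psi> g \<in> Hom D (on_obj (act A g) X) X" if "g \<in> K" for g
    using that by (simp add: family_arr_def Some_GHom_iff)
  have iso: "\<psi> g \<in> Isos D (on_obj (act A g) X) X" if "?typ" "?mult" "?unit" "g \<in> K" for g
  proof -
    have g: "g \<in> carrier G" using that by simp
    have t: "family_arr X \<psi> g \<in> GHom g X X" "family_arr X \<psi> (inv\<^bsub>G\<^esub> g) \<in> GHom (inv\<^bsub>G\<^esub> g) X X" using that by auto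
    have gg: "family_arr X \<psi> g \<cdot> family_arr X \<psi> (inv\<^bsub>G\<^esub> g) = gid X" "family_arr X \<psi> (inv\<^bsub>G\<^esub> g) \<cdot> family_arr X \<psi> g = gid X"
      using that g by (metis r_inv l_inv subgroup.m_inv_closed[OF K])+
    have e: "emb (on_obj (act A g) X) X (\<psi> g) = family_arr X \<psi> g \<cdot> pull g X"
      using emb_mor[OF t(1)] by (simp add: family_arr_def)
    show ?thesis
    \<comment> \<open>With \<open>p\<close> for the arrows of \<psi>, the morphism at
      \<open>g\<close> is the word \<open>p(g) \<cdot> pull g X\<close>. Its inverse is therefore
      \<open>push g X \<cdot> p(inv g)\<close>.\<close>
    proof (rule IsosI_emb[where e = "push g X \<cdot> family_arr X \<psi> (inv\<^bsub>G\<^esub> g)"])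
      show "push g X \<cdot> family_arr X \<psi> (inv\<^bsub>G\<^esub> g) \<in> GHom \<one>\<^bsub>G\<^esub> X (on_obj (act A g) X)"
        using gcomp_closed[OF push_GHom t(2), of g] g by simp
      have "(push g X \<cdot> family_arr X \<psi> (inv\<^bsub>G\<^esub> g)) \<cdot> family_arr X \<psi> g \<cdot> pull g X =
        push g X \<cdot> (family_arr X \<psi> (inv\<^bsub>G\<^esub> g) \<cdot> family_arr X \<psi> g) \<cdot> pull g X"
        by (simp add: gcomp_assoc)
      then show "(push g X \<cdot> family_arr X \<psi> (inv\<^bsub>G\<^esub> g)) \<cdot> emb (on_obj (act A g) X) X (\<psi> g) = gid (on_obj (act A g) X)"
        using e gg g gid_gcomp[OF pull_GHom, of g X] push_pull[of g X] by simp
      have "(family_arr X \<psi> g \<cdot> pull g X) \<cdot> push g X \<cdot> family_arr X \<psi> (inv\<^bsub>G\<^esub> g) =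
        family_arr X \<psi> g \<cdot> (pull g X \<cdot> push g X) \<cdot> family_arr X \<psi> (inv\<^bsub>G\<^esub> g)"
        by (simp add: gcomp_assoc)
      then show "emb (on_obj (act A g) X) X (\<psi> g) \<cdot> push g X \<cdot> family_arr X \<psi> (inv\<^bsub>G\<^esub> g) = gid X"
        using e gg g gid_gcomp[OF t(2)] pull_push[of g X] by simp
      show "\<psi> g \<in> Hom D (on_obj (act A g) X) X" using t ty that by simp
    qed (use g in simp_all)
  qed
  have mult: "family_arr X \<psi> (g \<otimes>\<^bsub>G\<^esub> h) = family_arr X \<psi> g \<cdot> family_arr X \<psi> h \<longleftrightarrow> \<psi> (g \<otimes>\<^bsub>G\<^esub> h) =
           \<psi> g \<odot>\<^bsub>D\<^esub> on_mor (act A g) (on_obj (act A h) X) X (\<psi> h) \<odot>\<^bsub>D\<^esub> assoc A g h X"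
    if "g \<in> K" "h \<in> K" "\<psi> g \<in> Hom D (on_obj (act A g) X) X" "\<psi> h \<in> Hom D (on_obj (act A h) X) X" for g h
    using that by (simp add: family_arr_def gcomp_Some)
  have unit: "family_arr X \<psi> \<one>\<^bsub>G\<^esub> = gid X \<longleftrightarrow> \<psi> \<one>\<^bsub>G\<^esub> = unitor A X"
    by (simp add: family_arr_def gid_def)
  have "\<psi> \<in> equivariant_structures (G\<lparr>carrier := K\<rparr>) D A X \<longleftrightarrow>
    ?ext \<and> (\<forall>g \<in> K. \<psi> g \<in> Isos D (on_obj (act A g) X) X) \<and> ?typ \<and> ?mult \<and> ?unit"
    unfolding equivariant_structures_def
    using mult unit ty Isos_Hom by (auto simp: PiE_iff)
  with iso show ?thesis by blast
qed

text \<open>The two composites with \<open>emb X Y f\<close> have underlying morphisms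
  \<open>f \<circ> \<psi>\<^sub>g\<close> and \<open>\<chi>\<^sub>g \<circ> (g \<otimes> f)\<close>,
  so equivariance is commutation with the graded arrows.\<close>

lemma Hom_equivariant_iff:
  assumes K: "subgroup K G" and "X \<in> Obj D" "Y \<in> Obj D"
    and "\<psi> \<in> equivariant_structures (G\<lparr>carrier := K\<rparr>) D A X"
    and "\<chi> \<in> equivariant_structures (G\<lparr>carrier := K\<rparr>) D A Y"
  shows "f \<in> Hom (equivariant_category (G\<lparr>carrier := K\<rparr>) D A) (X, \<psi>) (Y, \<chi>) \<longleftrightarrow>
    f \<in> Hom D X Y \<and> (\<forall>g \<in> K. emb X Y f \<cdot> family_arr X \<psi> g = family_arr Y \<chi> g \<cdot> emb X Y f)"
proof -
  have "\<psi> g \<in> Hom D (on_obj (act A g) X) X" "\<chi> g \<in> Hom D (on_obj (act A g) Y) Y" if "g \<in> K" for g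
    using that assms equivariant_structures_iff[OF K] by (auto simp: family_arr_def Some_GHom_iff)
  then show ?thesis
    using assms subgroup.mem_carrier[OF K]
    by (auto simp: equivariant_category_def family_arr_def emb_gcomp_Some Some_gcomp_emb)
qed

section \<open>The equivariant category is linear and additive\<close>

lemma act_add: "g \<in> carrier G \<Longrightarrow> X \<in> Obj D \<Longrightarrow> Y \<in> Obj D \<Longrightarrow> f \<in> Hom D X Y \<Longrightarrow> f' \<in> Hom D X Y \<Longrightarrow>
    on_mor (act A g) X Y (f + f') = on_mor (act A g) X Y f + on_mor (act A g) X Y f'"
  by (rule linear_functor.on_mor_add[OF act_linear_functor])

lemma act_scale: "g \<in> carrier G \<Longrightarrow> X \<in> Obj D \<Longrightarrow> Y \<in> Obj D \<Longrightarrow> f \<in> Hom D X Y \<Longrightarrow>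
    on_mor (act A g) X Y (Scale D a f) = Scale D a (on_mor (act A g) X Y f)"
  by (rule linear_functor.on_mor_scale[OF act_linear_functor])

lemma act_zero: "g \<in> carrier G \<Longrightarrow> X \<in> Obj D \<Longrightarrow> Y \<in> Obj D \<Longrightarrow> on_mor (act A g) X Y 0 = 0"
  by (rule linear_functor.on_mor_zero[OF act_linear_functor])

lemma carrier_update_self: "G\<lparr>carrier := carrier G\<rparr> = G"
  by simp

lemmas equivariant_structures_self_iff =
  equivariant_structures_iff[OF subgroup_self, unfolded carrier_update_self]

lemmas Hom_equivariant_self_iff = Hom_equivariant_iff[OF subgroup_self, unfolded carrier_update_self]

lemma structure_GHom:
  "X \<in> Obj D \<Longrightarrow> \<psi> \<in> equivariant_structures G D A X \<Longrightarrow> g \<in> carrier G \<Longrightarrow> family_arr X \<psi> g \<in> GHom g X X"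
  by (simp add: equivariant_structures_self_iff)

lemma structure_Hom:
  "X \<in> Obj D \<Longrightarrow> \<psi> \<in> equivariant_structures G D A X \<Longrightarrow> g \<in> carrier G \<Longrightarrow>
    \<psi> g \<in> Hom D (on_obj (act A g) X) X"
  using structure_GHom[of X \<psi> g] by (simp add: family_arr_def Some_GHom_iff)

lemma Hom_equivariant_emb:
  assumes "P \<in> Obj (equivariant_category G D A)" "Q \<in> Obj (equivariant_category G D A)"
  shows "f \<in> Hom (equivariant_category G D A) P Q \<longleftrightarrow> f \<in> Hom D (fst P) (fst Q) \<and> (\<forall>g \<in> carrier G.
    emb (fst P) (fst Q) f \<cdot> family_arr (fst P) (snd P) g = family_arr (fst Q) (snd Q) g \<cdot> emb (fst P) (fst Q) f)"
  using assms by (cases P, cases Q) (simp add: Obj_equivariant Hom_equivariant_self_iff)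

text \<open>Both sides of the equivariance condition are linear in the morphism, so the Hom sets are
  subspaces. Closure under composition is commutation of graded arrows applied twice. The other
  axioms are inherited from \<open>D\<close>.\<close>

lemma equivariant_linear_category: "linear_category (equivariant_category G D A)" (is "linear_category ?E")
proof -
  note Obj_E = Obj_equivariant and Hom_E = Hom_equivariant and Id_E = Id_equivariant and emb_Hom_E = Hom_equivariant_emb
  note [simp] = Comp_equivariant Scale_equivariant
  show ?thesis
  proof (intro linear_category.intro linear_category_axioms.intro, goal_cases)
    case 1
    then show ?case by (simp add: vector_space_axioms)
  next
    case (2 P Q)
    then have o: "fst P \<in> Obj D" "fst Q \<in> Obj D" "\<And>g. g \<in> carrier G \<Longrightarrow> on_obj (act A g) (fst P) \<in> Obj D"
        "\<And>g. g \<in> carrier G \<Longrightarrow> on_obj (act A g) (fst Q) \<in> Obj D"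
        "\<And>g. g \<in> carrier G \<Longrightarrow> snd P g \<in> Hom D (on_obj (act A g) (fst P)) (fst P)"
        "\<And>g. g \<in> carrier G \<Longrightarrow> snd Q g \<in> Hom D (on_obj (act A g) (fst Q)) (fst Q)"
      by (auto simp: Obj_E structure_Hom act_obj)
    have "f + f' \<in> Hom ?E P Q" if "f \<in> Hom ?E P Q" "f' \<in> Hom ?E P Q" for f f'
    proof -
      have "(f + f') \<odot>\<^bsub>D\<^esub> snd P g = snd Q g \<odot>\<^bsub>D\<^esub> on_mor (act A g) (fst P) (fst Q) (f + f')" if g: "g \<in> carrier G" for g
        using g \<open>f \<in> _\<close> \<open>f' \<in> _\<close> o Comp_add_left[of "on_obj (act A g) (fst P)" "fst P" "fst Q" "snd P g" f f']
          Comp_add_right[of "on_obj (act A g) (fst P)" "on_obj (act A g) (fst Q)" "fst Q"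
            "on_mor (act A g) (fst P) (fst Q) f" "on_mor (act A g) (fst P) (fst Q) f'" "snd Q g"]
        by (simp add: Hom_E act_add act_mor)
      with that o show ?thesis by (simp add: Hom_E add_Hom)
    qed
    moreover have "Scale D a f \<in> Hom ?E P Q" if "f \<in> Hom ?E P Q" for a f
    proof -
      have "Scale D a f \<odot>\<^bsub>D\<^esub> snd P g = snd Q g \<odot>\<^bsub>D\<^esub> on_mor (act A g) (fst P) (fst Q) (Scale D a f)" if g: "g \<in> carrier G" for g
        using g \<open>f \<in> _\<close> o Comp_scale_left[of "on_obj (act A g) (fst P)" "fst P" "fst Q" "snd P g" f a]
          Comp_scale_right[of "on_obj (act A g) (fst P)" "on_obj (act A g) (fst Q)" "fst Q"
            "on_mor (act A g) (fst P) (fst Q) f" "snd Q g" a]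
        by (simp add: Hom_E act_scale act_mor)
      with that o show ?thesis by (simp add: Hom_E scale_Hom)
    qed
    moreover have "0 \<in> Hom ?E P Q"
    proof -
      have "0 \<odot>\<^bsub>D\<^esub> snd P g = snd Q g \<odot>\<^bsub>D\<^esub> on_mor (act A g) (fst P) (fst Q) 0" if g: "g \<in> carrier G" for g
        using g o Comp_zero_left[of "on_obj (act A g) (fst P)" "fst P" "fst Q" "snd P g"]
          Comp_zero_right[of "on_obj (act A g) (fst P)" "on_obj (act A g) (fst Q)" "fst Q" "snd Q g"]
        by (simp add: act_zero)
      with o show ?thesis by (simp add: Hom_E zero_Hom)
    qed
    ultimately show ?case by (simp add: subspace_def)
  next
    case (3 P)
    then show ?case
      using Comp_Id_left[of "on_obj (act A g) (fst P)" "fst P" "snd P g" for g]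
        Comp_Id_right[of "on_obj (act A g) (fst P)" "fst P" "snd P g" for g]
      by (auto simp: Obj_E Hom_E Id_E act_Id Id_in_Hom act_obj structure_Hom)
  next
    case (4 P Q R f f')
    have h: "f \<in> Hom D (fst P) (fst Q)" "f' \<in> Hom D (fst Q) (fst R)" using 4 by (simp_all add: Hom_E)
    have "(emb (fst Q) (fst R) f' \<cdot> emb (fst P) (fst Q) f) \<cdot> family_arr (fst P) (snd P) g =
        family_arr (fst R) (snd R) g \<cdot> (emb (fst Q) (fst R) f' \<cdot> emb (fst P) (fst Q) f)" if "g \<in> carrier G" for g
      using 4 that by (simp add: emb_Hom_E) (metis gcomp_assoc)
    then show ?case
      using 4 h Comp_in_Hom[of "fst P" "fst Q" "fst R" f f']
      by (simp add: emb_Hom_E emb_Comp[where Y = "fst Q"]) (simp add: Obj_E emb_Comp[where Y = "fst Q"])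
  next
    case (5 P Q R S f g h)
    then show ?case using Comp_assoc[of "fst P" "fst Q" "fst R" "fst S" f g h] by (simp add: Obj_E Hom_E)
  next
    case (6 P Q f)
    then show ?case using Comp_Id_right[of "fst P" "fst Q" f] by (simp add: Obj_E Hom_E Id_E)
  next
    case (7 P Q f)
    then show ?case using Comp_Id_left[of "fst P" "fst Q" f] by (simp add: Obj_E Hom_E Id_E)
  next
    case (8 P Q R f f' g)
    then show ?case using Comp_add_right[of "fst P" "fst Q" "fst R" f f' g] by (simp add: Obj_E Hom_E)
  next
    case (9 P Q R f g g')
    then show ?case using Comp_add_left[of "fst P" "fst Q" "fst R" f g g'] by (simp add: Obj_E Hom_E)
  next
    case (10 P Q R f g a)
    then show ?case using Comp_scale_right[of "fst P" "fst Q" "fst R" f g a] by (simp add: Obj_E Hom_E)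
  next
    case (11 P Q R f g a)
    then show ?case using Comp_scale_left[of "fst P" "fst Q" "fst R" f g a] by (simp add: Obj_E Hom_E)
  qed
qed

text \<open>All morphisms into the zero object \<open>Z\<close> vanish, so in each degree there is
  only one arrow from \<open>Z\<close> to itself and every equation between such arrows
  holds.\<close>

lemma equivariant_zero_object: "\<exists>Z. zero_object (equivariant_category G D A) Z"
proof -
  obtain Z where Z: "zero_object D Z" using has_zero_object by blast
  then have [simp]: "Hom D X Z = {0}" "Hom D Z X = {0}" if "X \<in> Obj D" for X
    using that by (auto simp: zero_object_def)
  have ZO: "Z \<in> Obj D" using Z by (simp add: zero_object_def)
  define \<zeta> where "\<zeta> = (\<lambda>g \<in> carrier G. 0 :: 'm)"
  have one: "a = b" if "a \<in> GHom g Z Z" "b \<in> GHom g Z Z" for g a b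
    using that by (auto simp: GHom_def act_obj)
  have ty: "family_arr Z \<zeta> g \<in> GHom g Z Z" if "g \<in> carrier G" for g
    using that ZO by (simp add: family_arr_def Some_GHom_iff \<zeta>_def act_obj)
  have "\<zeta> \<in> equivariant_structures G D A Z"
    unfolding equivariant_structures_self_iff[OF ZO]
    using ty one[OF ty gcomp_closed[OF ty ty]] one[OF ty gid_GHom[OF ZO]] by (auto simp: \<zeta>_def)
  moreover have "Hom (equivariant_category G D A) P (Z, \<zeta>) = {0}" "Hom (equivariant_category G D A) (Z, \<zeta>) P = {0}"
    if "P \<in> Obj (equivariant_category G D A)" for P
  proof -
    have Zo: "(Z, \<zeta>) \<in> Obj (equivariant_category G D A)"
      using calculation ZO by (simp add: Obj_equivariant)
    have "0 \<in> Hom (equivariant_category G D A) P (Z, \<zeta>)" "0 \<in> Hom (equivariant_category G D A) (Z, \<zeta>) P"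
      by (rule linear_category.zero_Hom[OF equivariant_linear_category]; fact)+
    moreover have "Hom (equivariant_category G D A) P (Z, \<zeta>) \<subseteq> {0}" "Hom (equivariant_category G D A) (Z, \<zeta>) P \<subseteq> {0}"
      using that by (auto simp: Hom_equivariant Obj_equivariant)
    ultimately show "Hom (equivariant_category G D A) P (Z, \<zeta>) = {0}" "Hom (equivariant_category G D A) (Z, \<zeta>) P = {0}"
      by blast+
  qed
  ultimately have "zero_object (equivariant_category G D A) (Z, \<zeta>)"
    using ZO by (simp add: zero_object_def Obj_equivariant)
  then show ?thesis ..
qed

text \<open>The biproduct \<open>S\<close> in \<open>D\<close> is given the structure that makes
  both projections equivariant. The projections are jointly monic, so the homomorphism law on
  \<open>S\<close> and the equivariance of the injections are checked after composing with
  \<open>p\<close> and with \<open>q\<close>.\<close>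

lemma equivariant_biproduct:
  assumes P: "P \<in> Obj (equivariant_category G D A)" and Q: "Q \<in> Obj (equivariant_category G D A)"
  shows "\<exists>R. biproduct (equivariant_category G D A) P Q R"
proof -
  obtain X \<psi> where P_eq: "P = (X, \<psi>)" by (cases P)
  obtain Y \<chi> where Q_eq: "Q = (Y, \<chi>)" by (cases Q)
  have X: "X \<in> Obj D" and \<psi>: "\<psi> \<in> equivariant_structures G D A X" using P by (simp_all add: P_eq Obj_equivariant)
  have Y: "Y \<in> Obj D" and \<chi>: "\<chi> \<in> equivariant_structures G D A Y" using Q by (simp_all add: Q_eq Obj_equivariant)
  obtain S where "biproduct D X Y S" using has_biproducts X Y by blast
  then obtain i j p q where S: "S \<in> Obj D" and i: "i \<in> Hom D X S" and j: "j \<in> Hom D Y S"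
    and p: "p \<in> Hom D S X" and q: "q \<in> Hom D S Y"
    and eqs: "p \<odot>\<^bsub>D\<^esub> i = Id D X" "q \<odot>\<^bsub>D\<^esub> j = Id D Y" "p \<odot>\<^bsub>D\<^esub> j = 0" "q \<odot>\<^bsub>D\<^esub> i = 0"
    and sum: "i \<odot>\<^bsub>D\<^esub> p + j \<odot>\<^bsub>D\<^esub> q = Id D S"
    unfolding biproduct_def by blast
  have monic: "a = b" if "T \<in> Obj D" "a \<in> Hom D T S" "b \<in> Hom D T S"
      "p \<odot>\<^bsub>D\<^esub> a = p \<odot>\<^bsub>D\<^esub> b" "q \<odot>\<^bsub>D\<^esub> a = q \<odot>\<^bsub>D\<^esub> b" for T a b
  proof -
    have "c = i \<odot>\<^bsub>D\<^esub> (p \<odot>\<^bsub>D\<^esub> c) + j \<odot>\<^bsub>D\<^esub> (q \<odot>\<^bsub>D\<^esub> c)" if "c \<in> Hom D T S" for c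
    proof -
      note t = \<open>T \<in> Obj D\<close>
      have "c = (i \<odot>\<^bsub>D\<^esub> p + j \<odot>\<^bsub>D\<^esub> q) \<odot>\<^bsub>D\<^esub> c"
        unfolding sum by (rule Comp_Id_left[OF t S that, symmetric])
      also have "\<dots> = i \<odot>\<^bsub>D\<^esub> p \<odot>\<^bsub>D\<^esub> c + j \<odot>\<^bsub>D\<^esub> q \<odot>\<^bsub>D\<^esub> c"
        by (rule Comp_add_left[OF t S S that Comp_in_Hom[OF S X S p i] Comp_in_Hom[OF S Y S q j]])
      also have "\<dots> = i \<odot>\<^bsub>D\<^esub> (p \<odot>\<^bsub>D\<^esub> c) + j \<odot>\<^bsub>D\<^esub> (q \<odot>\<^bsub>D\<^esub> c)"
        unfolding Comp_assoc[OF t S X S that p i] Comp_assoc[OF t S Y S that q j] ..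
      finally show ?thesis .
    qed
    from this[OF that(2)] this[OF that(3)] that(4,5) show ?thesis by simp
  qed
  \<comment> \<open>An arrow of degree \<open>g\<close> into \<open>S\<close> is a morphism out of
    \<open>g \<otimes> T\<close>, so joint monicity carries over to every degree.\<close>
  have gmonic: "a = b" if "a \<in> GHom g T S" "b \<in> GHom g T S"
      "emb S X p \<cdot> a = emb S X p \<cdot> b" "emb S Y q \<cdot> a = emb S Y q \<cdot> b" for g T a b
  proof -
    obtain f where f: "a = Some (T, g, f, S)" "g \<in> carrier G" "T \<in> Obj D" 
      "f \<in> Hom D (on_obj (act A g) T) S" using \<open>a \<in> _\<close> by (rule GHomE)
    obtain f' where f': "b = Some (T, g, f', S)"
      "f' \<in> Hom D (on_obj (act A g) T) S" using \<open>b \<in> _\<close> by (rule GHomE)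
    have "p \<odot>\<^bsub>D\<^esub> f = p \<odot>\<^bsub>D\<^esub> f'"
      using that(3) emb_gcomp_Some[OF f(3) S X f(2) p f(4)] emb_gcomp_Some[OF f(3) S X f(2) p f'(2)]
      unfolding f(1) f'(1) by simp
    moreover have "q \<odot>\<^bsub>D\<^esub> f = q \<odot>\<^bsub>D\<^esub> f'"
      using that(4) emb_gcomp_Some[OF f(3) S Y f(2) q f(4)] emb_gcomp_Some[OF f(3) S Y f(2) q f'(2)]
      unfolding f(1) f'(1) by simp
    ultimately have "f = f'"
      using f(4) f'(2) by (rule monic[OF act_obj[OF f(2,3)], rotated 2])
    with f f' show ?thesis by simp
  qed
  \<comment> \<open>The diagonal structure: project, act by \<psi> or \<chi>, inject and add. Joint
    monicity of \<open>p\<close> and \<open>q\<close> leaves no other choice if both are to be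
    equivariant.\<close>
  define \<sigma> where "\<sigma> = (\<lambda>g \<in> carrier G. i \<odot>\<^bsub>D\<^esub> (\<psi> g \<odot>\<^bsub>D\<^esub> on_mor (act A g) S X p)
    + j \<odot>\<^bsub>D\<^esub> (\<chi> g \<odot>\<^bsub>D\<^esub> on_mor (act A g) S Y q))"
  have \<sigma>: "family_arr S \<sigma> g \<in> GHom g S S \<and> emb S X p \<cdot> family_arr S \<sigma> g = family_arr X \<psi> g \<cdot> emb S X p \<and>
     emb S Y q \<cdot> family_arr S \<sigma> g = family_arr Y \<chi> g \<cdot> emb S Y q" if g: "g \<in> carrier G" for g
  proof -
    let ?s = "\<psi> g \<odot>\<^bsub>D\<^esub> on_mor (act A g) S X p" and ?t = "\<chi> g \<odot>\<^bsub>D\<^esub> on_mor (act A g) S Y q"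
    let ?S = "on_obj (act A g) S"
    note [simp] = X Y S g p q i j structure_Hom[OF X \<psi> g] structure_Hom[OF Y \<chi> g] act_mor act_obj eqs
    have [simp]: "?s \<in> Hom D ?S X" "?t \<in> Hom D ?S Y"
      using Comp_in_Hom[of ?S "on_obj (act A g) X" X "on_mor (act A g) S X p" "\<psi> g"]
        Comp_in_Hom[of ?S "on_obj (act A g) Y" Y "on_mor (act A g) S Y q" "\<chi> g"] by simp_all
    have [simp]: "i \<odot>\<^bsub>D\<^esub> ?s \<in> Hom D ?S S" "j \<odot>\<^bsub>D\<^esub> ?t \<in> Hom D ?S S"
      using Comp_in_Hom[of ?S X S ?s i] Comp_in_Hom[of ?S Y S ?t j] by simp_all
    have r: "r \<odot>\<^bsub>D\<^esub> \<sigma> g = r \<odot>\<^bsub>D\<^esub> i \<odot>\<^bsub>D\<^esub> ?s + r \<odot>\<^bsub>D\<^esub> j \<odot>\<^bsub>D\<^esub> ?t" if Z: "Z \<in> Obj D" and r: "r \<in> Hom D S Z" for r Z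
    proof -
      have "r \<odot>\<^bsub>D\<^esub> (i \<odot>\<^bsub>D\<^esub> ?s + j \<odot>\<^bsub>D\<^esub> ?t) = r \<odot>\<^bsub>D\<^esub> (i \<odot>\<^bsub>D\<^esub> ?s) + r \<odot>\<^bsub>D\<^esub> (j \<odot>\<^bsub>D\<^esub> ?t)"
        by (rule Comp_add_right[where X = ?S and Y = S and Z = Z]) (simp_all add: r Z)
      moreover have "r \<odot>\<^bsub>D\<^esub> (i \<odot>\<^bsub>D\<^esub> ?s) = r \<odot>\<^bsub>D\<^esub> i \<odot>\<^bsub>D\<^esub> ?s"
        by (rule Comp_assoc[symmetric, where X = ?S and Y = X and Z = S and W = Z]) (simp_all add: r Z)
      moreover have "r \<odot>\<^bsub>D\<^esub> (j \<odot>\<^bsub>D\<^esub> ?t) = r \<odot>\<^bsub>D\<^esub> j \<odot>\<^bsub>D\<^esub> ?t"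
        by (rule Comp_assoc[symmetric, where X = ?S and Y = Y and Z = S and W = Z]) (simp_all add: r Z)
      ultimately show ?thesis by (simp only: \<sigma>_def restrict_apply g if_True)
    qed
    have "Id D X \<odot>\<^bsub>D\<^esub> ?s = ?s" "Id D Y \<odot>\<^bsub>D\<^esub> ?t = ?t" "0 \<odot>\<^bsub>D\<^esub> ?t = 0" "0 \<odot>\<^bsub>D\<^esub> ?s = 0"
      by (rule Comp_Id_left[where X = ?S and Y = X] Comp_Id_left[where X = ?S and Y = Y]
          Comp_zero_left[where X = ?S and Y = X and Z = Y] Comp_zero_left[where X = ?S and Y = Y and Z = X]; simp)+
    then have "p \<odot>\<^bsub>D\<^esub> \<sigma> g = ?s" "q \<odot>\<^bsub>D\<^esub> \<sigma> g = ?t"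
      unfolding r[OF X p] r[OF Y q] eqs by simp_all
    moreover have "\<sigma> g \<in> Hom D ?S S" by (simp add: \<sigma>_def add_Hom)
    ultimately show ?thesis
      by (simp add: family_arr_def Some_GHom_iff emb_gcomp_Some Some_gcomp_emb)
  qed
  have \<psi>': "\<forall>g \<in> carrier G. \<forall>h \<in> carrier G. family_arr X \<psi> (g \<otimes>\<^bsub>G\<^esub> h) = family_arr X \<psi> g \<cdot> family_arr X \<psi> h" "family_arr X \<psi> \<one>\<^bsub>G\<^esub> = gid X"
    using \<psi> unfolding equivariant_structures_self_iff[OF X] by auto
  have \<chi>': "\<forall>g \<in> carrier G. \<forall>h \<in> carrier G. family_arr Y \<chi> (g \<otimes>\<^bsub>G\<^esub> h) = family_arr Y \<chi> g \<cdot> family_arr Y \<chi> h" "family_arr Y \<chi> \<one>\<^bsub>G\<^esub> = gid Y"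
    using \<chi> unfolding equivariant_structures_self_iff[OF Y] by auto
  have "\<sigma> \<in> equivariant_structures G D A S"
    unfolding equivariant_structures_self_iff[OF S]
  proof (intro conjI ballI)
    show "\<sigma> \<in> extensional (carrier G)" by (simp add: \<sigma>_def)
    show "family_arr S \<sigma> g \<in> GHom g S S" if "g \<in> carrier G" for g using \<sigma> that by blast
    show "family_arr S \<sigma> (g \<otimes>\<^bsub>G\<^esub> h) = family_arr S \<sigma> g \<cdot> family_arr S \<sigma> h" if "g \<in> carrier G" "h \<in> carrier G" for g h
    proof (rule gmonic)
      show "emb S X p \<cdot> family_arr S \<sigma> (g \<otimes>\<^bsub>G\<^esub> h) = emb S X p \<cdot> family_arr S \<sigma> g \<cdot> family_arr S \<sigma> h"
        using \<sigma> \<psi>' that by (metis gcomp_assoc m_closed)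
      show "emb S Y q \<cdot> family_arr S \<sigma> (g \<otimes>\<^bsub>G\<^esub> h) = emb S Y q \<cdot> family_arr S \<sigma> g \<cdot> family_arr S \<sigma> h"
        using \<sigma> \<chi>' that by (metis gcomp_assoc m_closed)
    qed (use \<sigma>[OF m_closed[OF that]] gcomp_closed[OF conjunct1[OF \<sigma>] conjunct1[OF \<sigma>], of g h] that in simp_all)
    show "family_arr S \<sigma> \<one>\<^bsub>G\<^esub> = gid S"
    proof (rule gmonic)
      show "emb S X p \<cdot> family_arr S \<sigma> \<one>\<^bsub>G\<^esub> = emb S X p \<cdot> gid S"
        using \<sigma>[OF one_closed] \<psi>' gcomp_gid[OF emb_GHom[OF S X p]] gid_gcomp[OF emb_GHom[OF S X p]] by simp
      show "emb S Y q \<cdot> family_arr S \<sigma> \<one>\<^bsub>G\<^esub> = emb S Y q \<cdot> gid S"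
        using \<sigma>[OF one_closed] \<chi>' gcomp_gid[OF emb_GHom[OF S Y q]] gid_gcomp[OF emb_GHom[OF S Y q]] by simp
    qed (use \<sigma> gid_GHom[OF S] in simp_all)
  qed
  then have R: "(S, \<sigma>) \<in> Obj (equivariant_category G D A)" using S by (simp add: Obj_equivariant)
  let ?E = "equivariant_category G D A"
  have "p \<in> Hom ?E (S, \<sigma>) P" "q \<in> Hom ?E (S, \<sigma>) Q"
    using R P Q \<sigma> p q by (simp_all add: Hom_equivariant_emb P_eq Q_eq)
  \<comment> \<open>The mixed composites of projections and injections vanish, so their equivariance
    is that of the zero morphism.\<close>
  moreover have zero: "emb X Y 0 \<cdot> family_arr X \<psi> g = family_arr Y \<chi> g \<cdot> emb X Y 0"
     "emb Y X 0 \<cdot> family_arr Y \<chi> g = family_arr X \<psi> g \<cdot> emb Y X 0" if "g \<in> carrier G" for g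
    using that linear_category.zero_Hom[OF equivariant_linear_category P Q]
      linear_category.zero_Hom[OF equivariant_linear_category Q P]
    by (simp_all add: Hom_equivariant_emb P Q, simp_all add: P_eq Q_eq)
  moreover have pi: "emb S X p \<cdot> emb X S i = gid X" "emb S Y q \<cdot> emb Y S j = gid Y"
    "emb S X p \<cdot> emb Y S j = emb Y X 0" "emb S Y q \<cdot> emb X S i = emb X Y 0"
    using X Y S i j p q eqs emb_Comp[of X S X i p] emb_Comp[of Y S Y j q] emb_Comp[of Y S X j p] emb_Comp[of X S Y i q]
    by (simp_all add: emb_Id)
  moreover have "emb X S i \<cdot> family_arr X \<psi> g = family_arr S \<sigma> g \<cdot> emb X S i" if g: "g \<in> carrier G" for g
  proof (rule gmonic)
    note t = structure_GHom[OF X \<psi> g]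
    show "emb X S i \<cdot> family_arr X \<psi> g \<in> GHom g X S" "family_arr S \<sigma> g \<cdot> emb X S i \<in> GHom g X S"
      using gcomp_closed[OF emb_GHom[OF X S i] t] gcomp_closed[OF conjunct1[OF \<sigma>[OF g]] emb_GHom[OF X S i]] g by simp_all
    show "emb S X p \<cdot> emb X S i \<cdot> family_arr X \<psi> g = emb S X p \<cdot> family_arr S \<sigma> g \<cdot> emb X S i"
      using \<sigma>[OF g] pi gid_gcomp[OF t] gcomp_gid[OF t] by (metis gcomp_assoc)
    show "emb S Y q \<cdot> emb X S i \<cdot> family_arr X \<psi> g = emb S Y q \<cdot> family_arr S \<sigma> g \<cdot> emb X S i"
      using \<sigma>[OF g] pi zero[OF g] by (metis gcomp_assoc)
  qed
  moreover have "emb Y S j \<cdot> family_arr Y \<chi> g = family_arr S \<sigma> g \<cdot> emb Y S j" if g: "g \<in> carrier G" for g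
  proof (rule gmonic)
    note t = structure_GHom[OF Y \<chi> g]
    show "emb Y S j \<cdot> family_arr Y \<chi> g \<in> GHom g Y S" "family_arr S \<sigma> g \<cdot> emb Y S j \<in> GHom g Y S"
      using gcomp_closed[OF emb_GHom[OF Y S j] t] gcomp_closed[OF conjunct1[OF \<sigma>[OF g]] emb_GHom[OF Y S j]] g by simp_all
    show "emb S X p \<cdot> emb Y S j \<cdot> family_arr Y \<chi> g = emb S X p \<cdot> family_arr S \<sigma> g \<cdot> emb Y S j"
      using \<sigma>[OF g] pi zero[OF g] by (metis gcomp_assoc)
    show "emb S Y q \<cdot> emb Y S j \<cdot> family_arr Y \<chi> g = emb S Y q \<cdot> family_arr S \<sigma> g \<cdot> emb Y S j"
      using \<sigma>[OF g] pi gid_gcomp[OF t] gcomp_gid[OF t] by (metis gcomp_assoc)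
  qed
  ultimately have "p \<in> Hom ?E (S, \<sigma>) P" "q \<in> Hom ?E (S, \<sigma>) Q" "i \<in> Hom ?E P (S, \<sigma>)" "j \<in> Hom ?E Q (S, \<sigma>)"
    using P Q R i j by (simp_all add: Hom_equivariant_emb P_eq Q_eq)
  then have "biproduct ?E P Q (S, \<sigma>)"
    unfolding biproduct_def Id_equivariant Comp_equivariant using P Q R eqs sum by (auto simp: P_eq Q_eq)
  then show ?thesis ..
qed

lemma equivariant_k_category: "k_category (equivariant_category G D A)"
  using equivariant_linear_category equivariant_zero_object equivariant_biproduct
  by (simp add: k_category_def k_category_axioms_def)

lemma restrict_action:
  assumes "subgroup K G"
  shows "category_action (G\<lparr>carrier := K\<rparr>) D A"
proof -
  note [simp] = subgroup.mem_carrier[OF assms]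
  show ?thesis
    using act_linear_functor assoc_natural_iso unitor_natural_iso pentagon triangle left_triangle
    by (intro category_action.intro category_action_axioms.intro subgroup.subgroup_is_group[OF assms group_axioms]
        k_category_axioms) simp_all
qed

text \<open>Stated with Hom in place of Isos for the action of the factor group on
  \<open>DH\<close>: there, lying in a Hom set translates directly into an equation of graded
  arrows.\<close>

lemma equivariant_structures_Hom_iff:
  assumes X: "X \<in> Obj D"
  shows "\<psi> \<in> equivariant_structures G D A X \<longleftrightarrow>
    \<psi> \<in> extensional (carrier G) \<and> (\<forall>g \<in> carrier G. \<psi> g \<in> Hom D (on_obj (act A g) X) X) \<and>
    (\<forall>g \<in> carrier G. \<forall>h \<in> carrier G. \<psi> (g \<otimes>\<^bsub>G\<^esub> h) =
       \<psi> g \<odot>\<^bsub>D\<^esub> on_mor (act A g) (on_obj (act A h) X) X (\<psi> h) \<odot>\<^bsub>D\<^esub> assoc A g h X) \<and>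
    \<psi> \<one>\<^bsub>G\<^esub> = unitor A X"
  unfolding equivariant_structures_self_iff[OF X]
  by (auto simp: family_arr_def Some_GHom_iff gcomp_Some gid_def X)

section \<open>Rewriting words of graded arrows\<close>

lemma push_gid: "g \<in> carrier G \<Longrightarrow> X \<in> Obj D \<Longrightarrow> push g X \<cdot> gid X = push g X"
  by (rule gcomp_gid[OF push_GHom])

lemma gid_push: "g \<in> carrier G \<Longrightarrow> X \<in> Obj D \<Longrightarrow> gid (on_obj (act A g) X) \<cdot> push g X = push g X"
  by (rule gid_gcomp[OF push_GHom])

lemma pull_gid: "g \<in> carrier G \<Longrightarrow> X \<in> Obj D \<Longrightarrow> pull g X \<cdot> gid (on_obj (act A g) X) = pull g X"
  by (rule gcomp_gid[OF pull_GHom])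

lemma gid_pull: "g \<in> carrier G \<Longrightarrow> X \<in> Obj D \<Longrightarrow> gid X \<cdot> pull g X = pull g X"
  by (rule gid_gcomp[OF pull_GHom])

lemma emb_gid: "X \<in> Obj D \<Longrightarrow> Y \<in> Obj D \<Longrightarrow> f \<in> Hom D X Y \<Longrightarrow> emb X Y f \<cdot> gid X = emb X Y f"
  by (rule gcomp_gid[OF emb_GHom])

lemma gid_emb: "X \<in> Obj D \<Longrightarrow> Y \<in> Obj D \<Longrightarrow> f \<in> Hom D X Y \<Longrightarrow> gid Y \<cdot> emb X Y f = emb X Y f"
  by (rule gid_gcomp[OF emb_GHom])

text \<open>Words are bracketed to the right, so a rule for \<open>a \<cdot> b\<close> matches only
  at the end of a word. This produces its variant for the inside.\<close>

lemma gcomp_eq_assoc: "a \<cdot> b = c \<Longrightarrow> a \<cdot> b \<cdot> z = c \<cdot> z"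
  by (simp flip: gcomp_assoc)

lemmas gcomp_simps = gcomp_assoc push_gid gid_push pull_gid gid_pull emb_gid gid_emb pull_push push_pull
  push_gid[THEN gcomp_eq_assoc] gid_push[THEN gcomp_eq_assoc] pull_gid[THEN gcomp_eq_assoc]
  gid_pull[THEN gcomp_eq_assoc] emb_gid[THEN gcomp_eq_assoc] gid_emb[THEN gcomp_eq_assoc]
  pull_push[THEN gcomp_eq_assoc] push_pull[THEN gcomp_eq_assoc]

end

section \<open>The lifted action\<close>

locale normal_action = category_action G D A + normal H G
  for G :: "('g, 'b) monoid_scheme"
    and D :: "('k::field, 'o, 'm::ab_group_add) lin_cat"
    and A :: "('g, 'o, 'm) cat_action"
    and H :: "'g set"
begin

text \<open>Unfolding the operations of the factor group would defeat its group laws as rewrite rules.\<close>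

declare one_FactGroup [simp del] mult_FactGroup [simp del]

abbreviation DH :: "('k, 'o \<times> ('g \<Rightarrow> 'm), 'm) lin_cat" where
  "DH \<equiv> equivariant_category (G\<lparr>carrier := H\<rparr>) D A"

definition struct_arr :: "'o \<times> ('g \<Rightarrow> 'm) \<Rightarrow> 'g \<Rightarrow> ('o \<times> 'g \<times> 'm \<times> 'o) option" where
  "struct_arr P h = family_arr (fst P) (snd P) h"

definition lift_obj :: "'g \<Rightarrow> 'o \<times> ('g \<Rightarrow> 'm) \<Rightarrow> 'o \<times> ('g \<Rightarrow> 'm)" where
  "lift_obj g P = (on_obj (act A g) (fst P),
     \<lambda>h \<in> H. mor (push g (fst P) \<cdot> struct_arr P (inv\<^bsub>G\<^esub> g \<otimes>\<^bsub>G\<^esub> h \<otimes>\<^bsub>G\<^esub> g) \<cdot> pull g (fst P)))"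

definition lift :: "'g \<Rightarrow> ('o \<times> ('g \<Rightarrow> 'm), 'm, 'o \<times> ('g \<Rightarrow> 'm), 'm) funct" where
  "lift g = \<lparr>on_obj = lift_obj g, on_mor = (\<lambda>P Q. on_mor (act A g) (fst P) (fst Q))\<rparr>"

lemma lift_sel:
  "on_obj (lift g) = lift_obj g" "on_mor (lift g) P Q = on_mor (act A g) (fst P) (fst Q)"
  by (simp_all add: lift_def)

definition lifted_action :: "('g, 'o \<times> ('g \<Rightarrow> 'm), 'm) cat_action" where
  "lifted_action = \<lparr>act = lift, assoc = (\<lambda>g h P. assoc A g h (fst P)), unitor = (\<lambda>P. unitor A (fst P))\<rparr>"

section \<open>The category \<open>DH\<close> in graded terms\<close>

lemma DH_k_category: "k_category DH"
  by (rule category_action.equivariant_k_category[OF restrict_action[OF subgroup_axioms]])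

lemma DH_linear_category: "linear_category DH"
  using DH_k_category by (simp add: k_category_def)

lemma Obj_DH: "P \<in> Obj DH \<longleftrightarrow> fst P \<in> Obj D \<and> snd P \<in> extensional H \<and>
    (\<forall>h \<in> H. struct_arr P h \<in> GHom h (fst P) (fst P)) \<and>
    (\<forall>h \<in> H. \<forall>k \<in> H. struct_arr P (h \<otimes>\<^bsub>G\<^esub> k) = struct_arr P h \<cdot> struct_arr P k) \<and>
    struct_arr P \<one>\<^bsub>G\<^esub> = gid (fst P)"
  using equivariant_structures_iff[OF subgroup_axioms, of "fst P" "snd P"]
  by (auto simp: Obj_equivariant struct_arr_def)

lemma Obj_DH_fst: "P \<in> Obj DH \<Longrightarrow> fst P \<in> Obj D"
  by (simp add: Obj_equivariant)

lemma Hom_DH: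
  assumes "P \<in> Obj DH" "Q \<in> Obj DH"
  shows "f \<in> Hom DH P Q \<longleftrightarrow> f \<in> Hom D (fst P) (fst Q) \<and>
    (\<forall>h \<in> H. emb (fst P) (fst Q) f \<cdot> struct_arr P h = struct_arr Q h \<cdot> emb (fst P) (fst Q) f)"
  using assms Hom_equivariant_iff[OF subgroup_axioms, of "fst P" "fst Q" "snd P" "snd Q"]
  by (simp add: Obj_equivariant struct_arr_def)

lemma Hom_DH_Hom: "f \<in> Hom DH P Q \<Longrightarrow> f \<in> Hom D (fst P) (fst Q)"
  by (simp add: Hom_equivariant)

lemma struct_GHom: "P \<in> Obj DH \<Longrightarrow> h \<in> H \<Longrightarrow> struct_arr P h \<in> GHom h (fst P) (fst P)"
  by (simp add: Obj_DH)

lemma struct_mult: "P \<in> Obj DH \<Longrightarrow> h \<in> H \<Longrightarrow> k \<in> H \<Longrightarrow>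
    struct_arr P h \<cdot> struct_arr P k = struct_arr P (h \<otimes>\<^bsub>G\<^esub> k)"
  by (simp add: Obj_DH)

lemma struct_one: "P \<in> Obj DH \<Longrightarrow> struct_arr P \<one>\<^bsub>G\<^esub> = gid (fst P)"
  by (simp add: Obj_DH)

lemma struct_gid: "P \<in> Obj DH \<Longrightarrow> h \<in> H \<Longrightarrow> struct_arr P h \<cdot> gid (fst P) = struct_arr P h"
  by (rule gcomp_gid[OF struct_GHom])

lemma gid_struct: "P \<in> Obj DH \<Longrightarrow> h \<in> H \<Longrightarrow> gid (fst P) \<cdot> struct_arr P h = struct_arr P h"
  by (rule gid_gcomp[OF struct_GHom])

lemma struct_emb: "P \<in> Obj DH \<Longrightarrow> Q \<in> Obj DH \<Longrightarrow> f \<in> Hom DH P Q \<Longrightarrow> h \<in> H \<Longrightarrow>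
    struct_arr Q h \<cdot> emb (fst P) (fst Q) f = emb (fst P) (fst Q) f \<cdot> struct_arr P h"
  by (simp add: Hom_DH)

text \<open>The rules merge neighbouring structure arrows and move them to the right past
  equivariant morphisms. Two words with the same outcome then differ at most in the group element
  inside one structure arrow.\<close>

lemmas struct_simps = gcomp_simps struct_mult struct_gid gid_struct struct_emb
  struct_mult[THEN gcomp_eq_assoc] struct_gid[THEN gcomp_eq_assoc] gid_struct[THEN gcomp_eq_assoc]
  struct_emb[THEN gcomp_eq_assoc]

lemma inv_cancel_left: "x \<in> carrier G \<Longrightarrow> y \<in> carrier G \<Longrightarrow> inv\<^bsub>G\<^esub> x \<otimes>\<^bsub>G\<^esub> (x \<otimes>\<^bsub>G\<^esub> y) = y"
  by (simp flip: m_assoc)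

lemma cancel_inv_left: "x \<in> carrier G \<Longrightarrow> y \<in> carrier G \<Longrightarrow> x \<otimes>\<^bsub>G\<^esub> (inv\<^bsub>G\<^esub> x \<otimes>\<^bsub>G\<^esub> y) = y"
  by (simp flip: m_assoc)

lemmas group_cancel_simps = m_assoc inv_mult_group inv_cancel_left cancel_inv_left

text \<open>Multiplying the equivariance equation of \<open>f\<close> on both sides by its inverse
  in \<open>D\<close> gives the equation for the inverse.\<close>

lemma Isos_DH:
  assumes P: "P \<in> Obj DH" and Q: "Q \<in> Obj DH" and f: "f \<in> Hom DH P Q" "f \<in> Isos D (fst P) (fst Q)"
  shows "f \<in> Isos DH P Q"
proof -
  note X = P[THEN Obj_DH_fst] and Y = Q[THEN Obj_DH_fst]
  obtain f' where f': "f' \<in> Hom D (fst Q) (fst P)" "f' \<odot>\<^bsub>D\<^esub> f = Id D (fst P)" "f \<odot>\<^bsub>D\<^esub> f' = Id D (fst Q)"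
    using f(2) by (auto simp: Isos_def)
  let ?f = "emb (fst P) (fst Q) f" and ?f' = "emb (fst Q) (fst P) f'"
  have e: "?f' \<cdot> ?f = gid (fst P)" "?f \<cdot> ?f' = gid (fst Q)"
    using f' f(2)[THEN Isos_Hom] X Y by (simp_all flip: emb_Comp emb_Id)
  have "?f' \<cdot> struct_arr Q h = struct_arr P h \<cdot> ?f'" if h: "h \<in> H" for h
  proof -
    have "?f' \<cdot> struct_arr Q h = ?f' \<cdot> struct_arr Q h \<cdot> ?f \<cdot> ?f'"
      using e P Q h by (simp add: struct_simps)
    also have "\<dots> = ?f' \<cdot> ?f \<cdot> struct_arr P h \<cdot> ?f'"
      using f P Q h by (simp add: struct_simps)
    also have "\<dots> = struct_arr P h \<cdot> ?f'"
      using gcomp_eq_assoc[OF e(1)] P h by (simp add: struct_simps)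
    finally show ?thesis .
  qed
  then have "f' \<in> Hom DH Q P" using P Q f' by (simp add: Hom_DH)
  with f f' show ?thesis by (auto simp: Isos_def Id_equivariant Comp_equivariant)
qed

section \<open>Lifting objects, morphisms and structural isomorphisms\<close>

lemma fst_lift_obj [simp]: "fst (lift_obj g P) = on_obj (act A g) (fst P)"
  by (simp add: lift_obj_def)

text \<open>Normality puts the conjugate \<open>g\<^sup>-\<^sup>1hg\<close> into \<open>H\<close>,
  and the degrees in the word multiply to \<open>h\<close>. So the word has the right type, and
  extracting its morphism with \<open>mor\<close> loses nothing.\<close>

lemma struct_lift:
  assumes "P \<in> Obj DH" "g \<in> carrier G" "h \<in> H"
  shows "struct_arr (lift_obj g P) h =
    push g (fst P) \<cdot> struct_arr P (inv\<^bsub>G\<^esub> g \<otimes>\<^bsub>G\<^esub> h \<otimes>\<^bsub>G\<^esub> g) \<cdot> pull g (fst P)" (is "_ = ?a")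
    and "struct_arr (lift_obj g P) h \<in> GHom h (on_obj (act A g) (fst P)) (on_obj (act A g) (fst P))"
proof -
  have k: "inv\<^bsub>G\<^esub> g \<otimes>\<^bsub>G\<^esub> h \<otimes>\<^bsub>G\<^esub> g \<in> H" using assms inv_op_closed1 by blast
  have "?a \<in> GHom (g \<otimes>\<^bsub>G\<^esub> ((inv\<^bsub>G\<^esub> g \<otimes>\<^bsub>G\<^esub> h \<otimes>\<^bsub>G\<^esub> g) \<otimes>\<^bsub>G\<^esub> inv\<^bsub>G\<^esub> g)) (on_obj (act A g) (fst P)) (on_obj (act A g) (fst P))"
    by (rule gcomp_closed[OF push_GHom gcomp_closed[OF struct_GHom pull_GHom]])
      (simp_all add: assms k Obj_DH_fst)
  also have "g \<otimes>\<^bsub>G\<^esub> ((inv\<^bsub>G\<^esub> g \<otimes>\<^bsub>G\<^esub> h \<otimes>\<^bsub>G\<^esub> g) \<otimes>\<^bsub>G\<^esub> inv\<^bsub>G\<^esub> g) = h"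
    using assms mem_carrier by (simp add: group_cancel_simps)
  finally have a: "?a \<in> GHom h (on_obj (act A g) (fst P)) (on_obj (act A g) (fst P))" .
  then show "struct_arr (lift_obj g P) h = ?a"
    using assms Some_mor[OF a] by (simp add: struct_arr_def lift_obj_def family_arr_def)
  with a show "struct_arr (lift_obj g P) h \<in> GHom h (on_obj (act A g) (fst P)) (on_obj (act A g) (fst P))" by simp
qed

text \<open>Conjugation by \<open>g\<close> is an endomorphism of \<open>H\<close>. In a product of
  two structure arrows the inner \<open>pull g\<close> and \<open>push g\<close> cancel, so
  multiplicativity is inherited.\<close>

lemma lift_obj_closed:
  assumes P: "P \<in> Obj DH" and g: "g \<in> carrier G"
  shows "lift_obj g P \<in> Obj DH"
proof -
  note X = P[THEN Obj_DH_fst]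
  have eq: "inv\<^bsub>G\<^esub> g \<otimes>\<^bsub>G\<^esub> h \<otimes>\<^bsub>G\<^esub> g \<otimes>\<^bsub>G\<^esub> (inv\<^bsub>G\<^esub> g \<otimes>\<^bsub>G\<^esub> k \<otimes>\<^bsub>G\<^esub> g) = inv\<^bsub>G\<^esub> g \<otimes>\<^bsub>G\<^esub> (h \<otimes>\<^bsub>G\<^esub> k) \<otimes>\<^bsub>G\<^esub> g"
    if "h \<in> H" "k \<in> H" for h k using that g by (simp add: group_cancel_simps)
  have "struct_arr (lift_obj g P) (h \<otimes>\<^bsub>G\<^esub> k) = struct_arr (lift_obj g P) h \<cdot> struct_arr (lift_obj g P) k"
    if "h \<in> H" "k \<in> H" for h k
    using that P g X inv_op_closed1[OF g] by (simp add: struct_lift struct_simps eq)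
  moreover have "struct_arr (lift_obj g P) \<one>\<^bsub>G\<^esub> = gid (fst (lift_obj g P))"
    using P g X by (simp add: struct_lift struct_one struct_simps)
  ultimately show ?thesis
    using P g X struct_lift(2) by (simp add: Obj_DH act_obj) (simp add: lift_obj_def)
qed

text \<open>Since \<open>g \<otimes> f\<close> is the conjugate of \<open>f\<close> by
  \<open>push\<close>, its equivariance at \<open>h\<close> is the equivariance of \<open>f\<close>
  at \<open>g\<^sup>-\<^sup>1hg\<close>, conjugated.\<close>

lemma lift_mor_closed:
  assumes P: "P \<in> Obj DH" and Q: "Q \<in> Obj DH" and g: "g \<in> carrier G" and f: "f \<in> Hom DH P Q"
  shows "on_mor (act A g) (fst P) (fst Q) f \<in> Hom DH (lift_obj g P) (lift_obj g Q)"
  using assms Obj_DH_fst inv_op_closed1[OF g] Hom_DH_Hom[OF f]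
  by (simp add: Hom_DH[of "lift_obj g P"] lift_obj_closed act_mor emb_act struct_lift struct_simps)

lemma lift_linear_functor:
  assumes "g \<in> carrier G"
  shows "linear_functor DH DH (lift g)"
  using assms Obj_DH_fst Hom_DH_Hom
  by (intro linear_functor.intro linear_functor_axioms.intro DH_linear_category)
    (simp_all add: lift_def lift_obj_closed lift_mor_closed Id_equivariant Comp_equivariant Scale_equivariant
      act_Id act_add act_scale act_Comp)

text \<open>The point is equivariance of \<alpha>, as naturality and invertibility come from
  \<open>D\<close>. As a word \<alpha> is two \<open>push\<close> arrows and a \<open>pull\<close>,
  and lifting by \<open>h\<close> and then by \<open>g\<close> conjugates the structure exactly as
  lifting by their product does.\<close>

lemma assoc_natural_iso_DH:
  assumes g: "g \<in> carrier G" and h: "h \<in> carrier G"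
  shows "natural_iso DH DH (lift (g \<otimes>\<^bsub>G\<^esub> h)) (comp_funct (lift g) (lift h)) (\<lambda>P. assoc A g h (fst P))"
proof -
  have "assoc A g h (fst P) \<in> Isos DH (lift_obj (g \<otimes>\<^bsub>G\<^esub> h) P) (lift_obj g (lift_obj h P))" if P: "P \<in> Obj DH" for P
  proof (rule Isos_DH)
    show "assoc A g h (fst P) \<in> Hom DH (lift_obj (g \<otimes>\<^bsub>G\<^esub> h) P) (lift_obj g (lift_obj h P))"
      using assms P Obj_DH_fst[OF P] inv_op_closed1[OF g] inv_op_closed1[OF h]
      by (simp add: Hom_DH lift_obj_closed assoc_Hom emb_assoc struct_lift act_obj struct_simps)
        (simp add: group_cancel_simps)
  qed (use assms P Obj_DH_fst[OF P] in \<open>simp_all add: lift_obj_closed assoc_Isos\<close>)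
  then show ?thesis
    using assms Obj_DH_fst Hom_DH_Hom
    by (simp add: natural_iso_def comp_funct_def lift_def Comp_equivariant assoc_natural)
qed

lemma unitor_natural_iso_DH: "natural_iso DH DH (lift \<one>\<^bsub>G\<^esub>) id_funct (\<lambda>P. unitor A (fst P))"
proof -
  have "unitor A (fst P) \<in> Isos DH (lift_obj \<one>\<^bsub>G\<^esub> P) P" if P: "P \<in> Obj DH" for P
  proof (rule Isos_DH)
    show "unitor A (fst P) \<in> Hom DH (lift_obj \<one>\<^bsub>G\<^esub> P) P"
      using P Obj_DH_fst[OF P]
      by (simp add: Hom_DH lift_obj_closed unitor_Hom emb_unitor struct_lift act_obj struct_simps)
  qed (use P Obj_DH_fst[OF P] in \<open>simp_all add: lift_obj_closed unitor_Isos\<close>)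
  then show ?thesis
    using Obj_DH_fst Hom_DH_Hom
    by (simp add: natural_iso_def id_funct_def lift_def Comp_equivariant unitor_natural)
qed

text \<open>The structural isomorphisms are those of \<open>A\<close> at the underlying objects, and
  composition in \<open>DH\<close> is that of \<open>D\<close>, so the coherence axioms are
  literally those of \<open>A\<close>.\<close>

lemma lifted_category_action: "category_action G DH lifted_action"
  using lift_linear_functor assoc_natural_iso_DH unitor_natural_iso_DH
  by (intro category_action.intro category_action_axioms.intro DH_k_category group_axioms)
    (simp_all add: lifted_action_def lift_def Obj_DH_fst Comp_equivariant Id_equivariant pentagon triangle left_triangle)

lemma lifted_forgetful_compatible: "forgetful_compatible G DH lifted_action A"
  by (simp add: forgetful_compatible_def comp_funct_def forgetful_def lifted_action_def lift_def)

section \<open>The quotient action\<close>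

text \<open>This is the comparison
  \<open>u\<^sub>b p(b\<^sup>-\<^sup>1a) u\<^sub>a\<^sup>-\<^sup>1\<close>. The last factor is
  supplied by \<open>mor\<close>, as \<open>emb_mor\<close> shows.\<close>

definition theta :: "'g \<Rightarrow> 'g \<Rightarrow> 'o \<times> ('g \<Rightarrow> 'm) \<Rightarrow> 'm" where
  "theta a b P = mor (push b (fst P) \<cdot> struct_arr P (inv\<^bsub>G\<^esub> b \<otimes>\<^bsub>G\<^esub> a))"

lemma
  assumes P: "P \<in> Obj DH" and a: "a \<in> carrier G" and b: "b \<in> carrier G" and ab: "inv\<^bsub>G\<^esub> b \<otimes>\<^bsub>G\<^esub> a \<in> H"
  shows emb_theta: "emb (on_obj (act A a) (fst P)) (on_obj (act A b) (fst P)) (theta a b P) =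
      push b (fst P) \<cdot> struct_arr P (inv\<^bsub>G\<^esub> b \<otimes>\<^bsub>G\<^esub> a) \<cdot> pull a (fst P)"
    and theta_Hom: "theta a b P \<in> Hom D (on_obj (act A a) (fst P)) (on_obj (act A b) (fst P))"
proof -
  have "push b (fst P) \<cdot> struct_arr P (inv\<^bsub>G\<^esub> b \<otimes>\<^bsub>G\<^esub> a)
      \<in> GHom (b \<otimes>\<^bsub>G\<^esub> (inv\<^bsub>G\<^esub> b \<otimes>\<^bsub>G\<^esub> a)) (fst P) (on_obj (act A b) (fst P))"
    by (rule gcomp_closed[OF push_GHom struct_GHom]) (simp_all add: assms Obj_DH_fst)
  then have *: "push b (fst P) \<cdot> struct_arr P (inv\<^bsub>G\<^esub> b \<otimes>\<^bsub>G\<^esub> a) \<in> GHom a (fst P) (on_obj (act A b) (fst P))"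
    using a b by (simp add: cancel_inv_left)
  from mor_Hom[OF *] show "theta a b P \<in> Hom D (on_obj (act A a) (fst P)) (on_obj (act A b) (fst P))"
    by (simp add: theta_def)
  from emb_mor[OF *] show "emb (on_obj (act A a) (fst P)) (on_obj (act A b) (fst P)) (theta a b P) =
      push b (fst P) \<cdot> struct_arr P (inv\<^bsub>G\<^esub> b \<otimes>\<^bsub>G\<^esub> a) \<cdot> pull a (fst P)"
    by (simp add: theta_def gcomp_assoc)
qed

text \<open>The inverse is \<open>theta b a\<close>, because the two structure arrows multiply to
  the unit. Naturality holds because a morphism of \<open>DH\<close> commutes with structure
  arrows.\<close>

lemma theta_natural_iso:
  assumes a: "a \<in> carrier G" and b: "b \<in> carrier G" and ab: "inv\<^bsub>G\<^esub> b \<otimes>\<^bsub>G\<^esub> a \<in> H"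
  shows "natural_iso DH DH (lift a) (lift b) (theta a b)"
proof -
  have ba: "inv\<^bsub>G\<^esub> a \<otimes>\<^bsub>G\<^esub> b \<in> H" using m_inv_closed[OF ab] a b by (simp add: inv_mult_group)
  have eq: "(inv\<^bsub>G\<^esub> b \<otimes>\<^bsub>G\<^esub> a) \<otimes>\<^bsub>G\<^esub> (inv\<^bsub>G\<^esub> a \<otimes>\<^bsub>G\<^esub> b) = \<one>\<^bsub>G\<^esub>" "(inv\<^bsub>G\<^esub> a \<otimes>\<^bsub>G\<^esub> b) \<otimes>\<^bsub>G\<^esub> (inv\<^bsub>G\<^esub> b \<otimes>\<^bsub>G\<^esub> a) = \<one>\<^bsub>G\<^esub>"
    using a b by (simp_all add: group_cancel_simps)
  have "theta a b P \<in> Isos DH (lift_obj a P) (lift_obj b P)" if P: "P \<in> Obj DH" for P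
  proof (rule Isos_DH)
    note X = Obj_DH_fst[OF P]
    \<comment> \<open>Moving the structure arrow of the source or of the target through
      \<open>theta\<close> leads to these two group elements; their equality is the equivariance of
      \<open>theta\<close>.\<close>
    have "(inv\<^bsub>G\<^esub> b \<otimes>\<^bsub>G\<^esub> a) \<otimes>\<^bsub>G\<^esub> (inv\<^bsub>G\<^esub> a \<otimes>\<^bsub>G\<^esub> k \<otimes>\<^bsub>G\<^esub> a) = (inv\<^bsub>G\<^esub> b \<otimes>\<^bsub>G\<^esub> k \<otimes>\<^bsub>G\<^esub> b) \<otimes>\<^bsub>G\<^esub> (inv\<^bsub>G\<^esub> b \<otimes>\<^bsub>G\<^esub> a)" if "k \<in> H" for k
      using a b that by (simp add: group_cancel_simps)
    then show "theta a b P \<in> Hom DH (lift_obj a P) (lift_obj b P)"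
      using assms P X inv_op_closed1[OF a] inv_op_closed1[OF b] 
      by (simp add: Hom_DH lift_obj_closed theta_Hom emb_theta struct_lift struct_simps)
    show "theta a b P \<in> Isos D (fst (lift_obj a P)) (fst (lift_obj b P))"
    proof (rule IsosI_emb)
      show "emb (fst (lift_obj b P)) (fst (lift_obj a P)) (theta b a P) \<in> GHom \<one>\<^bsub>G\<^esub> (fst (lift_obj b P)) (fst (lift_obj a P))"
        using assms ba P X by (simp add: emb_GHom act_obj theta_Hom)
      show "emb (fst (lift_obj b P)) (fst (lift_obj a P)) (theta b a P) \<cdot> emb (fst (lift_obj a P)) (fst (lift_obj b P)) (theta a b P)
          = gid (fst (lift_obj a P))"
        "emb (fst (lift_obj a P)) (fst (lift_obj b P)) (theta a b P) \<cdot> emb (fst (lift_obj b P)) (fst (lift_obj a P)) (theta b a P)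
          = gid (fst (lift_obj b P))"
        using assms ba P X by (simp_all add: emb_theta struct_simps eq struct_one)
    qed (use assms P X in \<open>simp_all add: act_obj theta_Hom\<close>)
  qed (use assms P in \<open>simp_all add: lift_obj_closed\<close>)
  moreover have "theta a b Q \<odot>\<^bsub>D\<^esub> on_mor (act A a) (fst P) (fst Q) f = on_mor (act A b) (fst P) (fst Q) f \<odot>\<^bsub>D\<^esub> theta a b P"
    if P: "P \<in> Obj DH" and Q: "Q \<in> Obj DH" and f: "f \<in> Hom DH P Q" for P Q f
  proof (rule emb_inject)
    note X = Obj_DH_fst[OF P] Obj_DH_fst[OF Q] Hom_DH_Hom[OF f]
    show "on_obj (act A a) (fst P) \<in> Obj D" "on_obj (act A b) (fst Q) \<in> Obj D" using a b X by (simp_all add: act_obj)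
    show "theta a b Q \<odot>\<^bsub>D\<^esub> on_mor (act A a) (fst P) (fst Q) f \<in> Hom D (on_obj (act A a) (fst P)) (on_obj (act A b) (fst Q))"
      by (rule Comp_in_Hom[OF _ _ _ act_mor theta_Hom]) (simp_all add: assms P Q X act_obj)
    show "on_mor (act A b) (fst P) (fst Q) f \<odot>\<^bsub>D\<^esub> theta a b P \<in> Hom D (on_obj (act A a) (fst P)) (on_obj (act A b) (fst Q))"
      by (rule Comp_in_Hom[OF _ _ _ theta_Hom act_mor]) (simp_all add: assms P Q X act_obj)
    show "emb (on_obj (act A a) (fst P)) (on_obj (act A b) (fst Q)) (theta a b Q \<odot>\<^bsub>D\<^esub> on_mor (act A a) (fst P) (fst Q) f) =
      emb (on_obj (act A a) (fst P)) (on_obj (act A b) (fst Q)) (on_mor (act A b) (fst P) (fst Q) f \<odot>\<^bsub>D\<^esub> theta a b P)"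
      using assms P Q X f
      by (simp add: emb_Comp[where Y = "on_obj (act A a) (fst Q)"] emb_Comp[where Y = "on_obj (act A b) (fst P)"]
          act_obj act_mor theta_Hom emb_theta emb_act struct_simps)
  qed
  ultimately show ?thesis
    by (simp add: natural_iso_def lift_def Comp_equivariant)
qed

lemma id_funct_linear: "linear_functor DH DH id_funct"
  by (intro linear_functor.intro linear_functor_axioms.intro DH_linear_category) (simp_all add: id_funct_def)

text \<open>An element \<open>h\<close> of \<open>H\<close> lies in the coset of the unit, so
  \<open>theta\<close> leads from \<open>h \<otimes> -\<close> to \<open>1 \<otimes> -\<close>. By
  \<open>emb_unitor_theta\<close> the resulting isomorphism to the identity is the structure
  morphism at \<open>h\<close> itself.\<close>

lemma unitor_theta_natural_iso:
  assumes "h \<in> H"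
  shows "natural_iso DH DH (lift h) id_funct (\<lambda>P. unitor A (fst P) \<odot>\<^bsub>D\<^esub> theta h \<one>\<^bsub>G\<^esub> P)"
  using natural_iso_comp[OF lift_linear_functor lift_linear_functor id_funct_linear
      theta_natural_iso unitor_natural_iso_DH, of h] assms
  by (simp add: Comp_equivariant)

lemma emb_unitor_theta:
  assumes "P \<in> Obj DH" "h \<in> H"
  shows "emb (on_obj (act A h) (fst P)) (fst P) (unitor A (fst P) \<odot>\<^bsub>D\<^esub> theta h \<one>\<^bsub>G\<^esub> P) =
      struct_arr P h \<cdot> pull h (fst P)"
  using assms Obj_DH_fst[OF assms(1)]
  by (simp add: emb_Comp[where Y = "on_obj (act A \<one>\<^bsub>G\<^esub>) (fst P)"] act_obj theta_Hom unitor_Hom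
      emb_theta emb_unitor struct_simps)

section \<open>Coset representatives\<close>

definition rep :: "'g set \<Rightarrow> 'g" where
  "rep c = (SOME g. g \<in> c)"

abbreviation GmodH :: "'g set monoid" where
  "GmodH \<equiv> G Mod H"

lemma
  assumes "c \<in> carrier GmodH"
  shows rep_closed: "rep c \<in> carrier G" and rcos_rep: "H #>\<^bsub>G\<^esub> rep c = c"
proof -
  obtain g where g: "g \<in> carrier G" "c = H #>\<^bsub>G\<^esub> g"
    using assms by (auto simp: FactGroup_def RCOSETS_def)
  then have "g \<in> c" using rcos_self[OF _ subgroup_axioms] by simp
  then have r: "rep c \<in> c" unfolding rep_def by (rule someI)
  with g show "rep c \<in> carrier G" using r_coset_subset_G[OF subset] by blast
  show "H #>\<^bsub>G\<^esub> rep c = c"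
    using repr_independence[OF _ g(1) subgroup_axioms] r g(2) by simp
qed

text \<open>If \<open>a = hb\<close>, then \<open>b\<^sup>-\<^sup>1a\<close> is the conjugate
  \<open>b\<^sup>-\<^sup>1hb\<close>. Normality thus turns equality of right cosets into the left
  quotient that \<open>theta\<close> uses.\<close>

lemma same_coset:
  assumes "a \<in> carrier G" "b \<in> carrier G" "H #>\<^bsub>G\<^esub> a = H #>\<^bsub>G\<^esub> b"
  shows "inv\<^bsub>G\<^esub> b \<otimes>\<^bsub>G\<^esub> a \<in> H"
proof -
  have "a \<in> H #>\<^bsub>G\<^esub> b" using rcos_self[OF assms(1) subgroup_axioms] assms(3) by simp
  then obtain h where "h \<in> H" "a = h \<otimes>\<^bsub>G\<^esub> b" by (auto simp: r_coset_def)
  then show ?thesis using inv_op_closed1[OF assms(2)] assms(2) by (simp add: m_assoc)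
qed

lemma rep_rcos:
  assumes "g \<in> carrier G"
  shows "H #>\<^bsub>G\<^esub> g \<in> carrier GmodH" "inv\<^bsub>G\<^esub> (rep (H #>\<^bsub>G\<^esub> g)) \<otimes>\<^bsub>G\<^esub> g \<in> H"
    "inv\<^bsub>G\<^esub> g \<otimes>\<^bsub>G\<^esub> rep (H #>\<^bsub>G\<^esub> g) \<in> H"
proof -
  show *: "H #>\<^bsub>G\<^esub> g \<in> carrier GmodH" using assms by (auto simp: FactGroup_def RCOSETS_def)
  show "inv\<^bsub>G\<^esub> (rep (H #>\<^bsub>G\<^esub> g)) \<otimes>\<^bsub>G\<^esub> g \<in> H" "inv\<^bsub>G\<^esub> g \<otimes>\<^bsub>G\<^esub> rep (H #>\<^bsub>G\<^esub> g) \<in> H"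
    using same_coset rep_closed[OF *] rcos_rep[OF *] assms by simp_all
qed

lemma GmodH_mult: "a \<in> carrier G \<Longrightarrow> b \<in> carrier G \<Longrightarrow>
    (H #>\<^bsub>G\<^esub> a) \<otimes>\<^bsub>GmodH\<^esub> (H #>\<^bsub>G\<^esub> b) = H #>\<^bsub>G\<^esub> (a \<otimes>\<^bsub>G\<^esub> b)"
  by (simp add: FactGroup_def rcos_sum)

lemma GmodH_one: "\<one>\<^bsub>GmodH\<^esub> = H"
  by (simp add: FactGroup_def)

text \<open>This element is the factor set of the group extension: it measures how far the choice of
  representatives is from being multiplicative.\<close>

lemma rep_mult:
  assumes "c \<in> carrier GmodH" "d \<in> carrier GmodH"
  shows "inv\<^bsub>G\<^esub> (rep c \<otimes>\<^bsub>G\<^esub> rep d) \<otimes>\<^bsub>G\<^esub> rep (c \<otimes>\<^bsub>GmodH\<^esub> d) \<in> H"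
  using rep_rcos(3)[of "rep c \<otimes>\<^bsub>G\<^esub> rep d"] GmodH_mult[of "rep c" "rep d"] rep_closed rcos_rep assms by simp

text \<open>The representative of the trivial coset is an arbitrary element of \<open>H\<close> and
  may differ from the unit, which is why \<open>quotient_unitor\<close> contains a
  \<open>theta\<close>.\<close>

lemma rep_one: "rep \<one>\<^bsub>GmodH\<^esub> \<in> H"
proof -
  have "H \<noteq> {}" using one_closed by blast
  then show ?thesis unfolding GmodH_one rep_def by (rule some_in_eq[THEN iffD2])
qed

section \<open>The action of the factor group\<close>

definition quotient_assoc :: "'g set \<Rightarrow> 'g set \<Rightarrow> 'o \<times> ('g \<Rightarrow> 'm) \<Rightarrow> 'm" where
  "quotient_assoc c d P = assoc A (rep c) (rep d) (fst P) \<odot>\<^bsub>D\<^esub>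
     theta (rep (c \<otimes>\<^bsub>GmodH\<^esub> d)) (rep c \<otimes>\<^bsub>G\<^esub> rep d) P"

definition quotient_unitor :: "'o \<times> ('g \<Rightarrow> 'm) \<Rightarrow> 'm" where
  "quotient_unitor P = unitor A (fst P) \<odot>\<^bsub>D\<^esub> theta (rep \<one>\<^bsub>GmodH\<^esub>) \<one>\<^bsub>G\<^esub> P"

definition quotient_action :: "('g set, 'o \<times> ('g \<Rightarrow> 'm), 'm) cat_action" where
  "quotient_action = \<lparr>act = (\<lambda>c. lift (rep c)), assoc = quotient_assoc, unitor = quotient_unitor\<rparr>"

lemma group_GmodH: "group GmodH"
  by (rule factorgroup_is_group)

lemma GmodH_closed: "c \<in> carrier GmodH \<Longrightarrow> d \<in> carrier GmodH \<Longrightarrow> c \<otimes>\<^bsub>GmodH\<^esub> d \<in> carrier GmodH"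
  by (rule monoid.m_closed[OF group.is_monoid[OF group_GmodH]])

text \<open>\<open>theta\<close> passes from the representative of the product to the product of the
  representatives, where \<alpha> applies. The inner \<open>pull\<close> and \<open>push\<close>
  cancel, and the factor set remains as the argument of the structure arrow.\<close>

lemma
  assumes "P \<in> Obj DH" "c \<in> carrier GmodH" "d \<in> carrier GmodH"
  shows quotient_assoc_Hom: "quotient_assoc c d P \<in>
      Hom D (on_obj (act A (rep (c \<otimes>\<^bsub>GmodH\<^esub> d))) (fst P)) (on_obj (act A (rep c)) (on_obj (act A (rep d)) (fst P)))"
    and emb_quotient_assoc: "emb (on_obj (act A (rep (c \<otimes>\<^bsub>GmodH\<^esub> d))) (fst P))
      (on_obj (act A (rep c)) (on_obj (act A (rep d)) (fst P))) (quotient_assoc c d P) =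
      push (rep c) (on_obj (act A (rep d)) (fst P)) \<cdot> push (rep d) (fst P) \<cdot>
      struct_arr P (inv\<^bsub>G\<^esub> (rep c \<otimes>\<^bsub>G\<^esub> rep d) \<otimes>\<^bsub>G\<^esub> rep (c \<otimes>\<^bsub>GmodH\<^esub> d)) \<cdot> pull (rep (c \<otimes>\<^bsub>GmodH\<^esub> d)) (fst P)"
proof -
  note [simp] = assms Obj_DH_fst[OF assms(1)] rep_closed rep_mult act_obj GmodH_closed
  show "quotient_assoc c d P \<in> Hom D (on_obj (act A (rep (c \<otimes>\<^bsub>GmodH\<^esub> d))) (fst P))
      (on_obj (act A (rep c)) (on_obj (act A (rep d)) (fst P)))"
    unfolding quotient_assoc_def
    by (rule Comp_in_Hom[where Y = "on_obj (act A (rep c \<otimes>\<^bsub>G\<^esub> rep d)) (fst P)"])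
      (simp_all add: theta_Hom assoc_Hom)
  show "emb (on_obj (act A (rep (c \<otimes>\<^bsub>GmodH\<^esub> d))) (fst P))
      (on_obj (act A (rep c)) (on_obj (act A (rep d)) (fst P))) (quotient_assoc c d P) =
      push (rep c) (on_obj (act A (rep d)) (fst P)) \<cdot> push (rep d) (fst P) \<cdot>
      struct_arr P (inv\<^bsub>G\<^esub> (rep c \<otimes>\<^bsub>G\<^esub> rep d) \<otimes>\<^bsub>G\<^esub> rep (c \<otimes>\<^bsub>GmodH\<^esub> d)) \<cdot> pull (rep (c \<otimes>\<^bsub>GmodH\<^esub> d)) (fst P)"
    unfolding quotient_assoc_def
    by (subst emb_Comp[where Y = "on_obj (act A (rep c \<otimes>\<^bsub>G\<^esub> rep d)) (fst P)"])
      (simp_all add: theta_Hom assoc_Hom emb_theta emb_assoc struct_simps)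
qed

lemma
  assumes "P \<in> Obj DH"
  shows quotient_unitor_Hom: "quotient_unitor P \<in> Hom D (on_obj (act A (rep \<one>\<^bsub>GmodH\<^esub>)) (fst P)) (fst P)"
    and emb_quotient_unitor: "emb (on_obj (act A (rep \<one>\<^bsub>GmodH\<^esub>)) (fst P)) (fst P) (quotient_unitor P) =
      struct_arr P (rep \<one>\<^bsub>GmodH\<^esub>) \<cdot> pull (rep \<one>\<^bsub>GmodH\<^esub>) (fst P)"
proof -
  show "quotient_unitor P \<in> Hom D (on_obj (act A (rep \<one>\<^bsub>GmodH\<^esub>)) (fst P)) (fst P)"
    unfolding quotient_unitor_def using rep_one assms
    by (intro Comp_in_Hom[OF _ _ _ theta_Hom unitor_Hom]) (simp_all add: Obj_DH_fst act_obj)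
  show "emb (on_obj (act A (rep \<one>\<^bsub>GmodH\<^esub>)) (fst P)) (fst P) (quotient_unitor P) =
      struct_arr P (rep \<one>\<^bsub>GmodH\<^esub>) \<cdot> pull (rep \<one>\<^bsub>GmodH\<^esub>) (fst P)"
    unfolding quotient_unitor_def by (rule emb_unitor_theta[OF assms rep_one])
qed

lemma quotient_assoc_natural_iso:
  assumes c: "c \<in> carrier GmodH" and d: "d \<in> carrier GmodH"
  shows "natural_iso DH DH (lift (rep (c \<otimes>\<^bsub>GmodH\<^esub> d))) (comp_funct (lift (rep c)) (lift (rep d))) (quotient_assoc c d)"
proof -
  note [simp] = assms rep_closed rep_mult GmodH_closed
  have F: "linear_functor DH DH (comp_funct (lift (rep c)) (lift (rep d)))"
  proof -
    interpret Fc: linear_functor DH DH "lift (rep c)" by (simp add: lift_linear_functor)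
    interpret Fd: linear_functor DH DH "lift (rep d)" by (simp add: lift_linear_functor)
    show ?thesis
      by (intro linear_functor.intro linear_functor_axioms.intro DH_linear_category)
        (simp_all add: comp_funct_def Fc.on_obj_closed Fd.on_obj_closed Fc.on_mor_closed Fd.on_mor_closed
          Fc.on_mor_Id Fd.on_mor_Id Fc.on_mor_add Fd.on_mor_add Fc.on_mor_scale Fd.on_mor_scale
          Fc.on_mor_Comp[where Y = "on_obj (lift (rep d)) Y" for Y] Fd.on_mor_Comp)
  qed
  have "natural_iso DH DH (lift (rep (c \<otimes>\<^bsub>GmodH\<^esub> d))) (comp_funct (lift (rep c)) (lift (rep d)))
    (\<lambda>P. assoc A (rep c) (rep d) (fst P) \<odot>\<^bsub>DH\<^esub> theta (rep (c \<otimes>\<^bsub>GmodH\<^esub> d)) (rep c \<otimes>\<^bsub>G\<^esub> rep d) P)"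
    by (rule natural_iso_comp[OF lift_linear_functor lift_linear_functor F theta_natural_iso assoc_natural_iso_DH])
      simp_all
  then show ?thesis by (simp add: quotient_assoc_def[abs_def] Comp_equivariant)
qed

text \<open>Under \<open>emb\<close> both sides become the pushes along \<open>rep e\<close>,
  \<open>rep d\<close> and \<open>rep c\<close>, preceded by one structure arrow and one
  \<open>pull\<close>. Comparing the structure arrows leaves the cocycle identity of the factor
  set.\<close>

lemma quotient_pentagon:
  assumes c: "c \<in> carrier GmodH" and d: "d \<in> carrier GmodH" and e: "e \<in> carrier GmodH" and P: "P \<in> Obj DH"
  shows "quotient_assoc c d (lift_obj (rep e) P) \<odot>\<^bsub>D\<^esub> quotient_assoc (c \<otimes>\<^bsub>GmodH\<^esub> d) e P =
    on_mor (act A (rep c)) (on_obj (act A (rep (d \<otimes>\<^bsub>GmodH\<^esub> e))) (fst P))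
      (on_obj (act A (rep d)) (on_obj (act A (rep e)) (fst P))) (quotient_assoc d e P)
      \<odot>\<^bsub>D\<^esub> quotient_assoc c (d \<otimes>\<^bsub>GmodH\<^esub> e) P"
proof -
  interpret GmodH: group GmodH by (rule group_GmodH)
  let ?o = "\<lambda>c. on_obj (act A (rep c))" let ?X = "fst P"
  note [simp] = assms Obj_DH_fst[OF P] rep_closed act_obj GmodH_closed lift_obj_closed GmodH.m_assoc
  have h1: "quotient_assoc c d (lift_obj (rep e) P) \<in> Hom D (?o (c \<otimes>\<^bsub>GmodH\<^esub> d) (?o e ?X)) (?o c (?o d (?o e ?X)))"
    using quotient_assoc_Hom[of "lift_obj (rep e) P" c d] by simp
  have h2: "quotient_assoc (c \<otimes>\<^bsub>GmodH\<^esub> d) e P \<in> Hom D (?o (c \<otimes>\<^bsub>GmodH\<^esub> (d \<otimes>\<^bsub>GmodH\<^esub> e)) ?X) (?o (c \<otimes>\<^bsub>GmodH\<^esub> d) (?o e ?X))"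
    using quotient_assoc_Hom[of P "c \<otimes>\<^bsub>GmodH\<^esub> d" e] by simp
  have h3: "quotient_assoc d e P \<in> Hom D (?o (d \<otimes>\<^bsub>GmodH\<^esub> e) ?X) (?o d (?o e ?X))"
    using quotient_assoc_Hom[of P d e] by simp
  have h4: "quotient_assoc c (d \<otimes>\<^bsub>GmodH\<^esub> e) P \<in> Hom D (?o (c \<otimes>\<^bsub>GmodH\<^esub> (d \<otimes>\<^bsub>GmodH\<^esub> e)) ?X) (?o c (?o (d \<otimes>\<^bsub>GmodH\<^esub> e) ?X))"
    using quotient_assoc_Hom[of P c "d \<otimes>\<^bsub>GmodH\<^esub> e"] by simp
  have h3': "on_mor (act A (rep c)) (?o (d \<otimes>\<^bsub>GmodH\<^esub> e) ?X) (?o d (?o e ?X)) (quotient_assoc d e P)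
      \<in> Hom D (?o c (?o (d \<otimes>\<^bsub>GmodH\<^esub> e) ?X)) (?o c (?o d (?o e ?X)))"
    using h3 by (simp add: act_mor)
  note m = rep_mult[OF c d] rep_mult[OF d e] rep_mult[OF GmodH_closed[OF c d] e, simplified]
    rep_mult[OF c GmodH_closed[OF d e]] inv_op_closed1[OF rep_closed[OF e] rep_mult[OF c d]]
  have "emb (?o (c \<otimes>\<^bsub>GmodH\<^esub> (d \<otimes>\<^bsub>GmodH\<^esub> e)) ?X) (?o (c \<otimes>\<^bsub>GmodH\<^esub> d) (?o e ?X)) (quotient_assoc (c \<otimes>\<^bsub>GmodH\<^esub> d) e P) =
      push (rep (c \<otimes>\<^bsub>GmodH\<^esub> d)) (?o e ?X) \<cdot> push (rep e) ?X \<cdot>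
      struct_arr P (inv\<^bsub>G\<^esub> (rep (c \<otimes>\<^bsub>GmodH\<^esub> d) \<otimes>\<^bsub>G\<^esub> rep e) \<otimes>\<^bsub>G\<^esub> rep (c \<otimes>\<^bsub>GmodH\<^esub> (d \<otimes>\<^bsub>GmodH\<^esub> e))) \<cdot>
      pull (rep (c \<otimes>\<^bsub>GmodH\<^esub> (d \<otimes>\<^bsub>GmodH\<^esub> e))) ?X"
    using emb_quotient_assoc[of P "c \<otimes>\<^bsub>GmodH\<^esub> d" e] by simp
  moreover have "emb (?o (c \<otimes>\<^bsub>GmodH\<^esub> d) (?o e ?X)) (?o c (?o d (?o e ?X))) (quotient_assoc c d (lift_obj (rep e) P)) =
      push (rep c) (?o d (?o e ?X)) \<cdot> push (rep d) (?o e ?X) \<cdot> (push (rep e) ?X \<cdot>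
        struct_arr P (inv\<^bsub>G\<^esub> (rep e) \<otimes>\<^bsub>G\<^esub> (inv\<^bsub>G\<^esub> (rep c \<otimes>\<^bsub>G\<^esub> rep d) \<otimes>\<^bsub>G\<^esub> rep (c \<otimes>\<^bsub>GmodH\<^esub> d)) \<otimes>\<^bsub>G\<^esub> rep e) \<cdot>
        pull (rep e) ?X) \<cdot> pull (rep (c \<otimes>\<^bsub>GmodH\<^esub> d)) (?o e ?X)"
    using emb_quotient_assoc[of "lift_obj (rep e) P" c d] struct_lift(1)[OF P rep_closed[OF e] m(1)] by simp
  \<comment> \<open>The cocycle identity. The conjugation by \<open>rep e\<close> on the left stems
    from the structure of the lifted object.\<close>
  moreover have "inv\<^bsub>G\<^esub> (rep e) \<otimes>\<^bsub>G\<^esub> (inv\<^bsub>G\<^esub> (rep c \<otimes>\<^bsub>G\<^esub> rep d) \<otimes>\<^bsub>G\<^esub> rep (c \<otimes>\<^bsub>GmodH\<^esub> d)) \<otimes>\<^bsub>G\<^esub> rep e \<otimes>\<^bsub>G\<^esub>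
      (inv\<^bsub>G\<^esub> (rep (c \<otimes>\<^bsub>GmodH\<^esub> d) \<otimes>\<^bsub>G\<^esub> rep e) \<otimes>\<^bsub>G\<^esub> rep (c \<otimes>\<^bsub>GmodH\<^esub> (d \<otimes>\<^bsub>GmodH\<^esub> e))) =
    (inv\<^bsub>G\<^esub> (rep d \<otimes>\<^bsub>G\<^esub> rep e) \<otimes>\<^bsub>G\<^esub> rep (d \<otimes>\<^bsub>GmodH\<^esub> e)) \<otimes>\<^bsub>G\<^esub>
      (inv\<^bsub>G\<^esub> (rep c \<otimes>\<^bsub>G\<^esub> rep (d \<otimes>\<^bsub>GmodH\<^esub> e)) \<otimes>\<^bsub>G\<^esub> rep (c \<otimes>\<^bsub>GmodH\<^esub> (d \<otimes>\<^bsub>GmodH\<^esub> e)))"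
    by (simp add: group_cancel_simps del: GmodH.m_assoc)
  ultimately have "emb (?o (c \<otimes>\<^bsub>GmodH\<^esub> d) (?o e ?X)) (?o c (?o d (?o e ?X))) (quotient_assoc c d (lift_obj (rep e) P)) \<cdot>
      emb (?o (c \<otimes>\<^bsub>GmodH\<^esub> (d \<otimes>\<^bsub>GmodH\<^esub> e)) ?X) (?o (c \<otimes>\<^bsub>GmodH\<^esub> d) (?o e ?X)) (quotient_assoc (c \<otimes>\<^bsub>GmodH\<^esub> d) e P) =
    emb (?o c (?o (d \<otimes>\<^bsub>GmodH\<^esub> e) ?X)) (?o c (?o d (?o e ?X)))
        (on_mor (act A (rep c)) (?o (d \<otimes>\<^bsub>GmodH\<^esub> e) ?X) (?o d (?o e ?X)) (quotient_assoc d e P)) \<cdot>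
      emb (?o (c \<otimes>\<^bsub>GmodH\<^esub> (d \<otimes>\<^bsub>GmodH\<^esub> e)) ?X) (?o c (?o (d \<otimes>\<^bsub>GmodH\<^esub> e) ?X)) (quotient_assoc c (d \<otimes>\<^bsub>GmodH\<^esub> e) P)"
    using h3 m by (simp add: emb_act emb_quotient_assoc struct_simps del: GmodH.m_assoc)
  moreover have "quotient_assoc c d (lift_obj (rep e) P) \<odot>\<^bsub>D\<^esub> quotient_assoc (c \<otimes>\<^bsub>GmodH\<^esub> d) e P \<in>
      Hom D (?o (c \<otimes>\<^bsub>GmodH\<^esub> (d \<otimes>\<^bsub>GmodH\<^esub> e)) ?X) (?o c (?o d (?o e ?X)))"
    by (rule Comp_in_Hom[OF _ _ _ h2 h1]) simp_all
  moreover have "on_mor (act A (rep c)) (?o (d \<otimes>\<^bsub>GmodH\<^esub> e) ?X) (?o d (?o e ?X)) (quotient_assoc d e P)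
      \<odot>\<^bsub>D\<^esub> quotient_assoc c (d \<otimes>\<^bsub>GmodH\<^esub> e) P \<in> Hom D (?o (c \<otimes>\<^bsub>GmodH\<^esub> (d \<otimes>\<^bsub>GmodH\<^esub> e)) ?X) (?o c (?o d (?o e ?X)))"
    by (rule Comp_in_Hom[OF _ _ _ h4 h3']) simp_all
  ultimately show ?thesis
    using h1 h2 h3' h4
    by (intro emb_inject[of "?o (c \<otimes>\<^bsub>GmodH\<^esub> (d \<otimes>\<^bsub>GmodH\<^esub> e)) ?X" "?o c (?o d (?o e ?X))"])
      (simp_all add: emb_Comp[where Y = "?o (c \<otimes>\<^bsub>GmodH\<^esub> d) (?o e ?X)"] emb_Comp[where Y = "?o c (?o (d \<otimes>\<^bsub>GmodH\<^esub> e) ?X)"])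
qed

text \<open>Each composite reduces to a structure arrow between \<open>push (rep c)\<close> and
  \<open>pull (rep c)\<close>. Its group element cancels to the unit, computed in
  \<open>eq\<close>.\<close>

lemma quotient_triangles:
  assumes c: "c \<in> carrier GmodH" and P: "P \<in> Obj DH"
  shows "on_mor (act A (rep c)) (on_obj (act A (rep \<one>\<^bsub>GmodH\<^esub>)) (fst P)) (fst P) (quotient_unitor P)
      \<odot>\<^bsub>D\<^esub> quotient_assoc c \<one>\<^bsub>GmodH\<^esub> P = Id D (on_obj (act A (rep c)) (fst P))" (is "?right")
    and "quotient_unitor (lift_obj (rep c) P) \<odot>\<^bsub>D\<^esub> quotient_assoc \<one>\<^bsub>GmodH\<^esub> c P
      = Id D (on_obj (act A (rep c)) (fst P))" (is "?left")
proof -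
  interpret GmodH: group GmodH by (rule group_GmodH)
  let ?o = "\<lambda>c. on_obj (act A (rep c))" let ?X = "fst P" let ?e = "\<one>\<^bsub>GmodH\<^esub>"
  note [simp] = assms Obj_DH_fst[OF P] rep_closed act_obj GmodH_closed lift_obj_closed rep_one
  have h1: "quotient_assoc c ?e P \<in> Hom D (?o c ?X) (?o c (?o ?e ?X))"
    using quotient_assoc_Hom[of P c ?e] by simp
  have h2: "quotient_assoc ?e c P \<in> Hom D (?o c ?X) (?o ?e (?o c ?X))"
    using quotient_assoc_Hom[of P ?e c] by simp
  have h3: "on_mor (act A (rep c)) (?o ?e ?X) ?X (quotient_unitor P) \<in> Hom D (?o c (?o ?e ?X)) (?o c ?X)"
    by (simp add: act_mor quotient_unitor_Hom)
  have h4: "quotient_unitor (lift_obj (rep c) P) \<in> Hom D (?o ?e (?o c ?X)) (?o c ?X)"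
    using quotient_unitor_Hom[of "lift_obj (rep c) P"] by simp
  have m: "inv\<^bsub>G\<^esub> (rep c \<otimes>\<^bsub>G\<^esub> rep ?e) \<otimes>\<^bsub>G\<^esub> rep c \<in> H" "inv\<^bsub>G\<^esub> (rep ?e \<otimes>\<^bsub>G\<^esub> rep c) \<otimes>\<^bsub>G\<^esub> rep c \<in> H"
    using rep_mult[of c ?e] rep_mult[of ?e c] by simp_all
  have e1: "emb (?o c ?X) (?o c (?o ?e ?X)) (quotient_assoc c ?e P) = push (rep c) (?o ?e ?X) \<cdot> push (rep ?e) ?X \<cdot>
      struct_arr P (inv\<^bsub>G\<^esub> (rep c \<otimes>\<^bsub>G\<^esub> rep ?e) \<otimes>\<^bsub>G\<^esub> rep c) \<cdot> pull (rep c) ?X"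
    using emb_quotient_assoc[of P c ?e] by simp
  have e2: "emb (?o c ?X) (?o ?e (?o c ?X)) (quotient_assoc ?e c P) = push (rep ?e) (?o c ?X) \<cdot> push (rep c) ?X \<cdot>
      struct_arr P (inv\<^bsub>G\<^esub> (rep ?e \<otimes>\<^bsub>G\<^esub> rep c) \<otimes>\<^bsub>G\<^esub> rep c) \<cdot> pull (rep c) ?X"
    using emb_quotient_assoc[of P ?e c] by simp
  have e4: "emb (?o ?e (?o c ?X)) (?o c ?X) (quotient_unitor (lift_obj (rep c) P)) =
      (push (rep c) ?X \<cdot> struct_arr P (inv\<^bsub>G\<^esub> (rep c) \<otimes>\<^bsub>G\<^esub> rep ?e \<otimes>\<^bsub>G\<^esub> rep c) \<cdot> pull (rep c) ?X) \<cdot> pull (rep ?e) (?o c ?X)"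
    using emb_quotient_unitor[of "lift_obj (rep c) P"] struct_lift(1)[OF P rep_closed[OF c] rep_one] by simp
  have eq: "rep ?e \<otimes>\<^bsub>G\<^esub> (inv\<^bsub>G\<^esub> (rep c \<otimes>\<^bsub>G\<^esub> rep ?e) \<otimes>\<^bsub>G\<^esub> rep c) = \<one>\<^bsub>G\<^esub>"
    "inv\<^bsub>G\<^esub> (rep c) \<otimes>\<^bsub>G\<^esub> rep ?e \<otimes>\<^bsub>G\<^esub> rep c \<otimes>\<^bsub>G\<^esub> (inv\<^bsub>G\<^esub> (rep ?e \<otimes>\<^bsub>G\<^esub> rep c) \<otimes>\<^bsub>G\<^esub> rep c) = \<one>\<^bsub>G\<^esub>"
    by (simp_all add: group_cancel_simps)
  show ?right
  proof (rule emb_inject[of "?o c ?X" "?o c ?X"])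
    show "emb (?o c ?X) (?o c ?X) (on_mor (act A (rep c)) (?o ?e ?X) ?X (quotient_unitor P) \<odot>\<^bsub>D\<^esub> quotient_assoc c ?e P) =
      emb (?o c ?X) (?o c ?X) (Id D (?o c ?X))"
      using h1 h3 m inv_op_closed1[OF rep_closed[OF c] rep_one]
      by (simp add: emb_Comp[where Y = "?o c (?o ?e ?X)"] emb_act quotient_unitor_Hom emb_quotient_unitor e1
          struct_simps eq struct_one emb_Id)
  qed (use Comp_in_Hom[OF _ _ _ h1 h3] in \<open>simp_all add: Id_in_Hom\<close>)
  show ?left
  proof (rule emb_inject[of "?o c ?X" "?o c ?X"])
    show "emb (?o c ?X) (?o c ?X) (quotient_unitor (lift_obj (rep c) P) \<odot>\<^bsub>D\<^esub> quotient_assoc ?e c P) =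
      emb (?o c ?X) (?o c ?X) (Id D (?o c ?X))"
      using h2 h4 m inv_op_closed1[OF rep_closed[OF c] rep_one]
      by (simp add: emb_Comp[where Y = "?o ?e (?o c ?X)"] e2 e4 struct_simps eq struct_one emb_Id)
  qed (use Comp_in_Hom[OF _ _ _ h2 h4] in \<open>simp_all add: Id_in_Hom\<close>)
qed

lemma quotient_category_action: "category_action GmodH DH quotient_action"
  using quotient_assoc_natural_iso quotient_pentagon quotient_triangles
    unitor_theta_natural_iso[OF rep_one, folded quotient_unitor_def[abs_def]]
  by (intro category_action.intro category_action_axioms.intro DH_k_category group_GmodH)
    (simp_all add: quotient_action_def lift_linear_functor rep_closed lift_sel Comp_equivariant Id_equivariant)

text \<open>A morphism from \<open>rep c \<otimes> X\<close> to \<open>X\<close> is an arrow of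
  degree \<open>rep c\<close> in the graded category of \<open>D\<close>. Structures over the factor
  group are thus described by the same arrows as those over \<open>G\<close>.\<close>

definition quotient_arr :: "'o \<times> ('g \<Rightarrow> 'm) \<Rightarrow> ('g set \<Rightarrow> 'm) \<Rightarrow> 'g set \<Rightarrow> ('o \<times> 'g \<times> 'm \<times> 'o) option" where
  "quotient_arr P \<chi> c = Some (fst P, rep c, \<chi> c, fst P)"

lemma gcomp_pull_cancel:
  assumes "g \<in> carrier G" "X \<in> Obj D" "a \<in> GHom h X Y" "b \<in> GHom h' X Y'" "a \<cdot> pull g X = b \<cdot> pull g X"
  shows "a = b"
proof -
  have "(a \<cdot> pull g X) \<cdot> push g X = (b \<cdot> pull g X) \<cdot> push g X" using assms(5) by simp
  then show ?thesis
    by (simp only: gcomp_assoc pull_push[OF assms(1,2)] gcomp_gid[OF assms(3)] gcomp_gid[OF assms(4)])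
qed

text \<open>Under \<open>emb\<close> each condition becomes an equation of words ending in the same
  \<open>pull\<close>, which is cancelled. Commutation with \<open>H\<close> up to conjugation says
  that the component is a morphism of \<open>DH\<close>; multiplicativity holds up to the factor set
  because \<open>quotient_assoc\<close> contains it.\<close>

lemma quotient_structures_iff:
  assumes P: "P \<in> Obj DH"
  shows "\<chi> \<in> equivariant_structures GmodH DH quotient_action P \<longleftrightarrow> \<chi> \<in> extensional (carrier GmodH) \<and>
    (\<forall>c \<in> carrier GmodH. quotient_arr P \<chi> c \<in> GHom (rep c) (fst P) (fst P)) \<and>
    (\<forall>c \<in> carrier GmodH. \<forall>h \<in> H. quotient_arr P \<chi> c \<cdot> struct_arr P (inv\<^bsub>G\<^esub> (rep c) \<otimes>\<^bsub>G\<^esub> h \<otimes>\<^bsub>G\<^esub> rep c) =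
       struct_arr P h \<cdot> quotient_arr P \<chi> c) \<and>
    (\<forall>c \<in> carrier GmodH. \<forall>d \<in> carrier GmodH. quotient_arr P \<chi> (c \<otimes>\<^bsub>GmodH\<^esub> d) = quotient_arr P \<chi> c \<cdot>
       quotient_arr P \<chi> d \<cdot> struct_arr P (inv\<^bsub>G\<^esub> (rep c \<otimes>\<^bsub>G\<^esub> rep d) \<otimes>\<^bsub>G\<^esub> rep (c \<otimes>\<^bsub>GmodH\<^esub> d))) \<and>
    quotient_arr P \<chi> \<one>\<^bsub>GmodH\<^esub> = struct_arr P (rep \<one>\<^bsub>GmodH\<^esub>)"
proof -
  interpret GmodH: group GmodH by (rule group_GmodH)
  let ?o = "\<lambda>c. on_obj (act A (rep c))" let ?X = "fst P" let ?e = "\<one>\<^bsub>GmodH\<^esub>"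
  note [simp] = P Obj_DH_fst[OF P] rep_closed act_obj GmodH_closed lift_obj_closed rep_one rep_mult
  let ?x = "quotient_arr P \<chi>"
  have ty: "?x c \<in> GHom (rep c) ?X ?X \<longleftrightarrow> \<chi> c \<in> Hom D (?o c ?X) ?X" if "c \<in> carrier GmodH" for c
    using that by (simp add: quotient_arr_def Some_GHom_iff)
  have emb_\<chi>: "emb (?o c ?X) ?X (\<chi> c) = ?x c \<cdot> pull (rep c) ?X" if "c \<in> carrier GmodH" "\<chi> c \<in> Hom D (?o c ?X) ?X" for c
    using emb_mor[of "?x c" "rep c" ?X ?X] that ty by (simp add: quotient_arr_def)
  have HomDH: "\<chi> c \<in> Hom DH (lift_obj (rep c) P) P \<longleftrightarrow> ?x c \<in> GHom (rep c) ?X ?X \<and>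
      (\<forall>h \<in> H. ?x c \<cdot> struct_arr P (inv\<^bsub>G\<^esub> (rep c) \<otimes>\<^bsub>G\<^esub> h \<otimes>\<^bsub>G\<^esub> rep c) = struct_arr P h \<cdot> ?x c)"
    if c: "c \<in> carrier GmodH" for c
  proof -
    have "emb (?o c ?X) ?X (\<chi> c) \<cdot> struct_arr (lift_obj (rep c) P) h = struct_arr P h \<cdot> emb (?o c ?X) ?X (\<chi> c) \<longleftrightarrow>
        ?x c \<cdot> struct_arr P (inv\<^bsub>G\<^esub> (rep c) \<otimes>\<^bsub>G\<^esub> h \<otimes>\<^bsub>G\<^esub> rep c) = struct_arr P h \<cdot> ?x c"
      if h: "h \<in> H" and x: "?x c \<in> GHom (rep c) ?X ?X" for h
    proof -
      note k = inv_op_closed1[OF rep_closed[OF c] h]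
      have "emb (?o c ?X) ?X (\<chi> c) \<cdot> struct_arr (lift_obj (rep c) P) h =
          (?x c \<cdot> struct_arr P (inv\<^bsub>G\<^esub> (rep c) \<otimes>\<^bsub>G\<^esub> h \<otimes>\<^bsub>G\<^esub> rep c)) \<cdot> pull (rep c) ?X"
        "struct_arr P h \<cdot> emb (?o c ?X) ?X (\<chi> c) = (struct_arr P h \<cdot> ?x c) \<cdot> pull (rep c) ?X"
        using c h k x ty by (simp_all add: emb_\<chi> struct_lift struct_simps)
      then show ?thesis
        using gcomp_pull_cancel[OF rep_closed[OF c] Obj_DH_fst[OF P] gcomp_closed[OF x struct_GHom[OF P k]]
            gcomp_closed[OF struct_GHom[OF P h] x]] by auto
    qed
    then show ?thesis using c ty by (auto simp: Hom_DH)
  qed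
  have mult: "\<chi> (c \<otimes>\<^bsub>GmodH\<^esub> d) = \<chi> c \<odot>\<^bsub>D\<^esub> on_mor (act A (rep c)) (?o d ?X) ?X (\<chi> d) \<odot>\<^bsub>D\<^esub> quotient_assoc c d P \<longleftrightarrow>
      ?x (c \<otimes>\<^bsub>GmodH\<^esub> d) = ?x c \<cdot> ?x d \<cdot> struct_arr P (inv\<^bsub>G\<^esub> (rep c \<otimes>\<^bsub>G\<^esub> rep d) \<otimes>\<^bsub>G\<^esub> rep (c \<otimes>\<^bsub>GmodH\<^esub> d))"
    (is "_ = ?rhs \<longleftrightarrow> _ = ?grhs")
    if c: "c \<in> carrier GmodH" and d: "d \<in> carrier GmodH" and x: "\<And>c. c \<in> carrier GmodH \<Longrightarrow> ?x c \<in> GHom (rep c) ?X ?X" for c d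
  proof -
    have \<chi>: "\<chi> c \<in> Hom D (?o c ?X) ?X" if "c \<in> carrier GmodH" for c using x ty that by simp
    have m: "on_mor (act A (rep c)) (?o d ?X) ?X (\<chi> d) \<in> Hom D (?o c (?o d ?X)) (?o c ?X)"
      using c d \<chi> by (simp add: act_mor)
    have m': "\<chi> c \<odot>\<^bsub>D\<^esub> on_mor (act A (rep c)) (?o d ?X) ?X (\<chi> d) \<in> Hom D (?o c (?o d ?X)) ?X"
      by (rule Comp_in_Hom[OF _ _ _ m \<chi>]) (use c d in simp_all)
    have r: "?rhs \<in> Hom D (?o (c \<otimes>\<^bsub>GmodH\<^esub> d) ?X) ?X"
      by (rule Comp_in_Hom[OF _ _ _ quotient_assoc_Hom m']) (use c d in simp_all)
    have "emb (?o (c \<otimes>\<^bsub>GmodH\<^esub> d) ?X) ?X ?rhs = ?grhs \<cdot> pull (rep (c \<otimes>\<^bsub>GmodH\<^esub> d)) ?X"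
      using c d m m' \<chi> gid_gcomp[OF x[OF d], THEN gcomp_eq_assoc]
      by (simp add: emb_Comp[where Y = "?o c (?o d ?X)"] emb_Comp[where Y = "?o c ?X"] quotient_assoc_Hom
          emb_quotient_assoc emb_act emb_\<chi> struct_simps)
    moreover have "emb (?o (c \<otimes>\<^bsub>GmodH\<^esub> d) ?X) ?X (\<chi> (c \<otimes>\<^bsub>GmodH\<^esub> d)) = ?x (c \<otimes>\<^bsub>GmodH\<^esub> d) \<cdot> pull (rep (c \<otimes>\<^bsub>GmodH\<^esub> d)) ?X"
      using c d \<chi> by (simp add: emb_\<chi>)
    moreover have "\<chi> (c \<otimes>\<^bsub>GmodH\<^esub> d) = ?rhs \<longleftrightarrow>
        emb (?o (c \<otimes>\<^bsub>GmodH\<^esub> d) ?X) ?X (\<chi> (c \<otimes>\<^bsub>GmodH\<^esub> d)) = emb (?o (c \<otimes>\<^bsub>GmodH\<^esub> d) ?X) ?X ?rhs"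
      using emb_inject[OF _ _ \<chi> r] c d by auto
    moreover have "?x (c \<otimes>\<^bsub>GmodH\<^esub> d) \<cdot> pull (rep (c \<otimes>\<^bsub>GmodH\<^esub> d)) ?X = ?grhs \<cdot> pull (rep (c \<otimes>\<^bsub>GmodH\<^esub> d)) ?X \<longleftrightarrow> ?x (c \<otimes>\<^bsub>GmodH\<^esub> d) = ?grhs"
      using gcomp_pull_cancel[OF _ _ x gcomp_closed[OF x gcomp_closed[OF x struct_GHom]], of "rep (c \<otimes>\<^bsub>GmodH\<^esub> d)" "c \<otimes>\<^bsub>GmodH\<^esub> d" c d] c d
      by auto
    ultimately show ?thesis by simp
  qed
  have unit: "\<chi> ?e = quotient_unitor P \<longleftrightarrow> ?x ?e = struct_arr P (rep ?e)" if x: "?x ?e \<in> GHom (rep ?e) ?X ?X"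
  proof -
    have \<chi>: "\<chi> ?e \<in> Hom D (?o ?e ?X) ?X" using x ty by simp
    have "\<chi> ?e = quotient_unitor P \<longleftrightarrow> emb (?o ?e ?X) ?X (\<chi> ?e) = emb (?o ?e ?X) ?X (quotient_unitor P)"
      using emb_inject[OF _ _ \<chi> quotient_unitor_Hom] by auto
    also have "\<dots> \<longleftrightarrow> ?x ?e \<cdot> pull (rep ?e) ?X = struct_arr P (rep ?e) \<cdot> pull (rep ?e) ?X"
      using \<chi> by (simp add: emb_\<chi> emb_quotient_unitor)
    also have "\<dots> \<longleftrightarrow> ?x ?e = struct_arr P (rep ?e)"
      using gcomp_pull_cancel[OF _ _ x struct_GHom[OF P rep_one], of "rep ?e"] by auto
    finally show ?thesis .
  qed
  show ?thesis
    unfolding category_action.equivariant_structures_Hom_iff[OF quotient_category_action P]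
    using HomDH mult unit
    by (simp add: quotient_action_def lift_sel Comp_equivariant cong: conj_cong) blast
qed

section \<open>Equivariance in stages\<close>

definition descend_arr :: "'o \<times> ('g \<Rightarrow> 'm) \<Rightarrow> ('g set \<Rightarrow> 'm) \<Rightarrow> 'g \<Rightarrow> ('o \<times> 'g \<times> 'm \<times> 'o) option" where
  "descend_arr P \<chi> g = quotient_arr P \<chi> (H #>\<^bsub>G\<^esub> g) \<cdot>
     struct_arr P (inv\<^bsub>G\<^esub> (rep (H #>\<^bsub>G\<^esub> g)) \<otimes>\<^bsub>G\<^esub> g)"

definition descend :: "('o \<times> ('g \<Rightarrow> 'm)) \<times> ('g set \<Rightarrow> 'm) \<Rightarrow> 'o \<times> ('g \<Rightarrow> 'm)" where
  "descend R = (fst (fst R), \<lambda>g \<in> carrier G. mor (descend_arr (fst R) (snd R) g))"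

definition ascend :: "'o \<times> ('g \<Rightarrow> 'm) \<Rightarrow> ('o \<times> ('g \<Rightarrow> 'm)) \<times> ('g set \<Rightarrow> 'm)" where
  "ascend Q = ((fst Q, restrict (snd Q) H), \<lambda>c \<in> carrier GmodH. snd Q (rep c))"

abbreviation DQ :: "('k, ('o \<times> ('g \<Rightarrow> 'm)) \<times> ('g set \<Rightarrow> 'm), 'm) lin_cat" where
  "DQ \<equiv> equivariant_category GmodH DH quotient_action"

abbreviation DG :: "('k, 'o \<times> ('g \<Rightarrow> 'm), 'm) lin_cat" where
  "DG \<equiv> equivariant_category G D A"

lemma
  assumes R: "R \<in> Obj DQ"
  shows DQ_fst: "fst R \<in> Obj DH"
    and DQ_extensional: "snd R \<in> extensional (carrier GmodH)"
    and quotient_GHom: "\<And>c. c \<in> carrier GmodH \<Longrightarrow>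
      quotient_arr (fst R) (snd R) c \<in> GHom (rep c) (fst (fst R)) (fst (fst R))"
    and struct_quotient: "\<And>c h. c \<in> carrier GmodH \<Longrightarrow> h \<in> H \<Longrightarrow> struct_arr (fst R) h \<cdot> quotient_arr (fst R) (snd R) c =
      quotient_arr (fst R) (snd R) c \<cdot> struct_arr (fst R) (inv\<^bsub>G\<^esub> (rep c) \<otimes>\<^bsub>G\<^esub> h \<otimes>\<^bsub>G\<^esub> rep c)"
    and quotient_mult: "\<And>c d. c \<in> carrier GmodH \<Longrightarrow> d \<in> carrier GmodH \<Longrightarrow>
      quotient_arr (fst R) (snd R) (c \<otimes>\<^bsub>GmodH\<^esub> d) = quotient_arr (fst R) (snd R) c \<cdot> quotient_arr (fst R) (snd R) d \<cdot>
        struct_arr (fst R) (inv\<^bsub>G\<^esub> (rep c \<otimes>\<^bsub>G\<^esub> rep d) \<otimes>\<^bsub>G\<^esub> rep (c \<otimes>\<^bsub>GmodH\<^esub> d))"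
    and quotient_one: "quotient_arr (fst R) (snd R) \<one>\<^bsub>GmodH\<^esub> = struct_arr (fst R) (rep \<one>\<^bsub>GmodH\<^esub>)"
proof -
  show *: "fst R \<in> Obj DH" using R by (simp add: Obj_equivariant[of R])
  have "snd R \<in> equivariant_structures GmodH DH quotient_action (fst R)"
    using R by (simp add: Obj_equivariant[of R])
  note iff = this[unfolded quotient_structures_iff[OF *]]
  show "snd R \<in> extensional (carrier GmodH)"
    "\<And>c. c \<in> carrier GmodH \<Longrightarrow> quotient_arr (fst R) (snd R) c \<in> GHom (rep c) (fst (fst R)) (fst (fst R))"
    "\<And>c h. c \<in> carrier GmodH \<Longrightarrow> h \<in> H \<Longrightarrow> struct_arr (fst R) h \<cdot> quotient_arr (fst R) (snd R) c =
      quotient_arr (fst R) (snd R) c \<cdot> struct_arr (fst R) (inv\<^bsub>G\<^esub> (rep c) \<otimes>\<^bsub>G\<^esub> h \<otimes>\<^bsub>G\<^esub> rep c)"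
    "\<And>c d. c \<in> carrier GmodH \<Longrightarrow> d \<in> carrier GmodH \<Longrightarrow>
      quotient_arr (fst R) (snd R) (c \<otimes>\<^bsub>GmodH\<^esub> d) = quotient_arr (fst R) (snd R) c \<cdot> quotient_arr (fst R) (snd R) d \<cdot>
        struct_arr (fst R) (inv\<^bsub>G\<^esub> (rep c \<otimes>\<^bsub>G\<^esub> rep d) \<otimes>\<^bsub>G\<^esub> rep (c \<otimes>\<^bsub>GmodH\<^esub> d))"
    "quotient_arr (fst R) (snd R) \<one>\<^bsub>GmodH\<^esub> = struct_arr (fst R) (rep \<one>\<^bsub>GmodH\<^esub>)"
    using iff by simp_all
qed

lemma descend_GHom:
  assumes R: "R \<in> Obj DQ" and g: "g \<in> carrier G"
  shows "descend_arr (fst R) (snd R) g \<in> GHom g (fst (fst R)) (fst (fst R))"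
  using gcomp_closed[OF quotient_GHom[OF R rep_rcos(1)[OF g]] struct_GHom[OF DQ_fst[OF R] rep_rcos(2)[OF g]]]
    g rep_closed[OF rep_rcos(1)[OF g]]
  by (simp add: descend_arr_def cancel_inv_left)

text \<open>In the product on the right, the structure arrow of the first factor moves past the
  quotient arrow of the second by \<open>struct_quotient\<close>. On the left,
  \<open>quotient_mult\<close> splits the quotient arrow of the product coset. Then only elements of
  \<open>H\<close> are left to compare.\<close>

lemma descend_mult:
  assumes R: "R \<in> Obj DQ" and g: "g \<in> carrier G" and k: "k \<in> carrier G"
  shows "descend_arr (fst R) (snd R) (g \<otimes>\<^bsub>G\<^esub> k) = descend_arr (fst R) (snd R) g \<cdot> descend_arr (fst R) (snd R) k"
proof -
  let ?c = "H #>\<^bsub>G\<^esub> g" and ?d = "H #>\<^bsub>G\<^esub> k"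
  note P = DQ_fst[OF R] and c = rep_rcos(1)[OF g] and d = rep_rcos(1)[OF k]
  have cd: "H #>\<^bsub>G\<^esub> (g \<otimes>\<^bsub>G\<^esub> k) = ?c \<otimes>\<^bsub>GmodH\<^esub> ?d" using GmodH_mult[OF g k] by simp
  have m: "inv\<^bsub>G\<^esub> (rep (?c \<otimes>\<^bsub>GmodH\<^esub> ?d)) \<otimes>\<^bsub>G\<^esub> (g \<otimes>\<^bsub>G\<^esub> k) \<in> H"
    using rep_rcos(2)[of "g \<otimes>\<^bsub>G\<^esub> k"] g k cd by simp
  \<comment> \<open>Both sides cancel to the inverse of the product of the two representatives,
    times \<open>gk\<close>.\<close>
  have eq: "inv\<^bsub>G\<^esub> (rep ?c \<otimes>\<^bsub>G\<^esub> rep ?d) \<otimes>\<^bsub>G\<^esub> rep (?c \<otimes>\<^bsub>GmodH\<^esub> ?d) \<otimes>\<^bsub>G\<^esub> (inv\<^bsub>G\<^esub> (rep (?c \<otimes>\<^bsub>GmodH\<^esub> ?d)) \<otimes>\<^bsub>G\<^esub> (g \<otimes>\<^bsub>G\<^esub> k)) =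
    inv\<^bsub>G\<^esub> (rep ?d) \<otimes>\<^bsub>G\<^esub> (inv\<^bsub>G\<^esub> (rep ?c) \<otimes>\<^bsub>G\<^esub> g) \<otimes>\<^bsub>G\<^esub> rep ?d \<otimes>\<^bsub>G\<^esub> (inv\<^bsub>G\<^esub> (rep ?d) \<otimes>\<^bsub>G\<^esub> k)"
    using g k rep_closed[OF c] rep_closed[OF d] rep_closed[OF GmodH_closed[OF c d]]
    by (simp add: group_cancel_simps)
  show ?thesis
    unfolding descend_arr_def cd
    using P c d m rep_mult[OF c d] rep_rcos(2)[OF g] rep_rcos(2)[OF k] inv_op_closed1[OF rep_closed[OF d] rep_rcos(2)[OF g]]
      struct_quotient[OF R d rep_rcos(2)[OF g], THEN gcomp_eq_assoc]
    by (simp add: quotient_mult[OF R] struct_simps eq)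
qed

text \<open>On the trivial coset the quotient arrow is the structure arrow at its representative,
  which cancels in the product. With \<open>descend_rep\<close>, the descended family contains both
  original families.\<close>

lemma descend_struct:
  assumes R: "R \<in> Obj DQ" and h: "h \<in> H"
  shows "descend_arr (fst R) (snd R) h = struct_arr (fst R) h"
proof -
  have "H #>\<^bsub>G\<^esub> h = \<one>\<^bsub>GmodH\<^esub>" using coset_join2[OF _ subgroup_axioms h] h by (simp add: GmodH_one)
  then show ?thesis
    using h rep_one DQ_fst[OF R] quotient_one[OF R]
    by (simp add: descend_arr_def struct_mult cancel_inv_left)
qed

lemma descend_rep:
  assumes R: "R \<in> Obj DQ" and c: "c \<in> carrier GmodH"
  shows "descend_arr (fst R) (snd R) (rep c) = quotient_arr (fst R) (snd R) c"
  using rep_closed[OF c] gcomp_gid[OF quotient_GHom[OF R c]] DQ_fst[OF R]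
  by (simp add: descend_arr_def rcos_rep[OF c] struct_one)

lemma family_arr_descend:
  assumes R: "R \<in> Obj DQ" and g: "g \<in> carrier G"
  shows "family_arr (fst (fst R)) (snd (descend R)) g = descend_arr (fst R) (snd R) g"
  using Some_mor[OF descend_GHom[OF R g]] g by (simp add: family_arr_def descend_def)

lemma descend_closed:
  assumes R: "R \<in> Obj DQ"
  shows "descend R \<in> Obj DG"
proof -
  note X = Obj_DH_fst[OF DQ_fst[OF R]]
  have "snd (descend R) \<in> extensional (carrier G)" by (simp add: descend_def)
  moreover have "descend_arr (fst R) (snd R) \<one>\<^bsub>G\<^esub> = gid (fst (fst R))"
    using descend_struct[OF R one_closed] struct_one[OF DQ_fst[OF R]] by simp
  ultimately have "snd (descend R) \<in> equivariant_structures G D A (fst (fst R))"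
    using R by (simp add: equivariant_structures_self_iff[OF X] family_arr_descend descend_GHom descend_mult)
  then show ?thesis using X by (simp add: Obj_equivariant[of "descend R"]) (simp add: descend_def)
qed

lemma
  shows struct_ascend: "\<And>h. h \<in> H \<Longrightarrow> struct_arr (fst (ascend Q)) h = family_arr (fst Q) (snd Q) h"
    and quotient_ascend: "\<And>c. c \<in> carrier GmodH \<Longrightarrow> quotient_arr (fst (ascend Q)) (snd (ascend Q)) c = family_arr (fst Q) (snd Q) (rep c)"
  by (simp_all add: struct_arr_def family_arr_def ascend_def quotient_arr_def)

text \<open>All arrows are values of one homomorphism on \<open>G\<close>, so each clause of
  \<open>quotient_structures_iff\<close> becomes an equality of group elements.\<close>

lemma ascend_closed:
  assumes Q: "Q \<in> Obj DG"
  shows "ascend Q \<in> Obj DQ"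
proof -
  have X: "fst Q \<in> Obj D" and \<phi>: "snd Q \<in> equivariant_structures G D A (fst Q)"
    using Q by (simp_all add: Obj_equivariant)
  note s = \<phi>[unfolded equivariant_structures_self_iff[OF X]]
  have fst_ascend: "fst (fst (ascend Q)) = fst Q" by (simp add: ascend_def)
  have ext: "snd (fst (ascend Q)) \<in> extensional H" "snd (ascend Q) \<in> extensional (carrier GmodH)"
    by (simp_all add: ascend_def)
  have P: "fst (ascend Q) \<in> Obj DH"
    using X s ext by (simp add: Obj_DH fst_ascend struct_ascend)
  have m: "family_arr (fst Q) (snd Q) g \<cdot> family_arr (fst Q) (snd Q) k = family_arr (fst Q) (snd Q) (g \<otimes>\<^bsub>G\<^esub> k)"
    if "g \<in> carrier G" "k \<in> carrier G" for g k using s that by simp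
  have "snd (ascend Q) \<in> equivariant_structures GmodH DH quotient_action (fst (ascend Q))"
    unfolding quotient_structures_iff[OF P] fst_ascend
  proof (intro conjI ballI)
    fix c assume c: "c \<in> carrier GmodH"
    show "quotient_arr (fst (ascend Q)) (snd (ascend Q)) c \<in> GHom (rep c) (fst Q) (fst Q)"
      using s c by (simp add: quotient_ascend rep_closed)
    show "quotient_arr (fst (ascend Q)) (snd (ascend Q)) c \<cdot> struct_arr (fst (ascend Q)) (inv\<^bsub>G\<^esub> (rep c) \<otimes>\<^bsub>G\<^esub> h \<otimes>\<^bsub>G\<^esub> rep c) =
        struct_arr (fst (ascend Q)) h \<cdot> quotient_arr (fst (ascend Q)) (snd (ascend Q)) c" if h: "h \<in> H" for h
      using c h inv_op_closed1[OF rep_closed[OF c] h] rep_closed[OF c]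
      by (simp add: quotient_ascend struct_ascend m) (simp add: group_cancel_simps)
    show "quotient_arr (fst (ascend Q)) (snd (ascend Q)) (c \<otimes>\<^bsub>GmodH\<^esub> d) = quotient_arr (fst (ascend Q)) (snd (ascend Q)) c \<cdot>
        quotient_arr (fst (ascend Q)) (snd (ascend Q)) d \<cdot>
        struct_arr (fst (ascend Q)) (inv\<^bsub>G\<^esub> (rep c \<otimes>\<^bsub>G\<^esub> rep d) \<otimes>\<^bsub>G\<^esub> rep (c \<otimes>\<^bsub>GmodH\<^esub> d))" if d: "d \<in> carrier GmodH" for d
      using c d rep_mult[OF c d] rep_closed[OF c] rep_closed[OF d] rep_closed[OF GmodH_closed[OF c d]]
      by (simp add: quotient_ascend struct_ascend m GmodH_closed) (simp add: group_cancel_simps)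
  next
    show "quotient_arr (fst (ascend Q)) (snd (ascend Q)) \<one>\<^bsub>GmodH\<^esub> = struct_arr (fst (ascend Q)) (rep \<one>\<^bsub>GmodH\<^esub>)"
      using rep_one monoid.one_closed[OF group.is_monoid[OF group_GmodH]]
      by (simp add: quotient_ascend struct_ascend)
  qed (rule ext)
  with P show ?thesis by (simp add: Obj_equivariant[of "ascend Q"])
qed

text \<open>By \<open>descend_struct\<close> and \<open>descend_rep\<close> both families are
  recovered on their index sets. Extensionality makes this an equality of objects and not merely an
  isomorphism.\<close>

lemma ascend_descend:
  assumes R: "R \<in> Obj DQ"
  shows "ascend (descend R) = R"
proof -
  have "restrict (snd (descend R)) H = snd (fst R)"
  proof (rule extensionalityI[of _ H])
    show "snd (fst R) \<in> extensional H" using DQ_fst[OF R] by (simp add: Obj_DH)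
    show "restrict (snd (descend R)) H h = snd (fst R) h" if "h \<in> H" for h
      using family_arr_descend[OF R, of h] descend_struct[OF R that] that
      by (simp add: family_arr_def struct_arr_def)
  qed simp
  moreover have "(\<lambda>c \<in> carrier GmodH. snd (descend R) (rep c)) = snd R"
  proof (rule extensionalityI[of _ "carrier GmodH"])
    show "(\<lambda>c \<in> carrier GmodH. snd (descend R) (rep c)) c = snd R c" if "c \<in> carrier GmodH" for c
      using family_arr_descend[OF R rep_closed[OF that]] descend_rep[OF R that] that
      by (simp add: family_arr_def quotient_arr_def)
  qed (use DQ_extensional[OF R] in simp_all)
  ultimately show ?thesis by (simp add: ascend_def prod_eq_iff) (simp add: descend_def)
qed

text \<open>A homomorphism on \<open>G\<close> is determined by its values on \<open>H\<close> and
  on the representatives, since \<open>g\<close> is the representative of its coset times an element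
  of \<open>H\<close>.\<close>

lemma descend_ascend:
  assumes Q: "Q \<in> Obj DG"
  shows "descend (ascend Q) = Q"
proof -
  have X: "fst Q \<in> Obj D" and \<phi>: "snd Q \<in> equivariant_structures G D A (fst Q)"
    using Q by (simp_all add: Obj_equivariant)
  note s = \<phi>[unfolded equivariant_structures_self_iff[OF X]]
  have fst_ascend: "fst (fst (ascend Q)) = fst Q" by (simp add: ascend_def)
  have "snd (descend (ascend Q)) = snd Q"
  proof (rule extensionalityI[of _ "carrier G"])
    show "snd (descend (ascend Q)) \<in> extensional (carrier G)" by (simp add: descend_def)
    show "snd Q \<in> extensional (carrier G)" using s by simp
    fix g assume g: "g \<in> carrier G"
    note c = rep_rcos(1)[OF g]
    have "family_arr (fst Q) (snd (descend (ascend Q))) g =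
        family_arr (fst Q) (snd Q) (rep (H #>\<^bsub>G\<^esub> g)) \<cdot> family_arr (fst Q) (snd Q) (inv\<^bsub>G\<^esub> (rep (H #>\<^bsub>G\<^esub> g)) \<otimes>\<^bsub>G\<^esub> g)"
      using family_arr_descend[OF ascend_closed[OF Q] g] rep_rcos(2)[OF g]
      by (simp add: descend_arr_def fst_ascend quotient_ascend[OF c] struct_ascend)
    also have "\<dots> = family_arr (fst Q) (snd Q) (rep (H #>\<^bsub>G\<^esub> g) \<otimes>\<^bsub>G\<^esub> (inv\<^bsub>G\<^esub> (rep (H #>\<^bsub>G\<^esub> g)) \<otimes>\<^bsub>G\<^esub> g))"
      using s g rep_closed[OF c] by simp
    also have "\<dots> = family_arr (fst Q) (snd Q) g" using g rep_closed[OF c] by (simp add: cancel_inv_left)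
    finally show "snd (descend (ascend Q)) g = snd Q g" by (simp add: family_arr_def)
  qed
  then show ?thesis by (simp add: prod_eq_iff) (simp add: descend_def fst_ascend)
qed

text \<open>The descended arrows are products of structure and quotient arrows and include all of
  these. A morphism therefore commutes with the descended arrows exactly when it commutes with both
  families.\<close>

lemma Hom_descend:
  assumes R: "R \<in> Obj DQ" and S: "S \<in> Obj DQ"
  shows "Hom DG (descend R) (descend S) = Hom DQ R S"
proof (rule Set.set_eqI)
  fix f
  let ?X = "fst (fst R)" and ?Y = "fst (fst S)"
  let ?f = "emb ?X ?Y f"
  note P = DQ_fst[OF R] and P' = DQ_fst[OF S]
  note X = Obj_DH_fst[OF P] and Y = Obj_DH_fst[OF P']
  have [simp]: "fst (descend R) = ?X" "fst (descend S) = ?Y" by (simp_all add: descend_def)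
  have G: "f \<in> Hom DG (descend R) (descend S) \<longleftrightarrow> f \<in> Hom D ?X ?Y \<and>
      (\<forall>g \<in> carrier G. ?f \<cdot> descend_arr (fst R) (snd R) g = descend_arr (fst S) (snd S) g \<cdot> ?f)"
    using R S by (simp add: Hom_equivariant_emb descend_closed family_arr_descend)
  have "f \<odot>\<^bsub>D\<^esub> snd R c = snd S c \<odot>\<^bsub>D\<^esub> on_mor (act A (rep c)) ?X ?Y f \<longleftrightarrow>
      ?f \<cdot> quotient_arr (fst R) (snd R) c = quotient_arr (fst S) (snd S) c \<cdot> ?f"
    if "f \<in> Hom D ?X ?Y" "c \<in> carrier GmodH" for c
    using that X Y quotient_GHom[OF R that(2)] quotient_GHom[OF S that(2)]
    by (simp add: quotient_arr_def Some_GHom_iff emb_gcomp_Some Some_gcomp_emb)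
  then have Q: "f \<in> Hom DQ R S \<longleftrightarrow> f \<in> Hom D ?X ?Y \<and>
      (\<forall>h \<in> H. ?f \<cdot> struct_arr (fst R) h = struct_arr (fst S) h \<cdot> ?f) \<and>
      (\<forall>c \<in> carrier GmodH. ?f \<cdot> quotient_arr (fst R) (snd R) c = quotient_arr (fst S) (snd S) c \<cdot> ?f)"
    using P P' by (auto simp: Hom_equivariant[of f _ _ _ R] Hom_DH Comp_equivariant quotient_action_def lift_sel)
  show "f \<in> Hom DG (descend R) (descend S) \<longleftrightarrow> f \<in> Hom DQ R S"
    unfolding G Q
  proof (intro conj_cong refl iffI conjI ballI)
    fix h assume "\<forall>g \<in> carrier G. ?f \<cdot> descend_arr (fst R) (snd R) g = descend_arr (fst S) (snd S) g \<cdot> ?f" "h \<in> H"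
    then show "?f \<cdot> struct_arr (fst R) h = struct_arr (fst S) h \<cdot> ?f"
      using descend_struct[OF R] descend_struct[OF S] mem_carrier by metis
  next
    fix c assume "\<forall>g \<in> carrier G. ?f \<cdot> descend_arr (fst R) (snd R) g = descend_arr (fst S) (snd S) g \<cdot> ?f" "c \<in> carrier GmodH"
    then show "?f \<cdot> quotient_arr (fst R) (snd R) c = quotient_arr (fst S) (snd S) c \<cdot> ?f"
      using descend_rep[OF R] descend_rep[OF S] rep_closed by metis
  next
    fix g assume *: "(\<forall>h \<in> H. ?f \<cdot> struct_arr (fst R) h = struct_arr (fst S) h \<cdot> ?f) \<and>
      (\<forall>c \<in> carrier GmodH. ?f \<cdot> quotient_arr (fst R) (snd R) c = quotient_arr (fst S) (snd S) c \<cdot> ?f)" "g \<in> carrier G"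
    then show "?f \<cdot> descend_arr (fst R) (snd R) g = descend_arr (fst S) (snd S) g \<cdot> ?f"
      unfolding descend_arr_def using rep_rcos(1,2)[OF *(2)] by (metis gcomp_assoc)
  qed
qed

lemma quotient_equivalence: "equivalent_categories DQ DG"
proof (rule equivalent_categoriesI[where F = descend and G = ascend])
  show "linear_category DQ" 
    by (rule category_action.equivariant_linear_category[OF quotient_category_action])
  show "linear_category DG" by (rule equivariant_linear_category)
  show "descend R \<in> Obj DG \<and> ascend (descend R) = R \<and> Id DG (descend R) = Id DQ R" if "R \<in> Obj DQ" for R
    using that by (simp add: descend_closed ascend_descend Id_equivariant[of _ _ _ R] Id_equivariant)
      (simp add: descend_def)
qed (simp_all add: ascend_closed descend_ascend Hom_descend Comp_equivariant Scale_equivariant)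

end

theorem proposition2p11:
  fixes C :: "('k::field, 'o, 'm::ab_group_add) lin_cat"
    and \<Gamma> :: "('g, 'b) monoid_scheme"
    and A :: "('g, 'o, 'm) cat_action"
    and H :: "'g set"
  assumes "k_category C" and "Hom_finite C" and "Krull_Schmidt C"
    and "group \<Gamma>" and "finite (carrier \<Gamma>)" and "\<not> CHAR('k) dvd order \<Gamma>"
    and "category_action \<Gamma> C A"
    and "H \<lhd> \<Gamma>"
  shows "category_action (\<Gamma>\<lparr>carrier := H\<rparr>) C A \<and>
    (let CH = equivariant_category (\<Gamma>\<lparr>carrier := H\<rparr>) C A in
      \<exists>B. category_action \<Gamma> CH B \<and> forgetful_compatible \<Gamma> CH B A \<and>
        (\<forall>h \<in> H. isomorphic_functors CH CH (act B h) id_funct) \<and>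
        (\<exists>Q. category_action (\<Gamma> Mod H) CH Q \<and>
          (\<forall>g \<in> carrier \<Gamma>. isomorphic_functors CH CH (act Q (H #>\<^bsub>\<Gamma>\<^esub> g)) (act B g)) \<and>
          equivalent_categories (equivariant_category (\<Gamma> Mod H) CH Q)
            (equivariant_category \<Gamma> C A)))"
proof -
  interpret normal_action \<Gamma> C A H
    using assms(7,8) by (rule normal_action.intro)
  have B: "isomorphic_functors DH DH (act lifted_action h) id_funct" if "h \<in> H" for h
    using unitor_theta_natural_iso[OF that] by (auto simp: isomorphic_functors_def lifted_action_def)
  \<comment> \<open>\<open>theta\<close> leads from the chosen representative of the coset of
    \<open>g\<close> to \<open>g\<close> itself.\<close>
  have Q: "isomorphic_functors DH DH (act quotient_action (H #>\<^bsub>\<Gamma>\<^esub> g)) (act lifted_action g)"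
    if "g \<in> carrier \<Gamma>" for g
    using theta_natural_iso[OF rep_closed[OF rep_rcos(1)[OF that]] that rep_rcos(3)[OF that]]
    by (auto simp: isomorphic_functors_def lifted_action_def quotient_action_def)
  show ?thesis
    unfolding Let_def
    using restrict_action[OF subgroup_axioms] lifted_category_action lifted_forgetful_compatible B
      quotient_category_action Q quotient_equivalence
    by blast
qed

end
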